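(* Let $(\mathcal W\cup\mathcal W',\mathcal Y\cup\mathcal Y')$ be an $m$-triangular labyrinth patterns system such that there is a unique $\pi=\{i,j\}\in\mathcal P=\{\{1,2\},\{1,3\},\{2,3\}\}$ for which the system is not $\pi$-blocked, and let $\{k\}=\{1,2,3\}\setminus\{i,j\}$. Then the length of the arc in $L^{w}_\infty$ (respectively, in $L^{y}_\infty$) that connects two distinct points of $L^{w}_\infty$ (respectively, of $L^{y}_\infty$) is finite if and only if the arc coincides with the straight line segment defined by the two points, this segment being contained in the fractal and parallel to the side $\varrho_k$ of $T_1$.
   Context: **Triangles.** Let $H=\{(\alpha_1,\alpha_2,\alpha_3)\in[0,1]^3:\alpha_1+\alpha_2+\alpha_3=1\}$, $\mathbb N=\{0,1,2,\dots\}$, $\mathbf P_1=(0,0)$, $\mathbf P_2=(1,0)$, $\mathbf P_3=(1/2,\sqrt3/2)$. $\Delta(\mathbf A_1,\mathbf A_2,\mathbf A_3)$ denotes the full closed triangle with (ordered) vertices $\mathbf A_1,\mathbf A_2,\mathbf A_3$, and $T_1=\Delta(\mathbf P_1,\mathbf P_2,\mathbf P_3)$; $\varrho_k$ is the side of $T_1$ opposite to $\mathbf P_k$. For $\Delta=\Delta(\mathbf A_1,\mathbf A_2,\mathbf A_3)\subset T_1$ let $P_\Delta:T_1\to T_1$, $\sum\alpha_i\mathbf P_i\mapsto\sum\alpha_i\mathbf A_i$ for $(\alpha_1,\alpha_2,\alpha_3)\in H$. For $m\ge2$ and $(k_1,k_2,k_3)\in\mathbb Z^3$, $T_m(k_1,k_2,k_3)$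 is the triangle with ordered vertices $\mathbf A_i=\frac1m\big(k_1\mathbf P_1+k_2\mathbf P_2+k_3\mathbf P_3+\mathbf P_i\big)$ and $T'_m(k_1,k_2,k_3)$ is the triangle with ordered vertices $\mathbf A_i=\frac1m\big(k_1\mathbf P_1+k_2\mathbf P_2+k_3\mathbf P_3+\mathbf P_1+\mathbf P_2+\mathbf P_3-\mathbf P_i\big)$, $i=1,2,3$. Put $\mathcal T_m=\{T_m(k_1,k_2,k_3):k_i\in\mathbb N,\ k_1+k_2+k_3=m-1\}$ and $\mathcal T'_m=\{T'_m(k_1,k_2,k_3):k_i\in\mathbb N,\ k_1+k_2+k_3=m-2\}$. $T_m(k_1,k_2,k_3)$ and $T'_m(k'_1,k'_2,k'_3)$ are $j$-neighbours if $k_j=k'_j+1$ and $k_i=k'_i$ for $i\ne j$ (they then share a side). For $i\in\{1,2,3\}$ and $K\in\{0,\dots,m-1\}$, the set of all $T_m(k_1,k_2,k_3)\in\mathcal T_m$ and $T'_m(k_1,k_2,k_3)\in\mathcal T'_m$ with $k_i=K$ is called a strip of type $i$. **Patterns systems.** An $m$-triangular patterns system is a pair $(\mathcal W\cup\mathcal W',\mathcal Y\cup\mathcal Y')$ with $\mathcal W,\mathcal Y\subset\mathcal T_m$ and $\mathcal W',\mathcal Y'\subset\mathcal T'_m$. Put $\mathcal W_1=\mathcal W$, $\mathcal W'_1=\mathcal W'$, $\mathcal Y_1=\mathcal Y$, $\mathcal Y'_1=\mathcal Y'$, and for $n\ge2$ $\mathcal W_n=\{P_{U}(V):U\in\mathcal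 W_{n-1},V\in\mathcal W_1\}\cup\{P_{U}(V):U\in\mathcal W'_{n-1},V\in\mathcal Y'_1\}$, $\mathcal W'_n=\{P_{U}(V):U\in\mathcal W_{n-1},V\in\mathcal W'_1\}\cup\{P_{U}(V):U\in\mathcal W'_{n-1},V\in\mathcal Y_1\}$, $\mathcal Y_n=\{P_{U}(V):U\in\mathcal Y_{n-1},V\in\mathcal Y_1\}\cup\{P_{U}(V):U\in\mathcal Y'_{n-1},V\in\mathcal W'_1\}$, $\mathcal Y'_n=\{P_{U}(V):U\in\mathcal Y_{n-1},V\in\mathcal Y'_1\}\cup\{P_{U}(V):U\in\mathcal Y'_{n-1},V\in\mathcal W_1\}$. $\mathcal G(\mathcal W\cup\mathcal W')$ is the undirected graph with vertex set $\mathcal W\cup\mathcal W'$ in which two vertices are joined by an edge labelled $j$ iff they are $j$-neighbours; $\mathcal G(\mathcal Y\cup\mathcal Y')$ is defined analogously. **Labyrinth patterns systems.** The system is an $m$-triangular labyrinth patterns system if: (1) (tree property) $\mathcal G(\mathcal W\cup\mathcal W')$ and $\mathcal G(\mathcal Y\cup\mathcal Y')$ are trees; (2) (exits property) there is exactly one triple $(k_1,k_2,k_3)$ of integers in $\{0,\dots,m-1\}$ with $T_m(0,k_1,m-1-k_1)\in\mathcal W$, $T_m(0,m-1-k_1,k_1)\in\mathcal Y$, $T_m(k_2,0,m-1-k_2)\in\mathcal W$, $T_m(m-1-k_2,0,k_2)\in\mathcal Y$, $T_m(k_3,m-1-k_3,0)\in\mathcal W$, $T_m(m-1-k_3,k_3,0)\in\mathcal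 Y$; (3) (corners property) the sets $\mathcal C(\mathcal W)$, $\mathcal C(\mathcal Y)$ of elements of $\mathcal W$, resp. $\mathcal Y$, that contain one of $\mathbf P_1,\mathbf P_2,\mathbf P_3$ are disjoint and each has at most one element. The exits of the patterns are $e^w_1=T_m(0,k_1,m-1-k_1)$, $e^w_2=T_m(k_2,0,m-1-k_2)$, $e^w_3=T_m(k_3,m-1-k_3,0)$ and $e^y_1=T_m(0,m-1-k_1,k_1)$, $e^y_2=T_m(m-1-k_2,0,k_2)$, $e^y_3=T_m(m-1-k_3,k_3,0)$. **Fractals.** $L^{w}_n$ (resp. $L^{y}_n$) is the union of all triangles in $\mathcal W_n\cup\mathcal W'_n$ (resp. $\mathcal Y_n\cup\mathcal Y'_n$). The white and yellow triangular labyrinth fractals are $L^{w}_\infty=\bigcap_{n\ge1}L^{w}_n$ and $L^{y}_\infty=\bigcap_{n\ge1}L^{y}_n$. They are dendrites, so any two distinct points are joined by a unique arc inside the fractal. The length of an arc is its one-dimensional (Lebesgue) measure. **Blocked.** For $\{i,j\}\in\mathcal P$ the white (yellow) path of type $\{i,j\}$ is the unique path in the tree $\mathcal G(\mathcal W\cup\mathcal W')$ (resp. $\mathcal G(\mathcal Y\cup\mathcal Y')$) from $e^w_i$ to $e^w_j$ (resp. $e^y_i$ to $e^y_j$). With $\{k\}=\{1,2,3\}\setminus\{i,j\}$, this path is blocked if it contains two triangles that are not contained in the same strip of type $k$. The system is $\pi$-blocked ($\pi\in\mathcal P$) if the white or the yellow path of type $\pi$ is blocked. *)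

theory Defs
  imports
    "HOL-Analysis.Analysis"
    "Graph_Theory.Digraph_Component"
    "Graph_Theory.Vertex_Walk"
begin

text \<open>
  The indices 1, 2, 3 are the elements of the type \<open>3\<close>. A triangle is the vector of its ordered
  vertices; the order matters for the maps \<open>P_\<Delta>\<close> (\<open>tri_map\<close> below).
\<close>

type_synonym triangle = "(real^2)^3"

definition P :: triangle where
  "P = vector [vector [0, 0], vector [1, 0], vector [1/2, sqrt 3 / 2]]"

definition solid :: "triangle \<Rightarrow> (real^2) set" where
  "solid A = convex hull (range (\<lambda>i. A $ i))"

definition side :: "3 \<Rightarrow> (real^2) set" where
  "side k = convex hull ((\<lambda>i. P $ i) ` (UNIV - {k}))"

definition parallel_to_side :: "3 \<Rightarrow> real^2 \<Rightarrow> bool" where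
  "parallel_to_side k v \<longleftrightarrow> (\<exists>a\<in>side k. \<exists>b\<in>side k. a \<noteq> b \<and> (\<exists>c. v = c *\<^sub>R (b - a)))"

definition H :: "(real^3) set" where
  "H = {\<alpha>. (\<forall>i. \<alpha> $ i \<in> {0..1}) \<and> (\<Sum>i\<in>UNIV. \<alpha> $ i) = 1}"

definition bary :: "real^2 \<Rightarrow> real^3" where
  "bary x = (THE \<alpha>. \<alpha> \<in> H \<and> x = (\<Sum>i\<in>UNIV. \<alpha> $ i *\<^sub>R P $ i))"

definition tri_map :: "triangle \<Rightarrow> real^2 \<Rightarrow> real^2" where
  "tri_map A x = (\<Sum>i\<in>UNIV. bary x $ i *\<^sub>R A $ i)"

definition tri_image :: "triangle \<Rightarrow> triangle \<Rightarrow> triangle" where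
  "tri_image U V = (\<chi> i. tri_map U (V $ i))"

definition T :: "nat \<Rightarrow> int^3 \<Rightarrow> triangle" where
  "T m k = (\<chi> i. (1 / real m) *\<^sub>R ((\<Sum>l\<in>UNIV. of_int (k $ l) *\<^sub>R P $ l) + P $ i))"

definition T' :: "nat \<Rightarrow> int^3 \<Rightarrow> triangle" where
  "T' m k = (\<chi> i. (1 / real m) *\<^sub>R
     ((\<Sum>l\<in>UNIV. of_int (k $ l) *\<^sub>R P $ l) + P $ 1 + P $ 2 + P $ 3 - P $ i))"

definition idx :: "int \<Rightarrow> (int^3) set" where
  "idx n = {k. (\<forall>i. 0 \<le> k $ i) \<and> (\<Sum>i\<in>UNIV. k $ i) = n}"

definition calT :: "nat \<Rightarrow> triangle set" where
  "calT m = T m ` idx (int m - 1)"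

definition calT' :: "nat \<Rightarrow> triangle set" where
  "calT' m = T' m ` idx (int m - 2)"

text \<open>
  Since \<open>P $ 1 = 0\<close>, a triangle determines its index triple only once the sum of the indices is
  fixed; neighbours and strips therefore refer to triples in \<open>idx\<close>.
\<close>

definition neighbours :: "nat \<Rightarrow> 3 \<Rightarrow> triangle \<Rightarrow> triangle \<Rightarrow> bool" where
  "neighbours m j A B \<longleftrightarrow>
     (\<exists>k\<in>idx (int m - 1). \<exists>k'\<in>idx (int m - 2). A = T m k \<and> B = T' m k' \<and>
        k $ j = k' $ j + 1 \<and> (\<forall>i. i \<noteq> j \<longrightarrow> k $ i = k' $ i))"

definition strip :: "nat \<Rightarrow> 3 \<Rightarrow> int \<Rightarrow> triangle set" where
  "strip m i K = {T m k | k. k \<in> idx (int m - 1) \<and> k $ i = K} \<union>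
                 {T' m k | k. k \<in> idx (int m - 2) \<and> k $ i = K}"

text \<open>
  The fields are, in this order, the sets \<open>W\<close>, \<open>W'\<close>, \<open>Y\<close>, \<open>Y'\<close>.
\<close>

record patterns =
  white_up :: "triangle set"
  white_down :: "triangle set"
  yellow_up :: "triangle set"
  yellow_down :: "triangle set"

definition patterns_system :: "nat \<Rightarrow> patterns \<Rightarrow> bool" where
  "patterns_system m S \<longleftrightarrow>
     white_up S \<subseteq> calT m \<and> white_down S \<subseteq> calT' m \<and>
     yellow_up S \<subseteq> calT m \<and> yellow_down S \<subseteq> calT' m"

definition images :: "triangle set \<Rightarrow> triangle set \<Rightarrow> triangle set" where
  "images X Z = {tri_image U V | U V. U \<in> X \<and> V \<in> Z}"

definition refine :: "patterns \<Rightarrow> patterns \<Rightarrow> patterns" where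
  "refine S L = \<lparr>
     white_up = images (white_up L) (white_up S) \<union> images (white_down L) (yellow_down S),
     white_down = images (white_up L) (white_down S) \<union> images (white_down L) (yellow_up S),
     yellow_up = images (yellow_up L) (yellow_up S) \<union> images (yellow_down L) (white_down S),
     yellow_down = images (yellow_up L) (yellow_down S) \<union> images (yellow_down L) (white_up S)\<rparr>"

text \<open>Only the levels \<open>n \<ge> 1\<close> are meaningful; level 1 is the system itself.\<close>

definition level :: "patterns \<Rightarrow> nat \<Rightarrow> patterns" where
  "level S n = (refine S ^^ (n - 1)) S"

definition white_fractal :: "patterns \<Rightarrow> (real^2) set" where
  "white_fractal S = (\<Inter>n\<in>{1..}. \<Union>A\<in>white_up (level S n) \<union> white_down (level S n). solid A)"

definition yellow_fractal :: "patterns \<Rightarrow> (real^2) set" where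
  "yellow_fractal S = (\<Inter>n\<in>{1..}. \<Union>A\<in>yellow_up (level S n) \<union> yellow_down (level S n). solid A)"

text \<open>
  An undirected graph is represented by the symmetric digraph with both orientations of each edge.
  Going back and forth along one edge is then a directed cycle of length 2, which is why
  \<open>Digraph_Component.tree\<close> is not applicable: the cycles of the undirected (loopless, simple) graph
  are the directed cycles of length at least 3. Edge labels are omitted, as a pair of
  neighbours determines its label.
\<close>

definition pattern_graph :: "nat \<Rightarrow> triangle set \<Rightarrow> triangle pair_pre_digraph" where
  "pattern_graph m V =
     \<lparr> pverts = V,
       parcs = {(A, B). A \<in> V \<and> B \<in> V \<and> (\<exists>j. neighbours m j A B \<or> neighbours m j B A)} \<rparr>"

definition undirected_tree :: "'a pair_pre_digraph \<Rightarrow> bool" where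
  "undirected_tree G \<longleftrightarrow>
     Digraph_Component.connected (with_proj G) \<and>
     \<not> (\<exists>p. pre_digraph.cycle (with_proj G) p \<and> 3 \<le> length p)"

definition tree_path :: "'a pair_pre_digraph \<Rightarrow> 'a \<Rightarrow> 'a \<Rightarrow> 'a list" where
  "tree_path G u v = (THE p. vpath p (with_proj G) \<and> hd p = u \<and> last p = v)"

definition white_graph :: "nat \<Rightarrow> patterns \<Rightarrow> triangle pair_pre_digraph" where
  "white_graph m S = pattern_graph m (white_up S \<union> white_down S)"

definition yellow_graph :: "nat \<Rightarrow> patterns \<Rightarrow> triangle pair_pre_digraph" where
  "yellow_graph m S = pattern_graph m (yellow_up S \<union> yellow_down S)"

definition tree_property :: "nat \<Rightarrow> patterns \<Rightarrow> bool" where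
  "tree_property m S \<longleftrightarrow> undirected_tree (white_graph m S) \<and> undirected_tree (yellow_graph m S)"

definition white_exit :: "nat \<Rightarrow> int^3 \<Rightarrow> 3 \<Rightarrow> triangle" where
  "white_exit m k i = T m
     (if i = 1 then vector [0, k $ 1, int m - 1 - k $ 1]
      else if i = 2 then vector [k $ 2, 0, int m - 1 - k $ 2]
      else vector [k $ 3, int m - 1 - k $ 3, 0])"

definition yellow_exit :: "nat \<Rightarrow> int^3 \<Rightarrow> 3 \<Rightarrow> triangle" where
  "yellow_exit m k i = T m
     (if i = 1 then vector [0, int m - 1 - k $ 1, k $ 1]
      else if i = 2 then vector [int m - 1 - k $ 2, 0, k $ 2]
      else vector [int m - 1 - k $ 3, k $ 3, 0])"

definition exit_triple :: "nat \<Rightarrow> patterns \<Rightarrow> int^3 \<Rightarrow> bool" where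
  "exit_triple m S k \<longleftrightarrow>
     (\<forall>i. k $ i \<in> {0..int m - 1} \<and> white_exit m k i \<in> white_up S \<and> yellow_exit m k i \<in> yellow_up S)"

definition exits_property :: "nat \<Rightarrow> patterns \<Rightarrow> bool" where
  "exits_property m S \<longleftrightarrow> (\<exists>!k. exit_triple m S k)"

definition corner_triangles :: "triangle set \<Rightarrow> triangle set" where
  "corner_triangles X = {A \<in> X. \<exists>i. P $ i \<in> solid A}"

definition corners_property :: "patterns \<Rightarrow> bool" where
  "corners_property S \<longleftrightarrow>
     corner_triangles (white_up S) \<inter> corner_triangles (yellow_up S) = {} \<and>
     (\<forall>X\<in>{white_up S, yellow_up S}. \<forall>A\<in>corner_triangles X. \<forall>B\<in>corner_triangles X. A = B)"

definition labyrinth_patterns_system :: "nat \<Rightarrow> patterns \<Rightarrow> bool" where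
  "labyrinth_patterns_system m S \<longleftrightarrow>
     patterns_system m S \<and> tree_property m S \<and> exits_property m S \<and> corners_property S"

definition white_path :: "nat \<Rightarrow> patterns \<Rightarrow> 3 \<Rightarrow> 3 \<Rightarrow> triangle list" where
  "white_path m S i j =
     (let k = (THE k. exit_triple m S k)
      in tree_path (white_graph m S) (white_exit m k i) (white_exit m k j))"

definition yellow_path :: "nat \<Rightarrow> patterns \<Rightarrow> 3 \<Rightarrow> 3 \<Rightarrow> triangle list" where
  "yellow_path m S i j =
     (let k = (THE k. exit_triple m S k)
      in tree_path (yellow_graph m S) (yellow_exit m k i) (yellow_exit m k j))"

definition path_blocked :: "nat \<Rightarrow> 3 \<Rightarrow> triangle list \<Rightarrow> bool" where
  "path_blocked m k p \<longleftrightarrow>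
     (\<exists>A\<in>set p. \<exists>B\<in>set p. \<not> (\<exists>K\<in>{0..int m - 1}. A \<in> strip m k K \<and> B \<in> strip m k K))"

definition index_pairs :: "3 set set" where
  "index_pairs = {{1, 2}, {1, 3}, {2, 3}}"

definition pair_blocked :: "nat \<Rightarrow> patterns \<Rightarrow> 3 set \<Rightarrow> bool" where
  "pair_blocked m S \<pi> \<longleftrightarrow>
     (\<exists>i j k. \<pi> = {i, j} \<and> i \<noteq> j \<and> {k} = UNIV - {i, j} \<and>
        (path_blocked m k (white_path m S i j) \<or> path_blocked m k (yellow_path m S i j)))"

text \<open>
  One-dimensional Hausdorff (outer) measure, normalised so that it is Lebesgue measure on lines.
  Boundedness is required because \<open>diameter\<close> is meaningless on unbounded sets.
\<close>

definition hausdorff_measure1 :: "'a::metric_space set \<Rightarrow> ennreal" where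
  "hausdorff_measure1 X =
     (SUP \<delta>\<in>{0<..}. INF U\<in>{U :: nat \<Rightarrow> 'a set. X \<subseteq> (\<Union>n. U n) \<and>
        (\<forall>n. bounded (U n) \<and> diameter (U n) \<le> \<delta>)}. \<Sum>n. ennreal (diameter (U n)))"

end

theory Submission
  imports Defs
begin

text \<open>
  The parts of the fractal in two level-\<open>n\<close> triangles share at most an exit point, so an arc
  runs through a path of triangles, from exit to exit. Let \<open>{i, j}\<close> be the pair that is not
  blocked. A crossing from side \<open>i\<close> to side \<open>j\<close> gains no height, where the height is the \<open>k\<close>-th
  barycentric coordinate. Suppose that some crossing from side \<open>i\<close> or \<open>j\<close> to side \<open>k\<close> has
  finite length, and take one with the least length per height. As it is composed of scaled
  crossings, it can only contain crossings of the same minimal ratio, hence none of type \<open>{i, j}\<close>;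
  if moreover its slope is extremal, all pieces have the same slope, its path stays in one strip,
  and a second pair is not blocked. So every crossing that gains height is infinitely long. An arc
  of finite length can therefore change its height only in its first and last triangle at each
  level, which leaves only a horizontal segment.
\<close>

section \<open>Length and one-dimensional Hausdorff measure\<close>

text \<open>The least length per height is attained because there are only finitely many kinds of
  crossings: a colour and a side \<open>i\<close> or \<open>j\<close>. A crossing is at least as
  long as the scaled crossings along its path of cells together, while its height is at most the sum
  of theirs, so minimality leaves no slack. Its slope is then the mean of their slopes, weighted by
  height, and a maximum equals a mean only if all terms agree. Within one colour the slope tells
  crossings from \<open>i\<close> and from \<open>j\<close> apart, so up cells use two sides only,
  and down cells share their sides with up cells. A pair is blocked as soon as one colour is, so the
  argument has to reach both colours: the second cell of the path is a down cell and carries the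
  other one. In barycentric coordinates cells are homotheties with integer data, and touching points
  are found by integrality. The change of coordinates is Lipschitz, which suffices as only
  finiteness of length is transported. Length is the variation of a parametrised arc: it is bounded
  by Hausdorff measure for arcs, and Hausdorff measure is bounded directly for segments.\<close>

lemma ennreal_SUP_add_SUP_le:
  fixes f :: "'a \<Rightarrow> ennreal" and g :: "'b \<Rightarrow> ennreal"
  assumes "I \<noteq> {}" "J \<noteq> {}" and le: "\<And>i j. i \<in> I \<Longrightarrow> j \<in> J \<Longrightarrow> f i + g j \<le> v"
  shows "(SUP i\<in>I. f i) + (SUP j\<in>J. g j) \<le> v"
proof -
  have *: "c + (SUP i\<in>K. h i) \<le> v" if "K \<noteq> {}" "\<And>i. i \<in> K \<Longrightarrow> c + h i \<le> v"
    for c and K :: "'c set" and h :: "'c \<Rightarrow> ennreal"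
  \<comment> \<open>Subtracting \<open>c\<close> is legitimate only if it is finite; an infinite
    \<open>c\<close> forces \<open>v\<close> to be infinite.\<close>
  proof (cases "c = \<infinity>")
    case True
    with that show ?thesis by fastforce
  next
    case False
    have "\<exists>k. k \<in> K" using that(1) by auto
    then obtain k where "k \<in> K" ..
    then have "c \<le> v" using that(2)[of k] by (meson le_iff_add order_trans)
    have "h i \<le> v - c" if "i \<in> K" for i
      using that False \<open>\<And>i. i \<in> K \<Longrightarrow> c + h i \<le> v\<close>
      by (simp add: ennreal_le_minus_iff add.commute)
    then have "(SUP i\<in>K. h i) \<le> v - c" by (rule SUP_least)
    then have "c + (SUP i\<in>K. h i) \<le> c + (v - c)" by (rule add_left_mono)
    also have "\<dots> = v" using \<open>c \<le> v\<close> by (simp add: add.commute diff_add_cancel_ennreal)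
    finally show ?thesis .
  qed
  have "(SUP j\<in>J. g j) + f i \<le> v" if "i \<in> I" for i
    using *[OF assms(2), of "f i" g] le[OF that] by (simp add: add.commute)
  then show ?thesis using *[OF assms(1), of "SUP j\<in>J. g j" f] by (simp add: add.commute)
qed

fun polygon_length :: "('b \<Rightarrow> 'a::metric_space) \<Rightarrow> 'b list \<Rightarrow> real" where
  "polygon_length g (x # y # zs) = dist (g x) (g y) + polygon_length g (y # zs)"
| "polygon_length g _ = 0"

text \<open>The total variation of \<open>g\<close>, with subdivisions as sorted lists that need not
  contain the ends. Cutting, scaling and reversing an arc become operations on lists, which is why
  the crossing argument runs with it rather than with Hausdorff measure.\<close>

definition arc_length :: "(real \<Rightarrow> 'a::metric_space) \<Rightarrow> real \<Rightarrow> real \<Rightarrow> ennreal" where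
  "arc_length g s t = (SUP xs\<in>{xs. sorted xs \<and> set xs \<subseteq> {s..t}}. ennreal (polygon_length g xs))"

lemma polygon_length_nonneg: "0 \<le> polygon_length g xs"
  by (induction g xs rule: polygon_length.induct) auto

text \<open>The link between the two lists is dropped. Superadditivity is what lower bounds for
  composed arcs require.\<close>

lemma polygon_length_append:
  "polygon_length g xs + polygon_length g ys \<le> polygon_length g (xs @ ys)"
proof (induction g xs rule: polygon_length.induct)
  case ("2_2" g x)
  then show ?case by (cases ys) auto
qed auto

lemma polygon_length_snoc:
  "polygon_length g (xs @ [y, x]) = polygon_length g (xs @ [y]) + dist (g y) (g x)"
  by (induction g xs rule: polygon_length.induct) auto

lemma polygon_length_rev: "polygon_length g (rev xs) = polygon_length g xs"
  by (induction g xs rule: polygon_length.induct)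
     (simp_all add: polygon_length_snoc dist_commute)

lemma polygon_length_map: "polygon_length g (map f xs) = polygon_length (\<lambda>x. g (f x)) xs"
  by (induction "\<lambda>x. g (f x)" xs rule: polygon_length.induct) auto

lemma polygon_length_scale_le:
  assumes "\<And>x y. x \<in> set xs \<Longrightarrow> y \<in> set xs \<Longrightarrow> dist (h x) (h y) \<le> c * dist (g x) (g y)"
  shows "polygon_length h xs \<le> c * polygon_length g xs"
  using assms
proof (induction g xs rule: polygon_length.induct)
  case (1 g x y zs)
  have "polygon_length h (y # zs) \<le> c * polygon_length g (y # zs)"
    by (rule 1) (use 1(2) in auto)
  moreover have "dist (h x) (h y) \<le> c * dist (g x) (g y)" by (rule 1) auto
  ultimately show ?case by (simp add: algebra_simps)
qed auto

lemma polygon_length_le_arc_length: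
  "sorted xs \<Longrightarrow> set xs \<subseteq> {s..t} \<Longrightarrow> ennreal (polygon_length g xs) \<le> arc_length g s t"
  unfolding arc_length_def by (rule SUP_upper) auto

lemma arc_length_leI:
  "(\<And>xs. sorted xs \<Longrightarrow> set xs \<subseteq> {s..t} \<Longrightarrow> ennreal (polygon_length g xs) \<le> v) \<Longrightarrow> arc_length g s t \<le> v"
  unfolding arc_length_def by (rule SUP_least) auto

lemma dist_le_arc_length: "s \<le> t \<Longrightarrow> ennreal (dist (g s) (g t)) \<le> arc_length g s t"
  using polygon_length_le_arc_length[of "[s, t]" s t g] by simp

lemma arc_length_mono: "s \<le> s' \<Longrightarrow> t' \<le> t \<Longrightarrow> arc_length g s' t' \<le> arc_length g s t"
  by (rule arc_length_leI) (rule polygon_length_le_arc_length; auto)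

lemma arc_length_add:
  assumes "r \<in> {s..t}"
  shows "arc_length g s r + arc_length g r t \<le> arc_length g s t"
proof -
  have "ennreal (polygon_length g xs) + ennreal (polygon_length g ys) \<le> arc_length g s t"
    if "sorted xs" "set xs \<subseteq> {s..r}" "sorted ys" "set ys \<subseteq> {r..t}" for xs ys
  proof -
    have "sorted (xs @ ys)" "set (xs @ ys) \<subseteq> {s..t}"
      using that assms by (fastforce simp: sorted_append)+
    have "ennreal (polygon_length g xs) + ennreal (polygon_length g ys)
        \<le> ennreal (polygon_length g (xs @ ys))"
      using polygon_length_append[of g xs ys]
      by (simp add: polygon_length_nonneg ennreal_leI flip: ennreal_plus)
    also have "\<dots> \<le> arc_length g s t"
      by (rule polygon_length_le_arc_length) fact+
    finally show ?thesis .
  qed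
  then show ?thesis
    unfolding arc_length_def[of g s r] arc_length_def[of g r t]
    by (intro ennreal_SUP_add_SUP_le) (auto intro: exI[of _ "[]"])
qed

lemma arc_length_scale_le:
  assumes "\<And>x y. x \<in> {s..t} \<Longrightarrow> y \<in> {s..t} \<Longrightarrow> dist (h x) (h y) \<le> c * dist (g x) (g y)" "0 \<le> c"
  shows "arc_length h s t \<le> ennreal c * arc_length g s t"
proof (rule arc_length_leI)
  fix xs assume xs: "sorted xs" "set xs \<subseteq> {s..t}"
  have "ennreal (polygon_length h xs) \<le> ennreal (c * polygon_length g xs)"
    by (intro ennreal_leI polygon_length_scale_le assms(1)) (use xs in auto)
  also have "\<dots> = ennreal c * ennreal (polygon_length g xs)"
    by (simp add: ennreal_mult assms(2) polygon_length_nonneg)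
  also have "\<dots> \<le> ennreal c * arc_length g s t"
    by (intro mult_left_mono polygon_length_le_arc_length xs) auto
  finally show "ennreal (polygon_length h xs) \<le> ennreal c * arc_length g s t" .
qed

lemma arc_length_reverse: "arc_length (\<lambda>x. g (- x)) (- t) (- s) \<le> arc_length g s t"
proof (rule arc_length_leI)
  fix xs :: "real list" assume xs: "sorted xs" "set xs \<subseteq> {- t..- s}"
  have "polygon_length (\<lambda>x. g (- x)) xs = polygon_length g (rev (map uminus xs))"
    by (simp add: polygon_length_rev polygon_length_map)
  also have "ennreal \<dots> \<le> arc_length g s t"
  proof (rule polygon_length_le_arc_length)
    have "sorted (rev (map uminus xs))"
      using xs(1) by (induction xs) (auto simp: sorted_append)
    then show "sorted (rev (map uminus xs))" .
    show "set (rev (map uminus xs)) \<subseteq> {s..t}" using xs(2) by force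
  qed
  finally show "ennreal (polygon_length (\<lambda>x. g (- x)) xs) \<le> arc_length g s t" .
qed

section \<open>Hausdorff premeasures at a fixed scale, and their comparison with arc length\<close>

definition hausdorff_pre1 :: "real \<Rightarrow> 'a::metric_space set \<Rightarrow> ennreal" where
  "hausdorff_pre1 \<delta> X = (INF U\<in>{U :: nat \<Rightarrow> 'a set. X \<subseteq> (\<Union>n. U n) \<and>
        (\<forall>n. bounded (U n) \<and> diameter (U n) \<le> \<delta>)}. \<Sum>n. ennreal (diameter (U n)))"

lemma hausdorff_measure1_eq: "hausdorff_measure1 X = (SUP \<delta>\<in>{0<..}. hausdorff_pre1 \<delta> X)"
  unfolding hausdorff_measure1_def hausdorff_pre1_def ..

lemma hausdorff_pre1_le: "\<delta> > 0 \<Longrightarrow> hausdorff_pre1 \<delta> X \<le> hausdorff_measure1 X"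
  unfolding hausdorff_measure1_eq by (rule SUP_upper) auto

lemma hausdorff_pre1_antimono: "\<delta> \<le> \<epsilon> \<Longrightarrow> hausdorff_pre1 \<epsilon> X \<le> hausdorff_pre1 \<delta> X"
  unfolding hausdorff_pre1_def by (rule INF_superset_mono) (auto intro: order_trans)

lemma hausdorff_pre1_mono: "X \<subseteq> Y \<Longrightarrow> hausdorff_pre1 \<delta> X \<le> hausdorff_pre1 \<delta> Y"
  unfolding hausdorff_pre1_def by (rule INF_superset_mono) auto

lemma hausdorff_measure1_mono: "X \<subseteq> Y \<Longrightarrow> hausdorff_measure1 X \<le> hausdorff_measure1 Y"
  unfolding hausdorff_measure1_eq by (rule SUP_mono) (auto intro: hausdorff_pre1_mono)

text \<open>No set of diameter at most \<open>\<delta>\<close> meets both \<open>X\<close> and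
  \<open>Y\<close>, so a cover of the union splits into a cover of \<open>X\<close> and one of
  \<open>Y\<close>.\<close>

lemma hausdorff_pre1_separated:
  fixes X Y :: "'a::metric_space set"
  assumes sep: "\<And>x y. x \<in> X \<Longrightarrow> y \<in> Y \<Longrightarrow> \<delta> < dist x y"
  shows "hausdorff_pre1 \<delta> X + hausdorff_pre1 \<delta> Y \<le> hausdorff_pre1 \<delta> (X \<union> Y)"
  unfolding hausdorff_pre1_def[of \<delta> "X \<union> Y"]
proof (rule INF_greatest)
  fix U :: "nat \<Rightarrow> 'a set"
  assume "U \<in> {U. X \<union> Y \<subseteq> (\<Union>n. U n) \<and> (\<forall>n. bounded (U n) \<and> diameter (U n) \<le> \<delta>)}"
  then have U: "X \<union> Y \<subseteq> (\<Union>n. U n)" "\<And>n. bounded (U n)" "\<And>n. diameter (U n) \<le> \<delta>" by auto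
  have \<delta>: "0 \<le> \<delta>" using diameter_ge_0[OF U(2)[of 0]] U(3)[of 0] by simp
  \<comment> \<open>Sets that miss \<open>Z\<close> are replaced by \<open>{}\<close> rather than
    dropped, which keeps the enumeration; \<open>{}\<close> has diameter 0, hence the need for
    \<open>0 \<le> \<delta>\<close>.\<close>
  define V where "V Z n = (if U n \<inter> Z = {} then {} else U n)" for Z :: "'a set" and n
  have le: "hausdorff_pre1 \<delta> Z \<le> (\<Sum>n. ennreal (diameter (V Z n)))" if "Z \<subseteq> X \<union> Y" for Z
    unfolding hausdorff_pre1_def
    by (rule INF_lower) (use U that \<delta> in \<open>fastforce simp: V_def\<close>)
  have "ennreal (diameter (V X n)) + ennreal (diameter (V Y n)) \<le> ennreal (diameter (U n))" for n
  proof (cases "U n \<inter> X = {} \<or> U n \<inter> Y = {}")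
    case False
    then obtain x y where "x \<in> U n" "x \<in> X" "y \<in> U n" "y \<in> Y" by auto
    with sep[of x y] diameter_bounded_bound[OF U(2), of x n y] U(3)[of n] show ?thesis by simp
  qed (auto simp: V_def)
  then have "(\<Sum>n. ennreal (diameter (V X n)) + ennreal (diameter (V Y n)))
      \<le> (\<Sum>n. ennreal (diameter (U n)))"
    by (intro suminf_le) auto
  then show "hausdorff_pre1 \<delta> X + hausdorff_pre1 \<delta> Y \<le> (\<Sum>n. ennreal (diameter (U n)))"
    using add_mono[OF le[of X] le[of Y]] by (simp add: suminf_add)
qed

text \<open>The additivity of a metric outer measure: below the scale \<open>d\<close> the
  premeasures of the two sets already add up.\<close>

lemma hausdorff_measure1_separated:
  fixes X Y :: "'a::metric_space set"
  assumes "d > 0" and sep: "\<And>x y. x \<in> X \<Longrightarrow> y \<in> Y \<Longrightarrow> d \<le> dist x y"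
  shows "hausdorff_measure1 X + hausdorff_measure1 Y \<le> hausdorff_measure1 (X \<union> Y)"
proof -
  have *: "hausdorff_pre1 \<delta> X + hausdorff_pre1 \<epsilon> Y \<le> hausdorff_measure1 (X \<union> Y)"
    if "\<delta> > 0" "\<epsilon> > 0" for \<delta> \<epsilon>
  proof -
    \<comment> \<open>Premeasures grow as the scale shrinks, so both may be passed to a common
      scale, which is chosen below \<open>d\<close>.\<close>
    define \<gamma> where "\<gamma> = min (min \<delta> \<epsilon>) (d / 2)"
    have \<gamma>: "\<gamma> > 0" "\<gamma> \<le> \<delta>" "\<gamma> \<le> \<epsilon>" "\<gamma> < d" using that assms(1) by (auto simp: \<gamma>_def)
    have "hausdorff_pre1 \<delta> X + hausdorff_pre1 \<epsilon> Y \<le> hausdorff_pre1 \<gamma> X + hausdorff_pre1 \<gamma> Y"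
      using \<gamma> by (intro add_mono hausdorff_pre1_antimono) auto
    also have "\<dots> \<le> hausdorff_pre1 \<gamma> (X \<union> Y)"
      using sep \<gamma> by (intro hausdorff_pre1_separated) force
    also have "\<dots> \<le> hausdorff_measure1 (X \<union> Y)" using \<gamma> by (intro hausdorff_pre1_le)
    finally show ?thesis .
  qed
  then show ?thesis
    unfolding hausdorff_measure1_eq[of X] hausdorff_measure1_eq[of Y]
    by (intro ennreal_SUP_add_SUP_le) (auto intro: exI[of _ 1])
qed

text \<open>The distance from \<open>a\<close> is 1-Lipschitz and maps \<open>C\<close> onto a set
  containing \<open>{0..dist a b}\<close>. A cover of \<open>C\<close> thus yields a cover of this
  interval by intervals of the same diameters, and Lebesgue measure bounds their sum.\<close>

lemma hausdorff_measure1_connected: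
  fixes C :: "'a::metric_space set"
  assumes "Topological_Spaces.connected C" "a \<in> C" "b \<in> C"
  shows "ennreal (dist a b) \<le> hausdorff_measure1 C"
proof -
  \<comment> \<open>The scale 1 is arbitrary: the estimate holds for every cover by bounded
    sets.\<close>
  have "ennreal (dist a b) \<le> hausdorff_pre1 1 C"
    unfolding hausdorff_pre1_def
  proof (rule INF_greatest)
    fix U :: "nat \<Rightarrow> 'a set"
    assume "U \<in> {U. C \<subseteq> (\<Union>n. U n) \<and> (\<forall>n. bounded (U n) \<and> diameter (U n) \<le> 1)}"
    then have U: "C \<subseteq> (\<Union>n. U n)" "\<And>n. bounded (U n)" by auto
    define I where "I n = (if U n = {} then {} else
      {Inf (dist a ` U n)..Inf (dist a ` U n) + diameter (U n)})" for n
    have sub: "dist a ` U n \<subseteq> I n" for n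
    proof (cases "U n = {}")
      case False
      have bb: "bdd_below (dist a ` U n)" by (rule bdd_belowI[of _ 0]) auto
      have "dist a z \<le> Inf (dist a ` U n) + diameter (U n)" if "z \<in> U n" for z
      proof -
        have "dist a z - diameter (U n) \<le> Inf (dist a ` U n)"
        proof (rule cINF_greatest[OF False])
          fix w assume "w \<in> U n"
          then show "dist a z - diameter (U n) \<le> dist a w"
            using diameter_bounded_bound[OF U(2) that, of w] dist_triangle[of a z w]
            by (simp add: dist_commute)
        qed
        then show ?thesis by simp
      qed
      then show ?thesis using False cINF_lower[OF bb] by (auto simp: I_def)
    qed (auto simp: I_def)
    have "Topological_Spaces.connected (dist a ` C)"
      by (intro connected_continuous_image assms continuous_intros)
    moreover have "0 \<in> dist a ` C" "dist a b \<in> dist a ` C" using assms by force+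
    ultimately have "{0..dist a b} \<subseteq> dist a ` C"
      by (rule connected_contains_Icc)
    also have "\<dots> \<subseteq> (\<Union>n. I n)" using U(1) sub by fastforce
    finally have "emeasure lborel {0..dist a b} \<le> emeasure lborel (\<Union>n. I n)"
      by (intro emeasure_mono) (auto simp: I_def)
    also have "\<dots> \<le> (\<Sum>n. emeasure lborel (I n))"
      by (intro emeasure_subadditive_countably) (auto simp: I_def)
    also have "\<dots> \<le> (\<Sum>n. ennreal (diameter (U n)))"
      by (intro suminf_le) (auto simp: I_def diameter_ge_0 U)
    finally show "ennreal (dist a b) \<le> (\<Sum>n. ennreal (diameter (U n)))" by simp
  qed
  then show ?thesis using hausdorff_pre1_le[of 1 C] by simp
qed

text \<open>By induction, each chord is charged to the connected piece of the arc that it spans.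
  Adjacent pieces share a point and are not at positive distance, so the first piece is cut short at
  some \<open>y' < y\<close>; injectivity and compactness then separate it from the rest, and
  \<open>y'\<close> tends to \<open>y\<close> from the left.\<close>

lemma polygon_length_le_hausdorff:
  fixes g :: "real \<Rightarrow> 'a::euclidean_space"
  assumes "sorted xs" "set xs \<subseteq> {s..t}" "continuous_on {s..t} g" "inj_on g {s..t}"
  shows "ennreal (polygon_length g xs) \<le> hausdorff_measure1 (g ` {s..t})"
  using assms
proof (induction g xs arbitrary: s rule: polygon_length.induct)
  case (1 g x y zs)
  define h where "h = hausdorff_measure1 (g ` {s..t})"
  have xy: "s \<le> x" "x \<le> y" "y \<le> t" using 1(2,3) by auto
  have IH: "ennreal (polygon_length g (y # zs)) \<le> hausdorff_measure1 (g ` {y..t})"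
  proof (rule 1(1))
    show "sorted (y # zs)" "set (y # zs) \<subseteq> {y..t}" using 1(2,3) by auto
    show "continuous_on {y..t} g" by (rule continuous_on_subset[OF 1(4)]) (use xy in auto)
    show "inj_on g {y..t}" by (rule inj_on_subset[OF 1(5)]) (use xy in auto)
  qed
  have step: "ennreal (dist (g x) (g y') + polygon_length g (y # zs)) \<le> h"
    if "x \<le> y'" "y' < y" for y'
  proof -
    have c: "compact (g ` {x..y'})" "compact (g ` {y..t})"
      by (intro compact_continuous_image continuous_on_subset[OF 1(4)]; use xy that in auto)+
    have "g ` {x..y'} \<inter> g ` {y..t} = {}"
      using xy that inj_onD[OF 1(5)] by fastforce
    then obtain d where d: "d > 0" "\<forall>u\<in>g ` {x..y'}. \<forall>v\<in>g ` {y..t}. d \<le> dist u v"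
      using separate_compact_closed[OF c(1) compact_imp_closed[OF c(2)]] by blast
    have "Topological_Spaces.connected (g ` {x..y'})"
      by (intro connected_continuous_image continuous_on_subset[OF 1(4)]) (use xy that in auto)
    then have "ennreal (dist (g x) (g y')) \<le> hausdorff_measure1 (g ` {x..y'})"
      using that by (intro hausdorff_measure1_connected) auto
    with IH have "ennreal (dist (g x) (g y')) + ennreal (polygon_length g (y # zs))
        \<le> hausdorff_measure1 (g ` {x..y'}) + hausdorff_measure1 (g ` {y..t})"
      by (rule add_mono[rotated])
    also have "\<dots> \<le> hausdorff_measure1 (g ` {x..y'} \<union> g ` {y..t})"
      using d by (intro hausdorff_measure1_separated) auto
    also have "\<dots> \<le> h" unfolding h_def
      by (rule hausdorff_measure1_mono) (use xy that in auto)
    finally show ?thesis by (simp add: polygon_length_nonneg)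
  qed
  have "ennreal (dist (g x) (g y) + polygon_length g (y # zs)) \<le> h"
  proof (cases "x = y")
    case True
    have "hausdorff_measure1 (g ` {y..t}) \<le> h" unfolding h_def
      by (rule hausdorff_measure1_mono) (use xy in auto)
    then show ?thesis using IH True by simp
  next
    case False
    then have "x < y" using xy by simp
    have "continuous_on {x..y} g" by (rule continuous_on_subset[OF 1(4)]) (use xy in auto)
    then have "(g \<longlongrightarrow> g y) (at_left y)"
      using \<open>x < y\<close> by (simp add: continuous_on_Icc_at_leftD)
    then have "((\<lambda>y'. ennreal (dist (g x) (g y') + polygon_length g (y # zs))) \<longlongrightarrow>
        ennreal (dist (g x) (g y) + polygon_length g (y # zs))) (at_left y)"
      by (intro tendsto_intros)
    moreover have "eventually (\<lambda>y'. ennreal (dist (g x) (g y') + polygon_length g (y # zs)) \<le> h) (at_left y)"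
      using eventually_at_left_real[OF \<open>x < y\<close>] by eventually_elim (use step in auto)
    ultimately show ?thesis
      using tendsto_upperbound trivial_limit_at_left_real by blast
  qed
  then show ?case by (simp add: h_def)
qed auto

lemma arc_length_le_hausdorff:
  fixes g :: "real \<Rightarrow> 'a::euclidean_space"
  assumes "continuous_on {s..t} g" "inj_on g {s..t}"
  shows "arc_length g s t \<le> hausdorff_measure1 (g ` {s..t})"
  by (rule arc_length_leI) (rule polygon_length_le_hausdorff[OF _ _ assms])

lemma hausdorff_measure1_segment:
  fixes x y :: "'a::euclidean_space"
  shows "hausdorff_measure1 (closed_segment x y) < \<infinity>"
proof -
  have "hausdorff_pre1 \<delta> (closed_segment x y) \<le> ennreal (dist x y)" if "\<delta> > 0" for \<delta>
  proof -
    \<comment> \<open>Strictness matters: \<open>0 \<le> dist x y / \<delta> < N\<close> makes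
      \<open>N\<close> positive even if \<open>x = y\<close>.\<close>
    obtain N :: nat where "dist x y / \<delta> < N" using reals_Archimedean2 by blast
    moreover have "0 \<le> dist x y / \<delta>" using that by simp
    ultimately have "0 < real N" by linarith
    with \<open>dist x y / \<delta> < N\<close> have N: "N > 0" "dist x y / N < \<delta>"
      using that by (simp_all add: field_simps)
    define p where "p i = x + (real i / N) *\<^sub>R (y - x)" for i :: nat
    define U where "U i = (if i < N then closed_segment (p i) (p (Suc i)) else {})" for i
    have diam: "diameter (U i) \<le> dist x y / N" for i
    proof -
      have "p (Suc i) - p i = (1 / N) *\<^sub>R (y - x)"
        by (simp add: p_def add_divide_distrib scaleR_left_distrib)
      then have "norm (p (Suc i) - p i) = dist x y / N"
        using N by (simp add: dist_norm norm_minus_commute)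
      moreover have "norm (v - w) \<le> norm (b - a)"
        if "v \<in> closed_segment a b" "w \<in> closed_segment a b" for v w a b :: 'a
      proof -
        obtain c d where cd: "0 \<le> c" "c \<le> 1" "0 \<le> d" "d \<le> 1"
            "v = (1 - c) *\<^sub>R a + c *\<^sub>R b" "w = (1 - d) *\<^sub>R a + d *\<^sub>R b"
          using \<open>v \<in> _\<close> \<open>w \<in> _\<close> by (auto simp: in_segment)
        then have "v - w = (c - d) *\<^sub>R (b - a)" unfolding cd(5,6) by (simp add: algebra_simps)
        then show ?thesis using cd by (simp add: mult_left_le_one_le)
      qed
      ultimately show ?thesis by (auto simp: U_def intro!: diameter_le) metis
    qed
    have "hausdorff_pre1 \<delta> (closed_segment x y) \<le> (\<Sum>i. ennreal (diameter (U i)))"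
      unfolding hausdorff_pre1_def
    proof (rule INF_lower, safe)
      fix z assume "z \<in> closed_segment x y"
      then obtain u where u: "0 \<le> u" "u \<le> 1" "z = x + u *\<^sub>R (y - x)"
        by (auto simp: in_segment algebra_simps)
      \<comment> \<open>For \<open>u = 1\<close> the floor is \<open>N\<close>, one past the last
        piece; the \<open>min\<close> assigns the end point to piece \<open>N - 1\<close>.\<close>
      define i where "i = min (nat \<lfloor>u * N\<rfloor>) (N - 1)"
      have i: "i < N" using N by (auto simp: i_def)
      have lo: "real i \<le> u * N" using u N by (auto simp: i_def min_def le_nat_iff le_floor_iff) linarith
      have hi: "u * N \<le> real (Suc i)"
      proof (cases "nat \<lfloor>u * N\<rfloor> \<le> N - 1")
        case True
        then show ?thesis using u by (simp add: i_def) linarith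
      next
        case False
        then have "real (Suc i) = N" using N by (simp add: i_def)
        then show ?thesis using u by (simp add: mult_left_le_one_le)
      qed
      have "z = (1 - (u * N - i)) *\<^sub>R p i + (u * N - i) *\<^sub>R p (Suc i)"
      proof -
        have "(1 - (u * N - i)) *\<^sub>R p i + (u * N - i) *\<^sub>R p (Suc i)
            = x + ((1 - (u * N - i)) * (i / N) + (u * N - i) * (Suc i / N)) *\<^sub>R (y - x)"
          by (simp add: p_def algebra_simps)
        also have "(1 - (u * N - i)) * (i / N) + (u * N - i) * (Suc i / N) = u"
          using N by (simp add: field_simps)
        finally show ?thesis using u by simp
      qed
      then have "z \<in> U i" using i lo hi by (auto simp: U_def in_segment intro!: exI[of _ "u * N - i"])
      then show "z \<in> (\<Union>i. U i)" by blast
    next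
      fix i
      show "bounded (U i)" by (auto simp: U_def intro: compact_imp_bounded)
      show "diameter (U i) \<le> \<delta>" using diam[of i] N by simp
    qed
    also have "\<dots> = (\<Sum>i<N. ennreal (diameter (U i)))"
      by (rule suminf_finite) (auto simp: U_def)
    also have "\<dots> \<le> (\<Sum>i<N. ennreal (dist x y / N))"
      by (intro sum_mono ennreal_leI diam)
    also have "\<dots> = ennreal (\<Sum>i<N. dist x y / N)" by (rule sum_ennreal) simp
    also have "\<dots> = ennreal (dist x y)" using N by simp
    finally show ?thesis .
  qed
  then have "hausdorff_measure1 (closed_segment x y) \<le> ennreal (dist x y)"
    unfolding hausdorff_measure1_eq by (intro SUP_least) auto
  then show ?thesis using ennreal_less_top le_less_trans by (metis infinity_ennreal_def)
qed

section \<open>Arcs in unions of sets arranged like a tree\<close>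

definition simple_path :: "('a \<Rightarrow> 'a \<Rightarrow> bool) \<Rightarrow> 'a set \<Rightarrow> 'a list \<Rightarrow> bool" where
  "simple_path E V xs \<longleftrightarrow> xs \<noteq> [] \<and> distinct xs \<and> set xs \<subseteq> V \<and> successively E xs"

lemma simple_path_Cons:
  "simple_path E V (x # xs) \<longleftrightarrow>
     x \<in> V \<and> (xs = [] \<or> x \<notin> set xs \<and> E x (hd xs) \<and> simple_path E V xs)"
  by (cases xs) (auto simp: simple_path_def)

lemma simple_path_rev:
  assumes "symp E" "simple_path E V xs"
  shows "simple_path E V (rev xs)"
proof -
  have "(\<lambda>x y. E y x) = E" using assms(1) by (auto dest: sympD)
  then have "successively E (rev xs)"
    unfolding successively_rev using assms(2) by (simp only: simple_path_def)
  then show ?thesis using assms by (simp add: simple_path_def)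
qed

text \<open>After the common beginning is removed, two paths that part at \<open>u\<close> and meet
  again later enclose a cycle. Acyclicity is phrased by simple paths: no path of three or more
  vertices has an edge joining its ends.\<close>

lemma simple_path_eqI:
  assumes "symp E"
    and acyclic: "\<And>xs. simple_path E V xs \<Longrightarrow> 3 \<le> length xs \<Longrightarrow> \<not> E (last xs) (hd xs)"
    and "simple_path E V p" "simple_path E V q" "hd p = hd q" "last p = last q"
  shows "p = q"
  using assms(3-)
proof (induction p arbitrary: q)
  case (Cons u p)
  then obtain q' where q: "q = u # q'" by (cases q) (auto simp: simple_path_def)
  show ?case
  proof (cases "p = [] \<or> q' = []")
    case True
    then show ?thesis using Cons.prems q by (auto simp: simple_path_def split: if_splits)
  next
    case False
    then have p: "simple_path E V p" "simple_path E V q'" "E u (hd p)" "E u (hd q')"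
        "u \<notin> set p" "u \<notin> set q'" "u \<in> V"
      using Cons.prems q by (auto simp: simple_path_Cons)
    have l: "last p = last q'" using Cons.prems(4) False q by simp
    show ?thesis
    proof (cases "hd p = hd q'")
      case True
      then show ?thesis using Cons.IH[OF p(1,2) True l] q by simp
    next
      case ne: False
      have "\<exists>x\<in>set p. x \<in> set q'" using l False by (metis last_in_set)
      \<comment> \<open>\<open>x\<close> is the first vertex of \<open>p\<close> that lies on
        \<open>q'\<close>. The path \<open>z\<close> below goes from \<open>u\<close> along
        \<open>p\<close> to \<open>x\<close> and back along \<open>q'\<close>; it is simple by the
        choice of \<open>x\<close>, and the edge from \<open>hd q'\<close> to \<open>u\<close>
        closes it.\<close>
      then obtain a x b where pa: "p = a @ x # b" "x \<in> set q'" "\<forall>y\<in>set a. y \<notin> set q'"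
        using split_list_first_prop[of p "\<lambda>x. x \<in> set q'"] by blast
      obtain c d where qc: "q' = c @ x # d" using split_list[OF pa(2)] by blast
      have sw: "(\<lambda>x y. E y x) = E" using assms(1) by (auto dest: sympD)
      define z where "z = u # a @ x # rev c"
      have sq: "successively E (rev (c @ [x]))"
        unfolding successively_rev sw using p(2) qc by (auto simp: simple_path_def successively_append_iff)
      have "successively E ((a @ [x]) @ b)" using p(1) pa(1) by (simp add: simple_path_def)
      then have "successively E (a @ [x])" by (simp only: successively_append_iff)
      moreover have "hd (a @ [x]) = hd p" using pa(1) by (cases a) auto
      ultimately have "successively E ((u # a) @ [x])" using p(3) by (simp add: successively_Cons)
      moreover have "successively E (x # rev c)" using sq by simp
      ultimately have "successively E ((u # a) @ x # rev c)"
        unfolding successively_append_iff by simp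
      moreover have "distinct z" "set z \<subseteq> V"
        using p pa qc by (auto simp: simple_path_def z_def)
      ultimately have "simple_path E V z" by (simp add: simple_path_def z_def)
      moreover have "3 \<le> length z"
        using ne pa qc by (cases a; cases c) (auto simp: z_def)
      moreover have "last z = hd q'" using qc by (cases c) (auto simp: z_def)
      ultimately show ?thesis using acyclic[of z] p(4) assms(1) by (auto simp: z_def dest: sympD)
    qed
  qed
qed (simp add: simple_path_def)

lemma arc_meets_Int:
  fixes g :: "real \<Rightarrow> 'b::topological_space"
  assumes "s \<le> t" "continuous_on {s..t} g" "closed A" "closed B"
    and "g ` {s..t} \<subseteq> A \<union> B" "g s \<in> A" "g t \<in> B"
  obtains r where "r \<in> {s..t}" "g r \<in> A \<inter> B"
proof -
  have "Topological_Spaces.connected {s..t}" by simp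
  moreover have "closedin (top_of_set {s..t}) ({s..t} \<inter> g -` A)"
      "closedin (top_of_set {s..t}) ({s..t} \<inter> g -` B)"
    using assms by (auto intro: continuous_closedin_preimage)
  moreover have "{s..t} \<inter> g -` A \<noteq> {}" "{s..t} \<inter> g -` B \<noteq> {}"
    using assms by (auto intro: exI[of _ s] exI[of _ t])
  moreover have "{s..t} \<subseteq> ({s..t} \<inter> g -` A) \<union> ({s..t} \<inter> g -` B)" using assms by auto
  ultimately have "({s..t} \<inter> g -` A) \<inter> ({s..t} \<inter> g -` B) \<noteq> {}"
    unfolding connected_closedin by blast
  then show thesis using that by blast
qed

text \<open>An excursion out of \<open>A\<close> passes through \<open>A \<inter> B\<close> before
  and after. As this is at most one point, injectivity makes both passages the same instant, so the
  excursion is empty.\<close>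

lemma arc_stays:
  fixes g :: "real \<Rightarrow> 'b::topological_space"
  assumes g: "continuous_on {s..t} g" "inj_on g {s..t}" "closed A" "closed B"
    and AB: "g ` {s..t} \<subseteq> A \<union> B" "\<And>x y. x \<in> A \<inter> B \<Longrightarrow> y \<in> A \<inter> B \<Longrightarrow> x = y"
    and "g s \<in> A" "g t \<in> A"
  shows "g ` {s..t} \<subseteq> A"
proof (rule ccontr)
  assume "\<not> g ` {s..t} \<subseteq> A"
  then obtain w where w: "w \<in> {s..t}" "g w \<notin> A" "g w \<in> B" using AB(1) by blast
  obtain r where r: "r \<in> {s..w}" "g r \<in> A \<inter> B"
  proof (rule arc_meets_Int[of s w g A B])
    show "continuous_on {s..w} g" using g(1) by (rule continuous_on_subset) (use w in auto)
    show "g ` {s..w} \<subseteq> A \<union> B" using AB(1) w by (auto simp: image_subset_iff)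
  qed (use assms w in auto)
  obtain r' where r': "r' \<in> {w..t}" "g r' \<in> B \<inter> A"
  proof (rule arc_meets_Int[of w t g B A])
    show "continuous_on {w..t} g" using g(1) by (rule continuous_on_subset) (use w in auto)
    show "g ` {w..t} \<subseteq> B \<union> A" using AB(1) w by (auto simp: image_subset_iff)
  qed (use assms w in auto)
  have "g r = g r'" using AB(2)[of "g r" "g r'"] r r' by auto
  then have "r = r'" using g(2) r r' w by (auto dest!: inj_onD)
  then show False using r r' w by auto
qed

text \<open>Abstracts the cells of one subdivision: closed pieces indexed by a tree
  (\<open>path_exists\<close> and \<open>path_unique\<close>), which meet only across edges and
  there in at most one point.\<close>

locale tree_cover =
  fixes E :: "'a \<Rightarrow> 'a \<Rightarrow> bool" and V :: "'a set" and K :: "'a \<Rightarrow> 'b::topological_space set"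
  assumes finite_V: "finite V" and sym: "symp E"
    and path_exists: "u \<in> V \<Longrightarrow> v \<in> V \<Longrightarrow> \<exists>xs. simple_path E V xs \<and> hd xs = u \<and> last xs = v"
    and path_unique: "simple_path E V p \<Longrightarrow> simple_path E V q \<Longrightarrow> hd p = hd q \<Longrightarrow> last p = last q \<Longrightarrow> p = q"
    and closed_K: "v \<in> V \<Longrightarrow> closed (K v)"
    and touch: "u \<in> V \<Longrightarrow> v \<in> V \<Longrightarrow> u \<noteq> v \<Longrightarrow> x \<in> K u \<Longrightarrow> x \<in> K v \<Longrightarrow> E u v"
    and touch_unique: "u \<in> V \<Longrightarrow> v \<in> V \<Longrightarrow> E u v \<Longrightarrow> x \<in> K u \<inter> K v \<Longrightarrow> y \<in> K u \<inter> K v \<Longrightarrow> x = y"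
begin

text \<open>For adjacent \<open>f\<close> and \<open>h\<close> this is the component of
  \<open>h\<close> after the edge between them is removed.\<close>

definition branch :: "'a \<Rightarrow> 'a \<Rightarrow> 'a set" where
  "branch f h = {u. \<exists>xs. simple_path E V (f # h # xs) \<and> last (h # xs) = u}"

lemma branch_subset: "branch f h \<subseteq> V"
  unfolding branch_def by (auto simp: simple_path_def)

lemma branch_self: "f \<notin> branch f h"
  unfolding branch_def by (auto simp: simple_path_def split: if_splits)

text \<open>The path from \<open>f\<close> to \<open>u\<close> can be extended by \<open>v\<close>,
  which puts \<open>v\<close> into the branch, unless \<open>v\<close> already lies on it. On the
  path beyond \<open>f\<close> it is in the branch anyway; if \<open>v = f\<close>, uniqueness of
  paths shrinks the path to the edge from \<open>f\<close> to \<open>h\<close>.\<close>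

lemma branch_boundary:
  assumes "u \<in> branch f h" "v \<in> V" "v \<notin> branch f h" "E u v"
  shows "u = h \<and> v = f"
proof -
  obtain xs where xs: "simple_path E V (f # h # xs)" "last (h # xs) = u"
    using assms(1) by (auto simp: branch_def)
  consider "v = f" | "v \<in> set (h # xs)" | "v \<noteq> f" "v \<notin> set (h # xs)" by blast
  then show ?thesis
  proof cases
    case 1
    have "u \<in> set (h # xs)" using xs(2) by (metis last_in_set list.distinct(1))
    then have "simple_path E V [f, u]"
      using xs assms(4) 1 sym by (auto simp: simple_path_def dest: sympD)
    then have "f # h # xs = [f, u]" by (rule path_unique[OF xs(1)]) (use xs in auto)
    then show ?thesis using 1 by simp
  next
    case 2
    then obtain a b where ab: "h # xs = a @ v # b" using split_list by fast
    then have "simple_path E V (f # a @ [v])"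
      using xs(1) unfolding ab
      by (cases a) (auto simp: simple_path_def successively_append_iff simp flip: append_Cons)
    moreover obtain ys where "a @ [v] = h # ys" using ab by (cases a) auto
    ultimately have "v \<in> branch f h" unfolding branch_def by (metis (mono_tags) last_snoc mem_Collect_eq)
    then show ?thesis using assms by simp
  next
    case 3
    then have "simple_path E V (f # h # xs @ [v])"
      using xs assms(2,4) by (auto simp: simple_path_def successively_append_iff successively_Cons split: if_splits)
    then have "v \<in> branch f h" unfolding branch_def by (auto intro!: exI[of _ "xs @ [v]"])
    then show ?thesis using assms by simp
  qed
qed

lemma closed_Union_K: "W \<subseteq> V \<Longrightarrow> closed (\<Union>v\<in>W. K v)"
  using finite_V closed_K by (intro closed_UN) (auto intro: finite_subset)

text \<open>Hence cutting one edge splits the union of all pieces into two closed sets with at most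
  one common point, the situation of \<open>arc_stays\<close>.\<close>

lemma branch_Int:
  assumes "x \<in> (\<Union>v\<in>V - branch f h. K v) \<inter> (\<Union>v\<in>branch f h. K v)"
  shows "x \<in> K f \<inter> K h"
proof -
  obtain a b where "a \<in> V" "a \<notin> branch f h" "b \<in> branch f h" "x \<in> K a" "x \<in> K b"
    using assms by auto
  then show ?thesis using touch[of b a x] branch_subset[of f h] branch_boundary[of b f h a] by auto
qed

text \<open>Suppose that the arc visits a piece \<open>K z\<close>, and let \<open>h\<close> be the
  first vertex on the way from \<open>u\<close> to \<open>z\<close>. By \<open>arc_stays\<close> the
  arc avoids the branch behind \<open>h\<close> except for points of
  \<open>K u \<inter> K h\<close>, so the visited point lies in \<open>K u\<close>.\<close>

lemma arc_in_cell:
  fixes g :: "real \<Rightarrow> 'b"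
  assumes g: "continuous_on {s..t} g" "inj_on g {s..t}" "g ` {s..t} \<subseteq> (\<Union>v\<in>V. K v)"
    and u: "u \<in> V" "g s \<in> K u" "g t \<in> K u"
  shows "g ` {s..t} \<subseteq> K u"
proof
  fix x assume x: "x \<in> g ` {s..t}"
  then obtain z where z: "z \<in> V" "x \<in> K z" using g by auto
  show "x \<in> K u"
  proof (cases "z = u")
    case False
    obtain xs where "simple_path E V xs" "hd xs = u" "last xs = z" using path_exists u z by metis
    then obtain h ys where xs: "simple_path E V (u # h # ys)" "last (h # ys) = z"
      using False by (cases xs; cases "tl xs") (auto simp: simple_path_def)
    then have h: "h \<in> V" "E u h" "z \<in> branch u h" by (auto simp: simple_path_def branch_def)
    have "g ` {s..t} \<subseteq> (\<Union>v\<in>V - branch u h. K v)"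
    proof (rule arc_stays[OF g(1,2)])
      show "g ` {s..t} \<subseteq> (\<Union>v\<in>V - branch u h. K v) \<union> (\<Union>v\<in>branch u h. K v)" using g(3) by blast
      show "g s \<in> (\<Union>v\<in>V - branch u h. K v)" "g t \<in> (\<Union>v\<in>V - branch u h. K v)"
        using u branch_self[of u h] by auto
      show "closed (\<Union>v\<in>V - branch u h. K v)" "closed (\<Union>v\<in>branch u h. K v)"
        using branch_subset by (auto intro!: closed_Union_K)
      show "x = y" if "x \<in> (\<Union>v\<in>V - branch u h. K v) \<inter> (\<Union>v\<in>branch u h. K v)"
        "y \<in> (\<Union>v\<in>V - branch u h. K v) \<inter> (\<Union>v\<in>branch u h. K v)" for x y
        using branch_Int[OF that(1)] branch_Int[OF that(2)] touch_unique[OF u(1) h(1,2)] by simp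
    qed
    then show ?thesis using branch_Int[of x u h] x z h by auto
  qed (use z in simp)
qed

text \<open>Cutting the edge from \<open>u\<close> to \<open>v\<close> separates the two ends of the
  arc, so it passes through \<open>K u \<inter> K v\<close>; up to that moment both ends lie in
  \<open>K u\<close> and \<open>arc_in_cell\<close> applies.\<close>

lemma arc_step:
  fixes g :: "real \<Rightarrow> 'b"
  assumes g: "s \<le> t" "continuous_on {s..t} g" "inj_on g {s..t}" "g ` {s..t} \<subseteq> (\<Union>v\<in>V. K v)"
    and p: "simple_path E V (u # v # ys)" "g s \<in> K u" "g t \<in> K (last (v # ys))"
  obtains r where "r \<in> {s..t}" "g r \<in> K u \<inter> K v" "g ` {s..r} \<subseteq> K u"
proof -
  have u: "u \<in> V" using p by (auto simp: simple_path_def)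
  have "last (v # ys) \<in> branch u v" using p(1) by (auto simp: branch_def)
  then have gt: "g t \<in> (\<Union>z\<in>branch u v. K z)" using p(3) by blast
  have gs: "g s \<in> (\<Union>z\<in>V - branch u v. K z)" using p(2) u branch_self[of u v] by blast
  obtain r where r: "r \<in> {s..t}"
      "g r \<in> (\<Union>z\<in>V - branch u v. K z) \<inter> (\<Union>z\<in>branch u v. K z)"
  proof (rule arc_meets_Int[OF g(1,2) _ _ _ gs gt])
    show "closed (\<Union>v\<in>V - branch u v. K v)" "closed (\<Union>v\<in>branch u v. K v)"
      using branch_subset by (auto intro!: closed_Union_K)
    show "g ` {s..t} \<subseteq> (\<Union>z\<in>V - branch u v. K z) \<union> (\<Union>z\<in>branch u v. K z)" using g(4) by blast
  qed
  then have ruv: "g r \<in> K u \<inter> K v" by (intro branch_Int)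
  have "g ` {s..r} \<subseteq> K u"
  proof (rule arc_in_cell)
    show "continuous_on {s..r} g" using g(2) by (rule continuous_on_subset) (use r in auto)
    show "inj_on g {s..r}" using g(3) by (rule inj_on_subset) (use r in auto)
  qed (use u p(2) ruv g(4) r in auto)
  with r(1) ruv show ?thesis by (rule that)
qed

end

section \<open>Labyrinths in barycentric coordinates\<close>

lemma UNIV_3_eq:
  fixes i j k :: 3
  assumes "i \<noteq> j" "i \<noteq> k" "j \<noteq> k"
  shows "(UNIV :: 3 set) = {i, j, k}"
proof -
  have "card {i, j, k} = CARD(3)" using assms by simp
  then show ?thesis by (metis card_subset_eq finite subset_UNIV)
qed

lemma index_3_cases: "i \<noteq> j \<Longrightarrow> i \<noteq> k \<Longrightarrow> j \<noteq> k \<Longrightarrow> l = i \<or> l = j \<or> l = (k :: 3)"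
  using UNIV_3_eq[of i j k] by blast

lemma sum_UNIV_3_eq:
  fixes i j k :: 3
  assumes "i \<noteq> j" "i \<noteq> k" "j \<noteq> k"
  shows "(\<Sum>l\<in>UNIV. f l) = f i + f j + (f k :: 'a::comm_monoid_add)"
  using assms by (subst UNIV_3_eq[OF assms]) (simp add: add.assoc)

lemma other_index_3: "\<exists>k. k \<noteq> (i :: 3) \<and> k \<noteq> j"
proof -
  have "card {i, j} \<le> 2" by (simp add: card_insert_if)
  then have "card {i, j} \<noteq> CARD(3)" by simp
  then have "{i, j} \<noteq> UNIV" by metis
  then show ?thesis by auto
qed

lemma other_indices_3: "\<exists>j k. j \<noteq> (i :: 3) \<and> k \<noteq> i \<and> k \<noteq> j"
  using other_index_3 by meson

lemma eq_of_le_powers: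
  fixes x y :: real and m :: nat
  assumes "m \<ge> 2" "\<And>n. \<bar>x - y\<bar> \<le> (1 / m) ^ n"
  shows "x = y"
proof -
  have "(\<lambda>n. (1 / real m) ^ n) \<longlonglongrightarrow> 0" using assms(1) by (intro LIMSEQ_power_zero) auto
  then have "\<bar>x - y\<bar> \<le> 0" by (rule tendsto_lowerbound) (use assms in auto)
  then show ?thesis by simp
qed

text \<open>
  A cell \<open>(b, u)\<close> stands for the homothety \<open>x \<mapsto> (u \<plusminus> x) / m\<close> of the plane of barycentric coordinates,
  with sign \<open>+\<close> iff \<open>b\<close>. So \<open>T m k\<close> is the cell \<open>(True, k)\<close>, but \<open>T' m k\<close> is \<open>(False, k + 1)\<close>
  with \<open>1\<close> added to every entry: its vertices are \<open>(k + (1, 1, 1) - e\<^sub>i) / m\<close>.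
\<close>

type_synonym cell = "bool \<times> (int^3)"

definition orient :: "bool \<Rightarrow> real" where
  "orient b = (if b then 1 else -1)"

definition real_vec :: "int^3 \<Rightarrow> real^3" where
  "real_vec u = (\<chi> i. real_of_int (u $ i))"

definition cell_map :: "nat \<Rightarrow> cell \<Rightarrow> real^3 \<Rightarrow> real^3" where
  "cell_map m a x = (1 / real m) *\<^sub>R (real_vec (snd a) + orient (fst a) *\<^sub>R x)"

definition cell_inv :: "nat \<Rightarrow> cell \<Rightarrow> real^3 \<Rightarrow> real^3" where
  "cell_inv m a x = orient (fst a) *\<^sub>R (real m *\<^sub>R x - real_vec (snd a))"

text \<open>The relation of \<open>neighbours\<close> after the shift by 1 in down cells:
  \<open>k $ l = k' $ l + 1\<close> turns into equality of the stored entries at \<open>l\<close>,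
  and equality elsewhere into a difference of 1.\<close>

definition link :: "3 \<Rightarrow> cell \<Rightarrow> cell \<Rightarrow> bool" where
  "link l a b \<longleftrightarrow> fst a \<and> \<not> fst b \<and> snd b $ l = snd a $ l \<and> (\<forall>i. i \<noteq> l \<longrightarrow> snd b $ i = snd a $ i + 1)"

definition linked :: "3 \<Rightarrow> cell \<Rightarrow> cell \<Rightarrow> bool" where
  "linked l a b \<longleftrightarrow> link l a b \<or> link l b a"

definition adj :: "cell \<Rightarrow> cell \<Rightarrow> bool" where
  "adj a b \<longleftrightarrow> (\<exists>l. linked l a b)"

definition strip_index :: "3 \<Rightarrow> cell \<Rightarrow> int" where
  "strip_index i a = (if fst a then snd a $ i else snd a $ i - 1)"

lemma orient_simps [simp]: "orient True = 1" "orient False = -1" "orient b * orient b = 1" "\<bar>orient b\<bar> = 1"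
  by (auto simp: orient_def)

lemma real_vec_nth [simp]: "real_vec u $ i = real_of_int (u $ i)"
  by (simp add: real_vec_def)

lemma cell_map_nth: "cell_map m a x $ i = (real_of_int (snd a $ i) + orient (fst a) * x $ i) / real m"
  by (simp add: cell_map_def)

lemma linked_sym: "linked l a b \<Longrightarrow> linked l b a"
  by (auto simp: linked_def)

lemma adj_sym: "symp adj"
  unfolding adj_def by (rule sympI) (metis linked_sym)

lemma linked_fst: "linked l a b \<Longrightarrow> fst b = (\<not> fst a)"
  by (auto simp: linked_def link_def)

lemma linked_label_unique:
  assumes "linked l a b" "linked l' a b"
  shows "l = l'"
proof (rule ccontr)
  assume "l \<noteq> l'"
  then show False using assms by (auto simp: linked_def link_def)
qed

text \<open>There is only one cell across each side, so a path that leaves a cell through the side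
  of entry would return to its previous cell.\<close>

lemma linked_unique:
  assumes "linked l a b" "linked l a b'"
  shows "b = b'"
proof -
  have "snd b $ i = snd b' $ i" for i using assms by (cases "i = l") (auto simp: linked_def link_def)
  then have "snd b = snd b'" by (simp add: vec_eq_iff)
  then show ?thesis using linked_fst[OF assms(1)] linked_fst[OF assms(2)] by (simp add: prod_eq_iff)
qed

lemma strip_index_linked: "linked l a b \<Longrightarrow> l \<noteq> i \<Longrightarrow> strip_index i a = strip_index i b"
  by (auto simp: linked_def link_def strip_index_def)

definition label :: "cell \<Rightarrow> cell \<Rightarrow> 3" where
  "label a b = (THE l. linked l a b)"

lemma label_eq: "linked l a b \<Longrightarrow> label a b = l"
  unfolding label_def by (rule the_equality) (auto dest: linked_label_unique)

lemma linked_label: "adj a b \<Longrightarrow> linked (label a b) a b"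
  by (metis adj_def label_eq)

text \<open>The itinerary of a path of cells: every cell comes with the labels of the sides of entry
  and of exit. The parameters \<open>x\<close> and \<open>y\<close> supply the side of entry into
  the first cell and the side of exit from the last.\<close>

fun steps :: "3 \<Rightarrow> cell list \<Rightarrow> 3 \<Rightarrow> (cell \<times> 3 \<times> 3) list" where
  "steps x [] y = []"
| "steps x [a] y = [(a, x, y)]"
| "steps x (a # b # as) y = (a, x, label a b) # steps (label a b) (b # as) y"

definition arc_in :: "'a::topological_space set \<Rightarrow> (real \<Rightarrow> 'a) \<Rightarrow> real \<Rightarrow> real \<Rightarrow> bool" where
  "arc_in X g s t \<longleftrightarrow> s \<le> t \<and> continuous_on {s..t} g \<and> inj_on g {s..t} \<and> g ` {s..t} \<subseteq> X"

lemma arc_in_sub: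
  assumes "arc_in X g s t" "s \<le> s'" "s' \<le> t'" "t' \<le> t" "g ` {s'..t'} \<subseteq> Y"
  shows "arc_in Y g s' t'"
proof -
  have "{s'..t'} \<subseteq> {s..t}" using assms by auto
  then show ?thesis using assms unfolding arc_in_def
    by (auto intro: continuous_on_subset inj_on_subset)
qed

lemma arc_in_reverse:
  assumes "arc_in X g s t"
  shows "arc_in X (\<lambda>x. g (- x)) (- t) (- s)"
proof -
  have "continuous_on {- t..- s} (\<lambda>x. g (- x))"
    by (rule continuous_on_compose2[of "{s..t}" g]) (use assms in \<open>auto simp: arc_in_def intro: continuous_intros\<close>)
  moreover have "inj_on (\<lambda>x. g (- x)) {- t..- s}"
  proof (rule inj_onI)
    fix x y assume "x \<in> {- t..- s}" "y \<in> {- t..- s}" "g (- x) = g (- y)"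
    then have "- x = - y" using assms by (intro inj_onD[of g "{s..t}"]) (auto simp: arc_in_def)
    then show "x = y" by simp
  qed
  moreover have "(\<lambda>x. g (- x)) ` {- t..- s} \<subseteq> X" using assms by (force simp: arc_in_def)
  ultimately show ?thesis using assms by (auto simp: arc_in_def)
qed

text \<open>
  The colours are \<open>True\<close> (white) and \<open>False\<close> (yellow). A down cell carries the other colour turned
  by a half turn, hence \<open>L (c = fst a)\<close>. Both kinds of exits are encoded at once by
  \<open>ex c j + ex (\<not> c) j = (m - 1) (1 - e\<^sub>j)\<close>: across a side labelled \<open>j\<close>, an exit meets the exit of
  the other colour.
\<close>

locale labyrinth =
  fixes m :: nat and Pat :: "bool \<Rightarrow> cell set" and ex :: "bool \<Rightarrow> 3 \<Rightarrow> int^3" and L :: "bool \<Rightarrow> (real^3) set"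
  assumes m: "m \<ge> 2"
    and Pat_up: "(True, u) \<in> Pat c \<Longrightarrow> 0 \<le> u $ i" "(True, u) \<in> Pat c \<Longrightarrow> (\<Sum>i\<in>UNIV. u $ i) = int m - 1"
    and Pat_down: "(False, u) \<in> Pat c \<Longrightarrow> 1 \<le> u $ i" "(False, u) \<in> Pat c \<Longrightarrow> (\<Sum>i\<in>UNIV. u $ i) = int m + 1"
    and finite_Pat: "finite (Pat c)"
    and exits: "(True, ex c j) \<in> Pat c" "ex c j $ j = 0" "i \<noteq> j \<Longrightarrow> ex c j $ i + ex (\<not> c) j $ i = int m - 1"
    and exit_unique: "(True, u) \<in> Pat c \<Longrightarrow> (True, v) \<in> Pat (\<not> c) \<Longrightarrow> u $ j = 0 \<Longrightarrow> v $ j = 0 \<Longrightarrow>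
      (\<And>i. i \<noteq> j \<Longrightarrow> u $ i + v $ i = int m - 1) \<Longrightarrow> u = ex c j"
    and corner_unique: "(True, u) \<in> Pat c \<Longrightarrow> u $ i = int m - 1 \<Longrightarrow> (True, v) \<in> Pat c \<Longrightarrow> v $ j = int m - 1 \<Longrightarrow> i = j"
    and corner_disjoint: "(True, u) \<in> Pat c \<Longrightarrow> u $ i = int m - 1 \<Longrightarrow> (True, u) \<notin> Pat (\<not> c)"
    and paths: "a \<in> Pat c \<Longrightarrow> b \<in> Pat c \<Longrightarrow> \<exists>xs. simple_path adj (Pat c) xs \<and> hd xs = a \<and> last xs = b"
      "simple_path adj (Pat c) xs \<Longrightarrow> simple_path adj (Pat c) ys \<Longrightarrow> hd xs = hd ys \<Longrightarrow> last xs = last ys \<Longrightarrow> xs = ys"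
    and L_simplex: "x \<in> L c \<Longrightarrow> 0 \<le> x $ i" "x \<in> L c \<Longrightarrow> (\<Sum>i\<in>UNIV. x $ i) = 1"
    and L_closed: "closed (L c)"
    and L_step: "x \<in> L c \<Longrightarrow> \<exists>a\<in>Pat c. \<exists>y\<in>L (c = fst a). x = cell_map m a y"
begin

lemma m_pos: "0 < real m" "1 < real m" "0 < real m - 1" using m by auto

lemma L_le_1: "x \<in> L c \<Longrightarrow> x $ i \<le> 1"
  using L_simplex[of x c] member_le_sum[of i UNIV "\<lambda>i. x $ i"] by auto

lemma L_corner_others: "x \<in> L c \<Longrightarrow> x $ i = 1 \<Longrightarrow> j \<noteq> i \<Longrightarrow> x $ j = 0"
proof -
  assume x: "x \<in> L c" "x $ i = 1" "j \<noteq> i"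
  obtain k where k: "k \<noteq> i" "k \<noteq> j" using other_index_3 x(3) by metis
  show "x $ j = 0"
    using L_simplex(1)[OF x(1), of j] L_simplex(1)[OF x(1), of k] L_simplex(2)[OF x(1)] x(2,3)
      sum_UNIV_3_eq[of i j k "\<lambda>l. x $ l"] k by simp
qed

lemma cell_map_nth_mult: "real m * cell_map m a x $ i = real_of_int (snd a $ i) + orient (fst a) * x $ i"
  using m by (simp add: cell_map_nth)

lemma cell_inv_map [simp]: "cell_inv m a (cell_map m a x) = x"
  using m by (simp add: cell_inv_def cell_map_def)

lemma cell_map_inv [simp]: "cell_map m a (cell_inv m a x) = x"
  using m by (simp add: cell_inv_def cell_map_def)

lemma cell_inv_dist: "dist (cell_inv m a x) (cell_inv m a y) = real m * dist x y"
proof -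
  have "cell_inv m a x - cell_inv m a y = (orient (fst a) * real m) *\<^sub>R (x - y)"
    by (simp add: cell_inv_def algebra_simps)
  then show ?thesis by (simp add: dist_norm abs_mult)
qed

text \<open>Carries the corners property from cells to points. At a corner two coordinates vanish;
  in a down cell, whose entries are at least 1, the preimage would then have two coordinates at
  least 1, although they sum to at most 1.\<close>

lemma L_corner_cell:
  assumes "x \<in> L c" "x $ i = 1"
  obtains u where "(True, u) \<in> Pat c" "u $ i = int m - 1"
proof -
  obtain b u y where a: "(b, u) \<in> Pat c" "y \<in> L (c = b)" "x = cell_map m (b, u) y"
    using L_step[OF assms(1)] by auto
  have eq: "real m * x $ l = real_of_int (u $ l) + orient b * y $ l" for l
    using cell_map_nth_mult[of "(b, u)" y l] a(3) by simp
  obtain j k where j: "j \<noteq> i" and k: "k \<noteq> i" "k \<noteq> j" using other_indices_3 by blast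
  have x0: "x $ j = 0" "x $ k = 0" using L_corner_others assms j k by auto
  have y: "0 \<le> y $ i" "0 \<le> y $ j" "0 \<le> y $ k" "y $ i + y $ j + y $ k = 1"
    using L_simplex[OF a(2)] sum_UNIV_3_eq[of i j k "\<lambda>l. y $ l"] j k by auto
  show ?thesis
  proof (cases b)
    case True
    have "0 \<le> u $ j" "0 \<le> u $ k" "u $ i + u $ j + u $ k = int m - 1"
      using Pat_up[of u c] a(1) True sum_UNIV_3_eq[of i j k "\<lambda>l. u $ l"] j k by auto
    moreover have "u $ j = 0" "u $ k = 0"
      using eq[of j] eq[of k] x0 True y calculation by auto
    ultimately show ?thesis using that a(1) True by auto
  next
    case False
    have "1 \<le> u $ j" "1 \<le> u $ k" using Pat_down[of u c] a(1) False by auto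
    then show ?thesis using eq[of j] eq[of k] x0 False y by auto
  qed
qed

lemma up_cell_corner_eq:
  assumes "(True, u) \<in> Pat c" "u $ i = int m - 1" "(True, v) \<in> Pat c'" "v $ i = int m - 1"
  shows "u = v"
proof -
  obtain j k where j: "j \<noteq> i" and k: "k \<noteq> i" "k \<noteq> j" using other_indices_3 by blast
  have s: "w $ j = 0 \<and> w $ k = 0" if "(True, w) \<in> Pat d" "w $ i = int m - 1" for w d
    using Pat_up(1)[OF that(1), of j] Pat_up(1)[OF that(1), of k] Pat_up(2)[OF that(1)]
      sum_UNIV_3_eq[of i j k "\<lambda>l. w $ l"] j k that(2) by auto
  have "u $ l = v $ l" for l
    using s[OF assms(1,2)] s[OF assms(3,4)] assms index_3_cases[of i j k l] j k by auto
  then show ?thesis by (simp add: vec_eq_iff)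
qed

lemma L_corner_unique: "x \<in> L c \<Longrightarrow> x $ i = 1 \<Longrightarrow> y \<in> L c \<Longrightarrow> y $ j = 1 \<Longrightarrow> i = j"
  by (metis L_corner_cell corner_unique)

lemma L_corner_disjoint: "x \<in> L c \<Longrightarrow> x $ i = 1 \<Longrightarrow> y \<in> L (\<not> c) \<Longrightarrow> y $ i \<noteq> 1"
  by (metis L_corner_cell corner_disjoint up_cell_corner_eq)

text \<open>Used for points in cells of equal orientation. A nonzero integer difference of sum 0 has
  a positive and a negative entry. As coordinates lie between 0 and 1, \<open>x\<close> and
  \<open>y\<close> would be two different corners in the same colour.\<close>

lemma L_diff_Ints:
  assumes xy: "x \<in> L c" "y \<in> L c" and int: "\<And>i. x $ i - y $ i \<in> \<int>"
  shows "x = y"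
proof (rule ccontr)
  assume "x \<noteq> y"
  have one: "z $ i = 1" if "z \<in> L c" "w \<in> L c" "z $ i - w $ i \<in> \<int>" "z $ i > w $ i" for z w i
  proof -
    from that(3) obtain n where n: "z $ i - w $ i = real_of_int n" by (rule Ints_cases)
    have "0 < n" using n that(4) by (metis diff_gt_0_iff_gt of_int_0_less_iff)
    then have "1 \<le> z $ i - w $ i" using n by simp
    then show ?thesis using L_le_1[OF that(1), of i] L_simplex(1)[OF that(2), of i] by simp
  qed
  have s: "(\<Sum>i\<in>UNIV. x $ i - y $ i) = 0" using L_simplex(2) xy by (simp add: sum_subtractf)
  have "\<exists>i. x $ i > y $ i"
  proof (rule ccontr)
    assume *: "\<nexists>i. x $ i > y $ i"
    then have "\<forall>i\<in>UNIV. - (x $ i - y $ i) = 0"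
      using s by (subst sum_nonneg_eq_0_iff[symmetric]) (auto simp: sum_negf not_less simp del: minus_diff_eq)
    then show False using \<open>x \<noteq> y\<close> by (auto simp: vec_eq_iff)
  qed
  moreover have "\<exists>i. y $ i > x $ i"
  proof (rule ccontr)
    assume *: "\<nexists>i. y $ i > x $ i"
    then have "\<forall>i\<in>UNIV. x $ i - y $ i = 0"
      using s by (subst sum_nonneg_eq_0_iff[symmetric]) (auto simp: not_less)
    then show False using \<open>x \<noteq> y\<close> by (auto simp: vec_eq_iff)
  qed
  ultimately obtain i j where ij: "x $ i > y $ i" "y $ j > x $ j" by auto
  have "y $ j - x $ j \<in> \<int>" using int[of j] by (metis Ints_minus minus_diff_eq)
  then have "x $ i = 1" "y $ j = 1" using one ij int xy by auto
  then have "i = j" using L_corner_unique xy by blast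
  then show False using ij by simp
qed

text \<open>Used for points in cells of opposite orientation. Each of the three sums is 0, 1 or 2,
  and 2 would be a corner common to both colours. The total is 2, so exactly one of them is
  0.\<close>

lemma L_sum_Ints:
  assumes xy: "x \<in> L c" "y \<in> L (\<not> c)" and int: "\<And>i. x $ i + y $ i \<in> \<int>"
  shows "\<exists>l. x $ l = 0 \<and> y $ l = 0 \<and> (\<forall>i. i \<noteq> l \<longrightarrow> x $ i + y $ i = 1)"
proof -
  have cases: "x $ i + y $ i = 0 \<or> x $ i + y $ i = 1" for i
  proof -
    from int[of i] obtain n where n: "x $ i + y $ i = real_of_int n" by (rule Ints_cases)
    have b: "0 \<le> x $ i" "x $ i \<le> 1" "0 \<le> y $ i" "y $ i \<le> 1" using L_simplex L_le_1 xy by auto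
    have "n \<noteq> 2" using L_corner_disjoint[OF xy(1) _ xy(2), of i] b n by auto
    moreover have "0 \<le> n" "n \<le> 2" using b n by linarith+
    ultimately show ?thesis using n by (cases "n = 0"; cases "n = 1") auto
  qed
  have s: "(x $ 1 + y $ 1) + (x $ 2 + y $ 2) + (x $ 3 + y $ 3) = 2"
    using L_simplex(2)[OF xy(1)] L_simplex(2)[OF xy(2)] by (simp add: sum_3)
  have nn: "0 \<le> x $ i" "0 \<le> y $ i" for i using L_simplex xy by auto
  obtain l where l: "x $ l + y $ l = 0" "\<forall>i. i \<noteq> l \<longrightarrow> x $ i + y $ i = 1"
    using cases[of 1] cases[of 2] cases[of 3] s that[of 1] that[of 2] that[of 3]
    by (auto simp: forall_3)
  then show ?thesis using nn[of l] by (intro exI[of _ l]) auto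
qed

text \<open>The fixed point of the homothety of the exit cell: \<open>x = (ex c j + x) / m\<close>
  gives the denominator \<open>m - 1\<close>.\<close>

definition exit_pt :: "bool \<Rightarrow> 3 \<Rightarrow> real^3" where
  "exit_pt c j = (1 / (real m - 1)) *\<^sub>R real_vec (ex c j)"

lemma exit_pt_nth: "exit_pt c j $ i = real_of_int (ex c j $ i) / (real m - 1)"
  by (simp add: exit_pt_def)

lemma exit_pt_self [simp]: "exit_pt c j $ j = 0"
  by (simp add: exit_pt_nth exits)

lemma exit_pt_sum: "i \<noteq> j \<Longrightarrow> exit_pt c j $ i + exit_pt (\<not> c) j $ i = 1"
  using exits(3)[of i j c] m_pos
  by (simp add: exit_pt_nth add_divide_distrib[symmetric] flip: of_int_add)

lemma exit_pt_bounds: "0 \<le> exit_pt c j $ i" "exit_pt c j $ i \<le> 1"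
proof -
  show nn: "0 \<le> exit_pt c j $ i" for c j i
    using Pat_up(1)[OF exits(1)] m_pos by (simp add: exit_pt_nth)
  show "exit_pt c j $ i \<le> 1"
    using exit_pt_sum[of i j c] nn[of "\<not> c" j i] nn[of c j i] by (cases "i = j") auto
qed

lemma exit_pt_fixed: "cell_map m (True, ex c j) (exit_pt c j) = exit_pt c j"
proof -
  have "cell_map m (True, ex c j) (exit_pt c j) $ i = exit_pt c j $ i" for i
    using m_pos by (simp add: cell_map_nth exit_pt_nth field_simps)
  then show ?thesis by (simp add: vec_eq_iff)
qed

text \<open>
  Across a side labelled \<open>j\<close>, the points \<open>x\<close> and \<open>(1, 1, 1) - e\<^sub>j - x\<close> coincide. Such a pair can only lie
  in the pair of exits, where it is the image of a pair of the same kind, so the contraction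
  towards the exit point forces \<open>x\<close> to be that point.
\<close>

lemma exit_pt_unique:
  assumes "x \<in> L c" "y \<in> L (\<not> c)" "x $ j = 0" "y $ j = 0" "\<And>i. i \<noteq> j \<Longrightarrow> x $ i + y $ i = 1"
  shows "x = exit_pt c j"
proof -
  have step: "\<exists>x'\<in>L c. \<exists>y'\<in>L (\<not> c). x = cell_map m (True, ex c j) x' \<and> x' $ j = 0 \<and> y' $ j = 0 \<and>
      (\<forall>i. i \<noteq> j \<longrightarrow> x' $ i + y' $ i = 1)"
    if xy: "x \<in> L c" "y \<in> L (\<not> c)" "x $ j = 0" "y $ j = 0" "\<And>i. i \<noteq> j \<Longrightarrow> x $ i + y $ i = 1" for x y
  proof -
    obtain b u x' where a: "(b, u) \<in> Pat c" "x' \<in> L (c = b)" "x = cell_map m (b, u) x'"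
      using L_step[OF xy(1)] by auto
    obtain b' v y' where a': "(b', v) \<in> Pat (\<not> c)" "y' \<in> L ((\<not> c) = b')" "y = cell_map m (b', v) y'"
      using L_step[OF xy(2)] by auto
    have eq: "real m * x $ i = real_of_int (u $ i) + orient b * x' $ i"
      "real m * y $ i = real_of_int (v $ i) + orient b' * y' $ i" for i
      using cell_map_nth_mult[of "(b, u)" x' i] cell_map_nth_mult[of "(b', v)" y' i] a(3) a'(3) by simp_all
    have nn: "0 \<le> x' $ i" "x' $ i \<le> 1" "0 \<le> y' $ i" "y' $ i \<le> 1" for i
      using L_simplex L_le_1 a a' by auto
    have int: "orient b * x' $ i + orient b' * y' $ i \<in> \<int>" for i
    proof (cases "i = j")
      case True
      have "orient b * x' $ i + orient b' * y' $ i = real_of_int (- u $ i - v $ i)"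
        using eq[of i] xy(3,4) True by simp
      then show ?thesis by (metis Ints_of_int)
    next
      case False
      have "real m * x $ i + real m * y $ i = real m"
        using xy(5)[OF False] by (metis distrib_left mult.right_neutral)
      then have "orient b * x' $ i + orient b' * y' $ i = real_of_int (int m - u $ i - v $ i)"
        using eq[of i] by simp
      then show ?thesis by (metis Ints_of_int)
    qed
    \<comment> \<open>Only two up cells are possible. For opposite orientations the preimages have
      the same colour and coincide by \<open>L_diff_Ints\<close>, although their \<open>j\<close>-th
      coordinates are 0 and 1; two down cells would put corner \<open>j\<close> into both
      colours.\<close>
    show ?thesis
    proof (cases b)
      case b: True
      have uj: "u $ j = 0" "x' $ j = 0"
        using eq(1)[of j] xy(3) b nn(1)[of j] Pat_up(1)[of u c j] a(1) by auto
      show ?thesis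
      proof (cases b')
        case b': True
        have vj: "v $ j = 0" "y' $ j = 0"
          using eq(2)[of j] xy(4) b' nn(3)[of j] Pat_up(1)[of v "\<not> c" j] a'(1) by auto
        obtain l where l: "x' $ l = 0" "y' $ l = 0" "\<forall>i. i \<noteq> l \<longrightarrow> x' $ i + y' $ i = 1"
          using L_sum_Ints[of x' c y'] a a' b b' int by auto
        then have "l = j" using uj vj by (metis add.right_neutral zero_neq_one)
        have "u $ i + v $ i = int m - 1" if "i \<noteq> j" for i
        proof -
          have "real m * x $ i + real m * y $ i = real m"
            using xy(5)[OF that] by (metis distrib_left mult.right_neutral)
          moreover have "x' $ i + y' $ i = 1" using l \<open>l = j\<close> that by simp
          ultimately have "real_of_int (u $ i + v $ i) = real_of_int (int m - 1)"
            using eq[of i] b b' by simp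
          then show ?thesis by (simp only: of_int_eq_iff)
        qed
        then have "u = ex c j" using exit_unique[of u c v j] a a' b b' uj vj by simp
        then show ?thesis using a a' b b' l \<open>l = j\<close> by (intro bexI[of _ x'] bexI[of _ y']) auto
      next
        case b': False
        have "x' = y'" using L_diff_Ints[of x' c y'] a a' b b' int by simp
        then show ?thesis
          using uj eq(2)[of j] xy(4) b' Pat_down(1)[of v "\<not> c" j] a'(1) by auto
      qed
    next
      case b: False
      have uj: "x' $ j = 1"
        using eq(1)[of j] xy(3) b nn(2)[of j] Pat_down(1)[of u c j] a(1) by auto
      show ?thesis
      proof (cases b')
        case b': True
        have vj: "y' $ j = 0"
          using eq(2)[of j] xy(4) b' nn(3)[of j] Pat_up(1)[of v "\<not> c" j] a'(1) by auto
        have "y' = x'" using L_diff_Ints[of y' "\<not> c" x'] a a' b b' int by (simp add: add.commute)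
        then show ?thesis using uj vj by simp
      next
        case b': False
        have vj: "y' $ j = 1"
          using eq(2)[of j] xy(4) b' nn(4)[of j] Pat_down(1)[of v "\<not> c" j] a'(1) by auto
        then show ?thesis using uj L_corner_disjoint[of y' c j x'] a a' b b' by simp
      qed
    qed
  qed
  have "\<bar>x $ i - exit_pt c j $ i\<bar> \<le> (1 / m) ^ n" for i n
    using assms
  proof (induction n arbitrary: x y)
    case 0
    then show ?case
      using L_simplex(1)[of x c i] L_le_1[of x c i] exit_pt_bounds[of c j i] by simp
  next
    case (Suc n)
    obtain x' y' where x': "x' \<in> L c" "y' \<in> L (\<not> c)" "x = cell_map m (True, ex c j) x'"
        "x' $ j = 0" "y' $ j = 0" "\<And>i. i \<noteq> j \<Longrightarrow> x' $ i + y' $ i = 1"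
      using step[OF Suc.prems] by auto
    have "x $ i - exit_pt c j $ i = (x' $ i - exit_pt c j $ i) / m"
      unfolding x'(3) by (subst exit_pt_fixed[symmetric]) (simp add: cell_map_nth diff_divide_distrib add_divide_distrib)
    then have "\<bar>x $ i - exit_pt c j $ i\<bar> = \<bar>x' $ i - exit_pt c j $ i\<bar> / m" by simp
    also have "\<dots> \<le> (1 / m) ^ n / m" using Suc.IH[OF x'(1,2,4,5,6)] by (intro divide_right_mono) auto
    finally show ?case by simp
  qed
  then have "x $ i = exit_pt c j $ i" for i using eq_of_le_powers[OF m] by blast
  then show ?thesis by (simp add: vec_eq_iff)
qed

text \<open>
  The fractal inside a cell. Two of these pieces meet at most in a gate, the common exit point of
  adjacent cells.
\<close>

definition K :: "bool \<Rightarrow> cell \<Rightarrow> (real^3) set" where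
  "K c a = cell_map m a ` L (c = fst a)"

definition gate :: "bool \<Rightarrow> cell \<Rightarrow> 3 \<Rightarrow> real^3" where
  "gate c a l = cell_map m a (exit_pt (c = fst a) l)"

lemma K_iff: "x \<in> K c a \<longleftrightarrow> cell_inv m a x \<in> L (c = fst a)"
  unfolding K_def by (metis cell_inv_map cell_map_inv image_iff)

lemma closed_K: "closed (K c a)"
proof -
  have "K c a = cell_inv m a -` L (c = fst a)" by (auto simp: K_iff)
  moreover have "continuous_on UNIV (cell_inv m a)"
    unfolding cell_inv_def by (intro continuous_intros)
  ultimately show ?thesis using L_closed continuous_closed_vimage by (metis continuous_on_eq_continuous_at open_UNIV UNIV_I)
qed

text \<open>Adjacent cells carry opposite colours, and \<open>exit_pt_sum\<close> says that the exit
  points of the two colours add up to the offset between the integer vectors of the cells.\<close>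

lemma gate_linked:
  assumes "linked l a b"
  shows "gate c a l = gate c b l"
proof -
  have *: "gate c a l = gate c b l" if "link l a b" for a b
  proof -
    have "gate c a l $ i = gate c b l $ i" for i
      using that exit_pt_sum[of i l c] by (cases "i = l") (auto simp: gate_def cell_map_nth link_def)
    then show ?thesis by (simp add: vec_eq_iff)
  qed
  then show ?thesis using assms by (auto simp: linked_def dest: *)
qed

text \<open>Equating the two homotheties makes the difference (equal orientation) or the sum
  (opposite orientation) of the preimages an integer vector. In the first case preimages and cells
  coincide; in the second \<open>L_sum_Ints\<close> finds the label and
  \<open>exit_pt_unique\<close> the point.\<close>

lemma K_touch:
  assumes "a \<in> Pat c" "b \<in> Pat c" "a \<noteq> b" "x \<in> K c a" "x \<in> K c b"
  shows "\<exists>l. linked l a b \<and> x = gate c a l"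
proof -
  have *: "\<exists>l. linked l a b \<and> x = gate c a l"
    if ab: "a \<in> Pat c" "b \<in> Pat c" "a \<noteq> b" "x \<in> K c a" "x \<in> K c b" and "fst a" for a b
  proof -
    obtain y z where yz: "y \<in> L (c = fst a)" "z \<in> L (c = fst b)" "x = cell_map m a y" "x = cell_map m b z"
      using ab by (auto simp: K_def)
    have eq: "real_of_int (snd a $ i) + y $ i = real_of_int (snd b $ i) + orient (fst b) * z $ i" for i
      using cell_map_nth_mult[of a y i] cell_map_nth_mult[of b z i] yz(3,4) \<open>fst a\<close> by simp
    show ?thesis
    proof (cases "fst b")
      case True
      have "y $ i - z $ i = real_of_int (snd b $ i - snd a $ i)" for i using eq[of i] True by simp
      then have "y = z" using L_diff_Ints[of y c z] yz True \<open>fst a\<close> by (simp add: Ints_of_int del: of_int_diff)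
      then have "snd a = snd b" using eq True by (simp add: vec_eq_iff)
      then show ?thesis using ab(3) True \<open>fst a\<close> by (simp add: prod_eq_iff)
    next
      case False
      have e: "y $ i + z $ i = real_of_int (snd b $ i - snd a $ i)" for i using eq[of i] False by simp
      obtain l where l: "y $ l = 0" "z $ l = 0" "\<And>i. i \<noteq> l \<Longrightarrow> y $ i + z $ i = 1"
        using L_sum_Ints[of y c z] yz False \<open>fst a\<close> e by (auto simp: Ints_of_int simp del: of_int_diff)
      then have "y = exit_pt c l" using exit_pt_unique[of y c z l] yz False \<open>fst a\<close> by simp
      moreover have "link l a b"
      proof -
        have "real_of_int (snd b $ l) = real_of_int (snd a $ l)" using e[of l] l by simp
        moreover have "real_of_int (snd b $ i) = real_of_int (snd a $ i + 1)" if "i \<noteq> l" for i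
          using e[of i] l(3)[OF that] by simp
        ultimately show ?thesis using False \<open>fst a\<close> unfolding link_def by (metis of_int_eq_iff)
      qed
      ultimately show ?thesis using yz \<open>fst a\<close> by (auto simp: linked_def gate_def)
    qed
  qed
  consider "fst a" | "fst b" | "\<not> fst a" "\<not> fst b" by blast
  then show ?thesis
  proof cases
    case 1
    then show ?thesis using * assms by blast
  next
    case 2
    then show ?thesis using *[of b a] assms gate_linked linked_sym by metis
  next
    case 3
    obtain y z where yz: "y \<in> L (\<not> c)" "z \<in> L (\<not> c)" "x = cell_map m a y" "x = cell_map m b z"
      using assms 3 by (auto simp: K_def)
    have eq: "real_of_int (snd a $ i) - y $ i = real_of_int (snd b $ i) - z $ i" for i
      using cell_map_nth_mult[of a y i] cell_map_nth_mult[of b z i] yz(3,4) 3 by simp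
    have "y $ i - z $ i = real_of_int (snd a $ i - snd b $ i)" for i using eq[of i] by simp
    then have "y = z" using L_diff_Ints[of y "\<not> c" z] yz by (simp add: Ints_of_int del: of_int_diff)
    then have "snd a = snd b" using eq by (simp add: vec_eq_iff)
    then show ?thesis using assms(3) 3 by (simp add: prod_eq_iff)
  qed
qed

lemma tree_cover_Pat: "tree_cover adj (Pat c) (K c)"
proof
  show "adj u v" if "u \<in> Pat c" "v \<in> Pat c" "u \<noteq> v" "x \<in> K c u" "x \<in> K c v" for u v x
    using K_touch[OF that] by (auto simp: adj_def)
  show "x = y" if "u \<in> Pat c" "v \<in> Pat c" "adj u v" "x \<in> K c u \<inter> K c v" "y \<in> K c u \<inter> K c v" for u v x y
  proof -
    have "u \<noteq> v" using that(3) by (auto simp: adj_def linked_def link_def)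
    then show ?thesis using K_touch[of u c v] that linked_label_unique by (metis IntD1 IntD2)
  qed
qed (use finite_Pat adj_sym paths closed_K in auto)

lemma L_subset_K: "L c \<subseteq> (\<Union>a\<in>Pat c. K c a)"
  using L_step by (fastforce simp: K_def)

lemma arc_in_single:
  assumes "arc_in (L c) g s t" "a \<in> Pat c" "g s \<in> K c a" "g t \<in> K c a"
  shows "arc_in (K c a) g s t"
proof -
  interpret tree_cover adj "Pat c" "K c" by (rule tree_cover_Pat)
  have "g ` {s..t} \<subseteq> K c a"
    by (rule arc_in_cell) (use assms L_subset_K[of c] in \<open>auto simp: arc_in_def intro: order_trans\<close>)
  then show ?thesis using assms by (auto simp: arc_in_def)
qed

lemma arc_in_first:
  assumes g: "arc_in (L c) g s t" and p: "simple_path adj (Pat c) (a # b # as)"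
    and ends: "g s \<in> K c a" "g t \<in> K c (last (b # as))"
  obtains r where "r \<in> {s..t}" "g r = gate c a (label a b)" "g r = gate c b (label a b)"
    "g r \<in> K c a" "g r \<in> K c b" "arc_in (K c a) g s r" "arc_in (L c) g r t"
proof -
  interpret tree_cover adj "Pat c" "K c" by (rule tree_cover_Pat)
  obtain r where r: "r \<in> {s..t}" "g r \<in> K c a \<inter> K c b" "g ` {s..r} \<subseteq> K c a"
    by (rule arc_step[OF _ _ _ _ p ends]) (use g L_subset_K[of c] in \<open>auto simp: arc_in_def intro: order_trans\<close>)
  have ab: "a \<in> Pat c" "b \<in> Pat c" "a \<noteq> b" using p by (auto simp: simple_path_def)
  obtain l where l: "linked l a b" "g r = gate c a l" using K_touch[OF ab, of "g r"] r(2) by blast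
  have "arc_in (K c a) g s r" by (rule arc_in_sub[OF g]) (use r in auto)
  moreover have "arc_in (L c) g r t" by (rule arc_in_sub[OF g]) (use r g in \<open>auto simp: arc_in_def\<close>)
  ultimately show thesis using that r l label_eq[OF l(1)] gate_linked[OF l(1)] by auto
qed

lemma arc_in_pull:
  assumes "arc_in (K c a) g s t"
  shows "arc_in (L (c = fst a)) (\<lambda>x. cell_inv m a (g x)) s t"
    "arc_length (\<lambda>x. cell_inv m a (g x)) s t \<le> ennreal m * arc_length g s t"
proof -
  have "continuous_on {s..t} (\<lambda>x. cell_inv m a (g x))"
    unfolding cell_inv_def using assms by (auto simp: arc_in_def intro!: continuous_intros)
  moreover have "inj_on (\<lambda>x. cell_inv m a (g x)) {s..t}"
    using assms unfolding arc_in_def inj_on_def by (metis cell_map_inv)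
  ultimately show "arc_in (L (c = fst a)) (\<lambda>x. cell_inv m a (g x)) s t"
    using assms by (auto simp: arc_in_def image_subset_iff K_iff)
  show "arc_length (\<lambda>x. cell_inv m a (g x)) s t \<le> ennreal m * arc_length g s t"
    by (rule arc_length_scale_le) (auto simp: cell_inv_dist)
qed

lemma cell_inv_gate [simp]: "cell_inv m a (gate c a l) = exit_pt (c = fst a) l"
  by (simp add: gate_def)

end

section \<open>Crossings of blocked type are infinitely long\<close>

lemma enn2real_sum_list:
  "sum_list xs < (\<infinity> :: ennreal) \<Longrightarrow>
     (\<forall>x\<in>set xs. x < \<infinity>) \<and> enn2real (sum_list xs) = sum_list (map enn2real xs)"
  by (induction xs) (auto simp: enn2real_plus)

lemma sum_list_vec_nth: "sum_list (xs :: (real^'n) list) $ i = sum_list (map (\<lambda>x. x $ i) xs)"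
  by (induction xs) auto

lemma sum_list_map_eq_0D:
  fixes f :: "'a \<Rightarrow> real"
  assumes "\<And>s. s \<in> set xs \<Longrightarrow> 0 \<le> f s" "sum_list (map f xs) = 0" "s \<in> set xs"
  shows "f s = 0"
proof -
  have "\<forall>y\<in>set (map f xs). y = 0"
    using assms(2) by (subst sum_list_nonneg_eq_0_iff[symmetric]) (use assms(1) in auto)
  then show ?thesis using assms(3) by simp
qed

lemma adj_fst: "adj a b \<Longrightarrow> fst b = (\<not> fst a)"
  unfolding adj_def by (metis linked_fst)

context labyrinth
begin

text \<open>Infinite also when no arc in \<open>L c\<close> joins the two exits.\<close>

definition crossing_length :: "bool \<Rightarrow> 3 \<Rightarrow> 3 \<Rightarrow> ennreal" where
  "crossing_length c x y =
     (INF (g, s, t)\<in>{(g, s, t). arc_in (L c) g s t \<and> g s = exit_pt c x \<and> g t = exit_pt c y}.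
        arc_length g s t)"

lemma crossing_length_le:
  "arc_in (L c) g s t \<Longrightarrow> g s = exit_pt c x \<Longrightarrow> g t = exit_pt c y \<Longrightarrow>
     crossing_length c x y \<le> arc_length g s t"
  unfolding crossing_length_def
  by (rule INF_lower2[of "(g, s, t)"]) auto

lemma crossing_length_geI:
  "(\<And>g s t. arc_in (L c) g s t \<Longrightarrow> g s = exit_pt c x \<Longrightarrow> g t = exit_pt c y \<Longrightarrow> v \<le> arc_length g s t) \<Longrightarrow>
     v \<le> crossing_length c x y"
  unfolding crossing_length_def by (rule INF_greatest) auto

lemma crossing_length_sym: "crossing_length c x y = crossing_length c y x"
proof -
  have le: "crossing_length c x y \<le> crossing_length c y x" for x y
  proof (rule crossing_length_geI)
    fix g s t assume g: "arc_in (L c) g s t" "g s = exit_pt c y" "g t = exit_pt c x"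
    have "crossing_length c x y \<le> arc_length (\<lambda>x. g (- x)) (- t) (- s)"
      by (rule crossing_length_le[OF arc_in_reverse[OF g(1)]]) (use g in auto)
    also have "\<dots> \<le> arc_length g s t" by (rule arc_length_reverse)
    finally show "crossing_length c x y \<le> arc_length g s t" .
  qed
  show ?thesis using le[of x y] le[of y x] by simp
qed

lemma crossing_length_ge_dist: "ennreal (dist (exit_pt c x) (exit_pt c y)) \<le> crossing_length c x y"
proof (rule crossing_length_geI)
  fix g s t assume g: "arc_in (L c) g s t" "g s = exit_pt c x" "g t = exit_pt c y"
  show "ennreal (dist (exit_pt c x) (exit_pt c y)) \<le> arc_length g s t"
    using dist_le_arc_length[of s t g] g by (simp add: arc_in_def)
qed

text \<open>Self-similarity: pulled back by the homothety of the cell, the piece is a crossing of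
  the whole fractal and \<open>m\<close> times as long.\<close>

lemma crossing_length_cell_le:
  assumes "arc_in (K c a) g s t" "g s = gate c a x" "g t = gate c a y"
  shows "ennreal (1 / m) * crossing_length (c = fst a) x y \<le> arc_length g s t"
proof -
  have "crossing_length (c = fst a) x y \<le> arc_length (\<lambda>x. cell_inv m a (g x)) s t"
    by (rule crossing_length_le[OF arc_in_pull(1)[OF assms(1)]]) (use assms in auto)
  also have "\<dots> \<le> ennreal m * arc_length g s t" by (rule arc_in_pull(2)[OF assms(1)])
  finally have "ennreal (1 / m) * crossing_length (c = fst a) x y \<le> ennreal (1 / m) * (ennreal m * arc_length g s t)"
    by (intro mult_left_mono) auto
  also have "\<dots> = ennreal (1 / m * m) * arc_length g s t"
    by (subst ennreal_mult) (auto simp: mult.assoc)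
  also have "\<dots> = arc_length g s t" using m by simp
  finally show ?thesis .
qed

text \<open>The arc is cut at the gates of its path of cells; in the induction the start
  \<open>s\<close> moves on from gate to gate.\<close>

lemma steps_length_le:
  assumes "simple_path adj (Pat c) xs" "arc_in (L c) g s t"
    and "g s = gate c (hd xs) x" "g t = gate c (last xs) y" "g s \<in> K c (hd xs)" "g t \<in> K c (last xs)"
  shows "ennreal (1 / m) * (\<Sum>(a, x, y)\<leftarrow>steps x xs y. crossing_length (c = fst a) x y) \<le> arc_length g s t"
  using assms
proof (induction x xs y arbitrary: s rule: steps.induct)
  case (1 x y)
  then show ?case by (simp add: simple_path_def)
next
  case (2 x a y)
  have "a \<in> Pat c" using 2 by (simp add: simple_path_def)
  then have "arc_in (K c a) g s t" using 2 by (intro arc_in_single) auto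
  then show ?case using 2 crossing_length_cell_le by simp
next
  case (3 x a b as y)
  obtain r where r: "r \<in> {s..t}" "g r = gate c a (label a b)" "g r = gate c b (label a b)"
    "g r \<in> K c a" "g r \<in> K c b" "arc_in (K c a) g s r" "arc_in (L c) g r t"
    by (rule arc_in_first[OF 3(3,2)]) (use 3 in auto)
  have "ennreal (1 / m) * (\<Sum>(a, x, y)\<leftarrow>steps x (a # b # as) y. crossing_length (c = fst a) x y) =
      ennreal (1 / m) * crossing_length (c = fst a) x (label a b) +
      ennreal (1 / m) * (\<Sum>(a, x, y)\<leftarrow>steps (label a b) (b # as) y. crossing_length (c = fst a) x y)"
    by (simp add: distrib_left)
  also have "\<dots> \<le> arc_length g s r + arc_length g r t"
  proof (rule add_mono)
    show "ennreal (1 / m) * crossing_length (c = fst a) x (label a b) \<le> arc_length g s r"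
      by (rule crossing_length_cell_le[OF r(6)]) (use 3 r in auto)
    show "ennreal (1 / m) * (\<Sum>(a, x, y)\<leftarrow>steps (label a b) (b # as) y. crossing_length (c = fst a) x y)
        \<le> arc_length g r t"
      by (rule 3(1)) (use 3 r in \<open>auto simp: simple_path_Cons\<close>)
  qed
  also have "\<dots> \<le> arc_length g s t" by (rule arc_length_add[OF r(1)])
  finally show ?case .
qed

text \<open>The displacements between successive gates telescope. Pulling them back to unit size
  costs the factor \<open>m\<close> and, for down cells, a sign.\<close>

lemma steps_displacement:
  assumes "xs \<noteq> []" "successively adj xs"
  shows "(\<Sum>(a, x, y)\<leftarrow>steps x xs y. orient (fst a) *\<^sub>R (exit_pt (c = fst a) y - exit_pt (c = fst a) x)) =
    real m *\<^sub>R (gate c (last xs) y - gate c (hd xs) x)"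
  using assms
proof (induction x xs y rule: steps.induct)
  case (2 x a y)
  then show ?case using m by (simp add: gate_def cell_map_def algebra_simps)
next
  case (3 x a b as y)
  have "linked (label a b) a b" using 3(3) by (simp add: linked_label)
  then have "gate c a (label a b) = gate c b (label a b)" by (rule gate_linked)
  moreover have "orient (fst a) *\<^sub>R (exit_pt (c = fst a) (label a b) - exit_pt (c = fst a) x) =
      real m *\<^sub>R (gate c a (label a b) - gate c a x)"
    using m by (simp add: gate_def cell_map_def algebra_simps)
  moreover have "(\<Sum>(a, x, y)\<leftarrow>steps (label a b) (b # as) y. orient (fst a) *\<^sub>R (exit_pt (c = fst a) y - exit_pt (c = fst a) x)) =
      real m *\<^sub>R (gate c (last (b # as)) y - gate c b (label a b))"
    using 3 by simp
  ultimately show ?case by (simp add: scaleR_diff_right)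
qed simp

text \<open>Leaving through the side of entry would lead back to the previous cell, by
  \<open>linked_unique\<close>; the first two hypotheses on \<open>linked\<close> exclude this at
  the two ends of the path.\<close>

lemma steps_labels_distinct:
  assumes "simple_path adj (Pat c) xs"
    and "\<And>b. b \<in> set xs \<Longrightarrow> \<not> linked x (hd xs) b" "\<And>b. b \<in> set xs \<Longrightarrow> \<not> linked y (last xs) b"
    and "length xs = 1 \<Longrightarrow> x \<noteq> y" and "(a, x', y') \<in> set (steps x xs y)"
  shows "x' \<noteq> y'"
  using assms
proof (induction x xs y rule: steps.induct)
  case (3 x a0 b as y)
  have l: "linked (label a0 b) a0 b" using 3(2) by (simp add: linked_label simple_path_Cons)
  have x: "x \<noteq> label a0 b" using 3(3)[of b] l by auto
  show ?case
  proof (cases "(a, x', y') \<in> set (steps (label a0 b) (b # as) y)")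
    case True
    have "x' \<noteq> y'"
    proof (rule 3(1))
      show "simple_path adj (Pat c) (b # as)" using 3(2) by (simp add: simple_path_Cons)
      show "\<not> linked (label a0 b) (hd (b # as)) d" if "d \<in> set (b # as)" for d
      proof
        assume "linked (label a0 b) (hd (b # as)) d"
        then have "d = a0" using linked_unique linked_sym[OF l] by simp
        then show False using that 3(2) by (auto simp: simple_path_def)
      qed
      show "\<not> linked y (last (b # as)) d" if "d \<in> set (b # as)" for d using 3(4)[of d] that by simp
      show "label a0 b \<noteq> y" if "length (b # as) = 1"
        using that 3(4)[of a0] linked_sym[OF l] by auto
    qed fact
    then show ?thesis .
  next
    case False
    then show ?thesis using 3(6) x by simp
  qed
qed auto

lemma steps_fst: "fst ` set (steps x xs y) = set xs"
  by (induction x xs y rule: steps.induct) auto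

text \<open>Orientation alternates along the path. So does the truth of "the shared label is
  \<open>z\<close>", since each step has \<open>z\<close> on exactly one of its sides. Two
  alternating sequences that agree at the start agree throughout.\<close>

lemma steps_orientation:
  assumes "successively adj xs" "xs \<noteq> []" "fst (hd xs) \<longleftrightarrow> x \<noteq> z"
    and "\<And>a x' y'. (a, x', y') \<in> set (steps x xs y) \<Longrightarrow> (x' = z) \<noteq> (y' = z)"
    and "(a, x', y') \<in> set (steps x xs y)"
  shows "fst a \<longleftrightarrow> y' = z"
  using assms
proof (induction x xs y rule: steps.induct)
  case (2 x b y)
  then show ?case by auto
next
  case (3 x a0 b as y)
  have b: "fst b = (\<not> fst a0)" using 3(2) adj_fst[of a0 b] by simp
  have "(x = z) \<noteq> (label a0 b = z)" by (rule 3(5)[of a0]) simp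
  then have l: "fst a0 \<longleftrightarrow> label a0 b = z" using 3(4) by auto
  show ?case
  proof (cases "(a, x', y') \<in> set (steps (label a0 b) (b # as) y)")
    case True
    show ?thesis
    proof (rule 3(1))
      show "(x' = z) \<noteq> (y' = z)" if "(a, x', y') \<in> set (steps (label a0 b) (b # as) y)" for a x' y'
        using 3(5)[of a x' y'] that by simp
    qed (use 3(2) l b True in auto)
  next
    case False
    then show ?thesis using 3(6) l by simp
  qed
qed simp

text \<open>One of two adjacent cells is an up cell, so every shared label already occurs in a step
  of an up cell. This matters because a down cell carries the other colour.\<close>

lemma steps_labels_subset:
  assumes "successively adj xs" "xs \<noteq> []" "x \<in> A" "y \<in> A"
    and "\<And>a x' y'. (a, x', y') \<in> set (steps x xs y) \<Longrightarrow> fst a \<Longrightarrow> x' \<in> A \<and> y' \<in> A"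
    and "(a, x', y') \<in> set (steps x xs y)"
  shows "x' \<in> A \<and> y' \<in> A"
  using assms
proof (induction x xs y rule: steps.induct)
  case (3 x a0 b as y)
  have b: "fst b = (\<not> fst a0)" using 3(2) adj_fst[of a0 b] by simp
  have l: "label a0 b \<in> A"
  proof (cases "fst a0")
    case True
    then show ?thesis using 3(6)[of a0 x "label a0 b"] by simp
  next
    case False
    obtain q where "(b, label a0 b, q) \<in> set (steps (label a0 b) (b # as) y)" by (cases as) auto
    then show ?thesis using 3(6)[of b "label a0 b" q] b False by simp
  qed
  show ?case
  proof (cases "(a, x', y') \<in> set (steps (label a0 b) (b # as) y)")
    case True
    show ?thesis
    proof (rule 3(1))
      show "x' \<in> A \<and> y' \<in> A" if "(a, x', y') \<in> set (steps (label a0 b) (b # as) y)" "fst a" for a x' y'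
        using 3(6)[of a x' y'] that by simp
    qed (use 3(2,5) l True in auto)
  next
    case False
    then show ?thesis using 3(4,7) l by simp
  qed
qed auto

lemma steps_strip_index:
  assumes "successively adj xs" "z \<notin> A"
    and "\<And>a x' y'. (a, x', y') \<in> set (steps x xs y) \<Longrightarrow> x' \<in> A \<and> y' \<in> A"
    and "a \<in> set xs"
  shows "strip_index z a = strip_index z (hd xs)"
  using assms
proof (induction x xs y rule: steps.induct)
  case (3 x a0 b as y)
  have l: "linked (label a0 b) a0 b" using 3(2) by (simp add: linked_label)
  have "label a0 b \<in> A" using 3(4)[of a0 x "label a0 b"] by simp
  then have ab: "strip_index z a0 = strip_index z b" using strip_index_linked[OF l, of z] 3(3) by metis
  show ?case
  proof (cases "a \<in> set (b # as)")
    case True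
    have "strip_index z a = strip_index z (hd (b # as))"
    proof (rule 3(1))
      show "x' \<in> A \<and> y' \<in> A" if "(a, x', y') \<in> set (steps (label a0 b) (b # as) y)" for a x' y'
        using 3(4)[of a x' y'] that by simp
    qed (use 3(2,3) True in auto)
    then show ?thesis using ab by simp
  next
    case False
    then show ?thesis using 3(5) by simp
  qed
qed auto

text \<open>Side \<open>j\<close> of the exit cell lies on the boundary of the large triangle: a
  neighbour across it would be a down cell with entry 0.\<close>

lemma exit_not_linked:
  assumes "b \<in> Pat c"
  shows "\<not> linked j (True, ex c j) b"
proof
  assume *: "linked j (True, ex c j) b"
  then have "b = (False, snd b)" "snd b $ j = 0"
    by (auto simp: linked_def link_def exits prod_eq_iff)
  then show False using Pat_down(1)[of "snd b" c j] assms by simp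
qed

lemma exit_gate: "gate c (True, ex c j) j = exit_pt c j"
  by (simp add: gate_def exit_pt_fixed)

lemma exit_pt_in_K: "exit_pt c j \<in> L c \<Longrightarrow> exit_pt c j \<in> K c (True, ex c j)"
  unfolding K_def using exit_pt_fixed[of c j] by (auto intro!: image_eqI[of _ _ "exit_pt c j"])

lemma exit_steps_length_le:
  assumes xs: "simple_path adj (Pat c) xs" "hd xs = (True, ex c x)" "last xs = (True, ex c y)"
  shows "ennreal (1 / m) * (\<Sum>(a, x, y)\<leftarrow>steps x xs y. crossing_length (c = fst a) x y) \<le> crossing_length c x y"
proof (rule crossing_length_geI)
  fix g s t assume g: "arc_in (L c) g s t" "g s = exit_pt c x" "g t = exit_pt c y"
  then have "exit_pt c x \<in> L c" "exit_pt c y \<in> L c"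
    unfolding g(2,3)[symmetric] by (auto simp: arc_in_def image_subset_iff)
  then show "ennreal (1 / m) * (\<Sum>(a, x, y)\<leftarrow>steps x xs y. crossing_length (c = fst a) x y) \<le> arc_length g s t"
    using g xs by (intro steps_length_le) (auto simp: exit_gate exit_pt_in_K)
qed

lemma exit_steps_displacement:
  assumes "simple_path adj (Pat c) xs" "hd xs = (True, ex c x)" "last xs = (True, ex c y)"
  shows "(\<Sum>(a, x, y)\<leftarrow>steps x xs y. orient (fst a) *\<^sub>R (exit_pt (c = fst a) y - exit_pt (c = fst a) x)) =
    real m *\<^sub>R (exit_pt c y - exit_pt c x)"
  using steps_displacement[of xs c x y] assms by (simp add: simple_path_def exit_gate)

text \<open>A common exit cell would have two entries 0, and the pairing of exits would put the
  other colour's exits on \<open>x\<close> and \<open>y\<close> into two different corners.\<close>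

lemma exit_cells_distinct:
  assumes "x \<noteq> y"
  shows "ex c x \<noteq> ex c y"
proof
  assume eq: "ex c x = ex c y"
  obtain o' where o': "o' \<noteq> x" "o' \<noteq> y" using other_index_3[of x y] by blast
  have z: "ex c x $ x = 0" "ex c x $ y = 0" using exits(2)[of c x] exits(2)[of c y] eq by auto
  have "ex c x $ o' = int m - 1"
    using Pat_up(2)[OF exits(1)[of c x]] sum_UNIV_3_eq[of x y o' "\<lambda>l. ex c x $ l"] z assms o' by simp
  have "ex (\<not> c) x $ y = int m - 1" "ex (\<not> c) y $ x = int m - 1"
    using exits(3)[of y x c] exits(3)[of x y c] z eq assms by auto
  then show False using corner_unique[OF exits(1) _ exits(1)] assms by metis
qed

end

text \<open>The unblocked pair enters through the equal height of its exits, for each colour. A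
  blocked pair provides a path that leaves its strip for one colour, and this colour cannot be
  chosen.\<close>

locale blocked_labyrinth = labyrinth +
  fixes i j k :: 3
  assumes ijk: "i \<noteq> j" "i \<noteq> k" "j \<noteq> k"
    and open_pair: "ex c i $ k = ex c j $ k"
    and blocked: "x \<in> {i, j} \<Longrightarrow> z \<noteq> x \<Longrightarrow> z \<noteq> k \<Longrightarrow> \<exists>c xs. simple_path adj (Pat c) xs \<and>
      hd xs = (True, ex c x) \<and> last xs = (True, ex c k) \<and> \<not> (\<exists>n. \<forall>a\<in>set xs. strip_index z a = n)"
begin

definition height :: "bool \<Rightarrow> real" where
  "height c = exit_pt c i $ k"

lemma exit_height: "x \<in> {i, j} \<Longrightarrow> exit_pt c x $ k = height c"
  using open_pair[of c] by (auto simp: height_def exit_pt_nth)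

text \<open>At height 0 the exits on \<open>i\<close> and \<open>j\<close> would be the cells at the
  corners \<open>j\<close> and \<open>i\<close>, two corners of one colour.\<close>

lemma ex_pos: "0 < ex c i $ k"
proof (rule ccontr)
  assume "\<not> 0 < ex c i $ k"
  then have 0: "ex c i $ k = 0" "ex c j $ k = 0"
    using Pat_up(1)[OF exits(1), of c i k] open_pair[of c] by auto
  have "ex c i $ j = int m - 1" "ex c j $ i = int m - 1"
    using Pat_up(2)[OF exits(1)[of c i]] Pat_up(2)[OF exits(1)[of c j]] 0 exits(2)[of c i] exits(2)[of c j]
      sum_UNIV_3_eq[OF ijk, of "\<lambda>l. ex c i $ l"] sum_UNIV_3_eq[OF ijk, of "\<lambda>l. ex c j $ l"] by auto
  then show False using corner_unique[OF exits(1) _ exits(1)] ijk by metis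
qed

lemma height_pos: "0 < height c"
  using ex_pos[of c] m_pos by (simp add: height_def exit_pt_nth)

text \<open>Coordinate \<open>i\<close> vanishes at exit \<open>i\<close>, so it tells the exits
  \<open>i\<close> and \<open>j\<close> apart. At exit \<open>j\<close> it equals the height of the
  other colour, by the pairing of exits and equality of heights.\<close>

lemma exit_pt_j_i: "0 < exit_pt c j $ i"
proof -
  have "ex c j $ i + ex c j $ k = int m - 1"
    using Pat_up(2)[OF exits(1)[of c j]] sum_UNIV_3_eq[OF ijk, of "\<lambda>l. ex c j $ l"] exits(2)[of c j] by simp
  then have "ex c j $ i = ex (\<not> c) i $ k" using exits(3)[of k i c] open_pair[of c] ijk by auto
  then show ?thesis using ex_pos[of "\<not> c"] m_pos by (simp add: exit_pt_nth)
qed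

lemma exit_path:
  obtains xs where "simple_path adj (Pat c) xs" "hd xs = (True, ex c x)" "last xs = (True, ex c k)"
  using paths(1)[OF exits(1) exits(1)] by blast

lemma steps_distinct:
  assumes "simple_path adj (Pat c) xs" "hd xs = (True, ex c x)" "last xs = (True, ex c k)" "x \<noteq> k"
    and "(a, x', y') \<in> set (steps x xs k)"
  shows "x' \<noteq> y'"
proof (rule steps_labels_distinct[OF assms(1) _ _ _ assms(5)])
  have "set xs \<subseteq> Pat c" using assms(1) by (simp add: simple_path_def)
  then show "\<not> linked x (hd xs) b" "\<not> linked k (last xs) b" if "b \<in> set xs" for b
    using that exit_not_linked[of b c x] exit_not_linked[of b c k] assms(2,3) by auto
qed (use assms in auto)

definition ratio :: "bool \<times> 3 \<Rightarrow> real" where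
  "ratio = (\<lambda>(c, x). enn2real (crossing_length c x k) / height c)"

text \<open>The change of coordinate \<open>i\<close> per unit of height lost on the way from exit
  \<open>x\<close> to exit \<open>k\<close>, which has height 0. Coordinate \<open>i\<close> is
  taken because it separates the two possible starting points.\<close>

definition slope :: "bool \<times> 3 \<Rightarrow> real" where
  "slope = (\<lambda>(c, x). (exit_pt c k $ i - exit_pt c x $ i) / height c)"

definition finite_crossings :: "(bool \<times> 3) set" where
  "finite_crossings = {(c, x). x \<in> {i, j} \<and> crossing_length c x k < \<infinity>}"

text \<open>
  A crossing of least length per height can only be made of crossings of the same kind: a step
  of type \<open>{i, j}\<close> has positive length, but gains no height.
\<close>

lemma minimal_ratio_steps:
  assumes r: "\<And>p. p \<in> finite_crossings \<Longrightarrow> r \<le> ratio p"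
    and cx: "(c, x) \<in> finite_crossings" "ratio (c, x) = r"
    and xs: "simple_path adj (Pat c) xs" "hd xs = (True, ex c x)" "last xs = (True, ex c k)"
    and step: "(a, x', y') \<in> set (steps x xs k)"
  shows "\<exists>z\<in>{i, j}. (x', y') = (if fst a then (z, k) else (k, z)) \<and>
    (c = fst a, z) \<in> finite_crossings \<and> ratio (c = fst a, z) = r"
proof -
  define S where "S = steps x xs k"
  define e where "e = (\<lambda>(a, x, y). enn2real (crossing_length (c = fst (a :: cell)) x y))"
  define v where "v = (\<lambda>(a, x, y). \<bar>exit_pt (c = fst (a :: cell)) y $ k - exit_pt (c = fst a) x $ k\<bar>)"
  have x: "x \<in> {i, j}" "x \<noteq> k" using cx ijk by (auto simp: finite_crossings_def)
  have "r \<ge> 0" using cx height_pos[of c] by (auto simp: ratio_def)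
  let ?T = "\<Sum>(a, x, y)\<leftarrow>S. crossing_length (c = fst a) x y"
  have le: "ennreal (1 / m) * ?T \<le> crossing_length c x k"
    unfolding S_def by (rule exit_steps_length_le) fact+
  have fin: "crossing_length c x k < \<infinity>" using cx by (simp add: finite_crossings_def)
  have T: "?T < \<infinity>"
  proof (rule ccontr)
    assume "\<not> ?T < \<infinity>"
    then have "?T = \<infinity>" by (metis infinity_ennreal_def less_top)
    then have "ennreal (1 / m) * ?T = \<infinity>" using m by (simp add: ennreal_mult_eq_top_iff)
    then show False using le fin by simp
  qed
  have Tfin: "crossing_length (c = fst a) x' y' < \<infinity>" if "(a, x', y') \<in> set S" for a x' y'
    using enn2real_sum_list[OF T] that by force
  have Te: "enn2real ?T = sum_list (map e S)"
    using enn2real_sum_list[OF T] by (simp add: e_def comp_def case_prod_unfold)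
  have "sum_list (map e S) \<le> m * (r * height c)"
  proof -
    have "enn2real (ennreal (1 / m) * ?T) \<le> enn2real (crossing_length c x k)"
      using le fin by (intro enn2real_mono) auto
    also have "\<dots> = r * height c" using cx height_pos[of c] by (auto simp: ratio_def)
    finally show ?thesis using m by (simp add: enn2real_mult Te field_simps)
  qed
  \<comment> \<open>The signed heights of the steps add up to that of the crossing, magnified by
    \<open>m\<close>; absolute values can only increase the sum.\<close>
  moreover have "m * height c \<le> sum_list (map v S)"
  proof -
    have "m * height c = \<bar>(real m *\<^sub>R (exit_pt c k - exit_pt c x)) $ k\<bar>"
      using height_pos[of c] exit_height[OF x(1), of c] by (simp add: abs_mult)
    also have "\<dots> = \<bar>sum_list (map (\<lambda>(a, x, y). orient (fst a) * (exit_pt (c = fst a) y $ k - exit_pt (c = fst a) x $ k)) S)\<bar>"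
      unfolding exit_steps_displacement[OF xs, symmetric] S_def
      by (simp add: sum_list_vec_nth comp_def case_prod_unfold)
    also have "\<dots> \<le> sum_list (map v S)"
      by (rule order_trans[OF sum_list_abs]) (simp add: v_def comp_def case_prod_unfold abs_mult)
    finally show ?thesis .
  qed
  \<comment> \<open>Length is bounded above, and height below, by multiples of the same
    \<open>height c\<close>. As no step has a smaller ratio than \<open>r\<close>, equality will
    hold in every step.\<close>
  ultimately have "sum_list (map e S) \<le> r * sum_list (map v S)"
    using \<open>r \<ge> 0\<close> by (smt (verit) mult.left_commute mult_left_mono)
  then have sum: "sum_list (map (\<lambda>s. e s - r * v s) S) \<le> 0"
    by (simp add: sum_list_subtractf sum_list_const_mult)
  have cases: "x' \<in> {i, j} \<and> y' \<in> {i, j} \<and> v (a, x', y') = 0 \<and> e (a, x', y') > 0 \<or>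
      (\<exists>z\<in>{i, j}. (x', y') \<in> {(z, k), (k, z)} \<and> (c = fst a, z) \<in> finite_crossings \<and>
        v (a, x', y') = height (c = fst a) \<and> e (a, x', y') = ratio (c = fst a, z) * height (c = fst a))"
    if s: "(a, x', y') \<in> set S" for a x' y'
  proof -
    have ne: "x' \<noteq> y'" using steps_distinct[OF xs x(2)] s by (simp add: S_def)
    have f: "crossing_length (c = fst a) x' y' < \<infinity>" using Tfin[OF s] .
    have h: "height d > 0" for d by (rule height_pos)
    have lab: "l \<in> {i, j} \<or> l = k" for l using index_3_cases[OF ijk] by blast
    consider "x' \<in> {i, j}" "y' \<in> {i, j}" | "x' \<in> {i, j}" "y' = k" | "x' = k" "y' \<in> {i, j}"
      using lab[of x'] lab[of y'] ne by blast
    then show ?thesis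
    proof cases
      case 1
      have "exit_pt (c = fst a) x' \<noteq> exit_pt (c = fst a) y'"
        using 1 ne exit_pt_j_i[of "c = fst a"] exit_pt_self[of "c = fst a" i] by (metis insertE less_irrefl singletonD)
      then have "0 < dist (exit_pt (c = fst a) x') (exit_pt (c = fst a) y')" by simp
      also have "\<dots> \<le> e (a, x', y')"
        using enn2real_mono[OF crossing_length_ge_dist[of "c = fst a" x' y']] f by (simp add: e_def)
      finally show ?thesis using 1 exit_height by (simp add: v_def)
    next
      case 2
      then show ?thesis using f h[of "c = fst a"] exit_height[OF 2(1)]
        by (intro disjI2 bexI[of _ x']) (auto simp: v_def e_def ratio_def finite_crossings_def)
    next
      case 3
      then show ?thesis using f h[of "c = fst a"] exit_height[OF 3(2)] crossing_length_sym[of "c = fst a" k y']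
        by (intro disjI2 bexI[of _ y']) (auto simp: v_def e_def ratio_def finite_crossings_def)
    qed
  qed
  have nonneg: "0 \<le> e s - r * v s" if "s \<in> set S" for s
  proof -
    obtain a x' y' where s: "s = (a, x', y')" by (cases s)
    show ?thesis using cases[of a x' y'] that r height_pos unfolding s
      by (auto intro: mult_right_mono less_imp_le)
  qed
  then have "sum_list (map (\<lambda>s. e s - r * v s) S) = 0"
    using sum by (intro antisym sum_list_nonneg) auto
  then have eq: "e s = r * v s" if "s \<in> set S" for s
    using sum_list_map_eq_0D[where f = "\<lambda>s. e s - r * v s", OF nonneg _ that] by simp
  have good: "\<exists>z\<in>{i, j}. (x', y') \<in> {(z, k), (k, z)} \<and> (c = fst a, z) \<in> finite_crossings \<and> ratio (c = fst a, z) = r"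
    if s: "(a, x', y') \<in> set S" for a x' y'
    using cases[OF s] eq[OF s] height_pos[of "c = fst a"] by auto
  \<comment> \<open>The path starts in an up cell entered through \<open>x\<close>, which is not
    \<open>k\<close>. So up cells are traversed towards side \<open>k\<close> and down cells away
    from it; after the half turn every step descends.\<close>
  have "fst a \<longleftrightarrow> y' = k"
  proof (rule steps_orientation[OF _ _ _ _ step])
    show "(x' = k) \<noteq> (y' = k)" if "(a, x', y') \<in> set (steps x xs k)" for a x' y'
      using good[of a x' y'] that ijk unfolding S_def by auto
  qed (use xs x in \<open>auto simp: simple_path_def\<close>)
  then show ?thesis using good[of a x' y'] step ijk unfolding S_def by auto
qed

text \<open>
  Among the crossings of minimal ratio, those of extremal slope consist of parallel pieces only, so
  their paths stay in one strip, for both colours.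
\<close>

lemma crossing_infinite:
  assumes "x \<in> {i, j}"
  shows "crossing_length c x k = \<infinity>"
proof (rule ccontr)
  assume "crossing_length c x k \<noteq> \<infinity>"
  then have ne: "finite_crossings \<noteq> {}"
    using assms by (auto simp: finite_crossings_def top.not_eq_extremum)
  have fin: "finite X" for X :: "(bool \<times> 3) set" by (rule finite)
  define r where "r = Min (ratio ` finite_crossings)"
  have r: "r \<le> ratio p" if "p \<in> finite_crossings" for p
    unfolding r_def using that by (intro Min_le) auto
  define B where "B = {p \<in> finite_crossings. ratio p = r}"
  have "r \<in> ratio ` finite_crossings" unfolding r_def using ne by (intro Min_in) auto
  then have "B \<noteq> {}" by (auto simp: B_def)
  define M where "M = Max (slope ` B)"
  have M: "slope p \<le> M" if "p \<in> B" for p unfolding M_def using that by (intro Max_ge) auto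
  have "M \<in> slope ` B" unfolding M_def using \<open>B \<noteq> {}\<close> by (intro Max_in) auto
  then obtain c x where start: "(c, x) \<in> B" "slope (c, x) = M" by auto
  have closed: "\<exists>z\<in>{i, j}. (x', y') = (if fst a then (z, k) else (k, z)) \<and> (c = fst a, z) \<in> B \<and> slope (c = fst a, z) = M"
    if cx: "(c, x) \<in> B" "slope (c, x) = M"
      and xs: "simple_path adj (Pat c) xs" "hd xs = (True, ex c x)" "last xs = (True, ex c k)"
      and step: "(a, x', y') \<in> set (steps x xs k)" for c x xs a x' y'
  proof -
    define S where "S = steps x xs k"
    define d where "d q = (\<lambda>(a, x, y). orient (fst a) * (exit_pt (c = fst (a :: cell)) y $ q - exit_pt (c = fst a) x $ q))" for q
    have x: "x \<in> {i, j}" using cx by (auto simp: B_def finite_crossings_def)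
    have d_sum: "sum_list (map (d q) S) = real m * (exit_pt c k $ q - exit_pt c x $ q)" for q
      using arg_cong[OF exit_steps_displacement[OF xs], of "\<lambda>v. v $ q"]
      by (simp add: sum_list_vec_nth comp_def case_prod_unfold d_def S_def)
    have st: "\<exists>z\<in>{i, j}. (x', y') = (if fst a then (z, k) else (k, z)) \<and> (c = fst a, z) \<in> B \<and>
        d k (a, x', y') = - height (c = fst a) \<and> d i (a, x', y') = slope (c = fst a, z) * height (c = fst a)"
      if "(a, x', y') \<in> set S" for a x' y'
    proof -
      have "(c, x) \<in> finite_crossings" "ratio (c, x) = r" using cx(1) by (simp_all add: B_def)
      from minimal_ratio_steps[OF r this xs that[unfolded S_def]]
      obtain z where z: "z \<in> {i, j}" "(x', y') = (if fst a then (z, k) else (k, z))"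
          "(c = fst a, z) \<in> finite_crossings" "ratio (c = fst a, z) = r"
        by blast
      have "d q (a, x', y') = exit_pt (c = fst a) k $ q - exit_pt (c = fst a) z $ q" for q
        using z(2) by (auto simp: d_def split: if_splits)
      then show ?thesis using z height_pos[of "c = fst a"] exit_height[OF z(1)]
        by (intro bexI[of _ z]) (auto simp: B_def slope_def)
    qed
    \<comment> \<open>By \<open>st\<close> each summand is \<open>(M - slope) * height\<close> of
      its step, hence nonnegative, and the total is the same expression for the whole crossing,
      whose slope is \<open>M\<close>.\<close>
    have "sum_list (map (\<lambda>s. - M * d k s - d i s) S) = - M * sum_list (map (d k) S) - sum_list (map (d i) S)"
      by (simp only: sum_list_subtractf sum_list_const_mult)
    also have "\<dots> = 0"
      using d_sum[of k] d_sum[of i] cx(2) height_pos[of c] exit_height[OF x, of c]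
      by (simp add: slope_def divide_eq_eq)
    finally have "sum_list (map (\<lambda>s. - M * d k s - d i s) S) = 0" .
    moreover have nonneg: "0 \<le> - M * d k s - d i s" if "s \<in> set S" for s
    proof -
      obtain a x' y' where s: "s = (a, x', y')" by (cases s)
      from st[OF that[unfolded s]] obtain z where "(c = fst a, z) \<in> B"
          "d k (a, x', y') = - height (c = fst a)" "d i (a, x', y') = slope (c = fst a, z) * height (c = fst a)"
        by (elim bexE conjE)
      then show ?thesis using mult_right_mono[OF M, of "(c = fst a, z)" "height (c = fst a)"] height_pos[of "c = fst a"] s by simp
    qed
    ultimately have zero: "- M * d k s - d i s = 0" if "s \<in> set S" for s
      using sum_list_map_eq_0D[where f = "\<lambda>s. - M * d k s - d i s", OF _ _ that] by blast
    have mem: "(a, x', y') \<in> set S" using step by (simp add: S_def)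
    from st[OF mem] obtain z where z: "z \<in> {i, j}" "(x', y') = (if fst a then (z, k) else (k, z))"
        "(c = fst a, z) \<in> B" "d k (a, x', y') = - height (c = fst a)"
        "d i (a, x', y') = slope (c = fst a, z) * height (c = fst a)"
      by (elim bexE conjE)
    have "slope (c = fst a, z) * height (c = fst a) = M * height (c = fst a)"
      using zero[OF mem] unfolding z(4,5) by linarith
    then have "slope (c = fst a, z) = M" using height_pos[of "c = fst a"] by simp
    with z show ?thesis by blast
  qed
  \<comment> \<open>This works only within one colour, so below it is applied to up cells, which
    keep the colour of the path.\<close>
  have slope_inj: "z = x" if "slope (c, z) = slope (c, x)" "z \<in> {i, j}" "x \<in> {i, j}" for c z x
  proof -
    have "exit_pt c z $ i = exit_pt c x $ i" using that(1) height_pos[of c] by (simp add: slope_def)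
    then show ?thesis using exit_pt_j_i[of c] that(2,3) by auto
  qed
  have straight: "(\<not> c, x) \<in> B \<and> slope (\<not> c, x) = M \<and> (\<exists>n. \<forall>a\<in>set xs. strip_index z a = n)"
    if cx: "(c, x) \<in> B" "slope (c, x) = M"
      and xs: "simple_path adj (Pat c) xs" "hd xs = (True, ex c x)" "last xs = (True, ex c k)"
      and z: "z \<noteq> x" "z \<noteq> k" for c x xs z
  proof -
    have x: "x \<in> {i, j}" "x \<noteq> k" using cx ijk by (auto simp: B_def finite_crossings_def)
    have adj: "successively adj xs" "xs \<noteq> []" using xs by (auto simp: simple_path_def)
    have lab: "x' \<in> {x, k} \<and> y' \<in> {x, k}" if "(a, x', y') \<in> set (steps x xs k)" for a x' y'
    proof (rule steps_labels_subset[OF adj _ _ _ that])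
      show "x' \<in> {x, k} \<and> y' \<in> {x, k}" if a: "(a, x', y') \<in> set (steps x xs k)" "fst a" for a x' y'
      proof -
        from closed[OF cx xs a(1)] obtain z' where z': "z' \<in> {i, j}"
            "(x', y') = (if fst a then (z', k) else (k, z'))" "slope (c = fst a, z') = M"
          by (elim bexE conjE)
        have "z' = x" by (rule slope_inj[of c]) (use z' a(2) cx x in simp_all)
        then show ?thesis using z'(2) a(2) by simp
      qed
    qed simp_all
    \<comment> \<open>A second cell exists and is a down cell. Its step is an extremal crossing of
      the other colour, again between \<open>x\<close> and \<open>k\<close>.\<close>
    have "xs \<noteq> [hd xs]"
    proof
      assume "xs = [hd xs]"
      then have "hd xs = last xs" by (metis last_ConsL)
      then show False using xs exit_cells_distinct[OF x(2), of c] by simp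
    qed
    then obtain b as where b: "xs = hd xs # b # as" using adj(2) by (metis list.collapse)
    then have "adj (hd xs) b" using adj(1) by (metis successively.simps(3))
    then have fb: "\<not> fst b" using adj_fst[of "hd xs" b] xs(2) by simp
    have "b \<in> fst ` set (steps x xs k)" unfolding steps_fst using b by (metis list.set_intros)
    then obtain x' y' where s: "(b, x', y') \<in> set (steps x xs k)" by auto
    from closed[OF cx xs s] obtain z' where z': "z' \<in> {i, j}"
        "(x', y') = (if fst b then (z', k) else (k, z'))" "(c = fst b, z') \<in> B" "slope (c = fst b, z') = M"
      by (elim bexE conjE)
    have "z' = x" using z'(1,2) lab[OF s] fb ijk by auto
    then have "(\<not> c, x) \<in> B \<and> slope (\<not> c, x) = M" using z'(3,4) fb by simp
    moreover have "\<forall>a\<in>set xs. strip_index z a = strip_index z (hd xs)"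
      using steps_strip_index[OF adj(1), of z "{x, k}" x k] lab z by blast
    ultimately show ?thesis by blast
  qed
  have x: "x \<in> {i, j}" using start by (auto simp: B_def finite_crossings_def)
  obtain z where z: "z \<noteq> x" "z \<noteq> k" using other_index_3 by blast
  obtain d xs where xs: "simple_path adj (Pat d) xs" "hd xs = (True, ex d x)" "last xs = (True, ex d k)"
      "\<not> (\<exists>n. \<forall>a\<in>set xs. strip_index z a = n)"
    using blocked[OF x z] by blast
  obtain ys where ys: "simple_path adj (Pat c) ys" "hd ys = (True, ex c x)" "last ys = (True, ex c k)"
    by (rule exit_path)
  \<comment> \<open>Now both colours attain \<open>M\<close>, so \<open>straight\<close> applies to
    the blocked path whatever its colour \<open>d\<close> is.\<close>
  have "(\<not> c, x) \<in> B" "slope (\<not> c, x) = M" using straight[OF start ys z] by auto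
  then have "(d, x) \<in> B" "slope (d, x) = M" using start by (cases "d = c"; simp)+
  then show False using straight[OF _ _ xs(1-3) z] xs(4) by blast
qed

end

section \<open>Arcs of finite length keep their height\<close>

lemma arc_in_ends: "arc_in X g s t \<Longrightarrow> g s \<in> X \<and> g t \<in> X"
  by (auto simp: arc_in_def)

context blocked_labyrinth
begin

lemma cell_inv_height: "\<bar>cell_inv m a x $ q - cell_inv m a y $ q\<bar> = m * \<bar>x $ q - y $ q\<bar>"
proof -
  have "cell_inv m a x $ q - cell_inv m a y $ q = orient (fst a) * (m * (x $ q - y $ q))"
    by (simp add: cell_inv_def algebra_simps)
  then show ?thesis by (simp add: abs_mult)
qed

text \<open>By \<open>crossing_infinite\<close> neither gate lies on a side \<open>k\<close> of the
  cell, and the exits on \<open>i\<close> and \<open>j\<close> are equally high.\<close>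

lemma finite_crossing_flat:
  assumes g: "arc_in (K c a) g s t" "arc_length g s t < \<infinity>"
    and "g s = gate c a x" "g t = gate c a y" "x \<noteq> y"
  shows "g s $ k = g t $ k"
proof -
  let ?h = "\<lambda>x. cell_inv m a (g x)"
  have "crossing_length (c = fst a) x y \<le> arc_length ?h s t"
    by (rule crossing_length_le[OF arc_in_pull(1)[OF g(1)]]) (use assms in auto)
  also have "\<dots> \<le> ennreal m * arc_length g s t" by (rule arc_in_pull(2)[OF g(1)])
  also have "\<dots> < \<infinity>" using g(2) by (simp add: ennreal_mult_less_top)
  finally have fin: "crossing_length (c = fst a) x y < \<infinity>" .
  have "x \<noteq> k" "y \<noteq> k"
    using fin assms(5) crossing_infinite index_3_cases[OF ijk, of x] index_3_cases[OF ijk, of y]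
      crossing_length_sym[of "c = fst a" k y] by auto
  then have "x \<in> {i, j}" "y \<in> {i, j}" using index_3_cases[OF ijk] by auto
  then have "exit_pt (c = fst a) x $ k = exit_pt (c = fst a) y $ k" by (simp only: exit_height)
  then show ?thesis using assms by (simp add: gate_def cell_map_nth)
qed

text \<open>A bound for whole fractals improves by the factor \<open>1 / m\<close> inside a cell.
  \<open>IH\<close> fixes the starting point of \<open>h\<close>, so that the lemma also serves when
  the bound is known only for arcs from an exit.\<close>

lemma single_cell_height:
  assumes g: "arc_in (K c a) g s t" "arc_length g s t < \<infinity>"
    and IH: "\<And>h. arc_in (L (c = fst a)) h s t \<Longrightarrow> arc_length h s t < \<infinity> \<Longrightarrow> h s = cell_inv m a (g s) \<Longrightarrow>
      \<bar>h t $ k - h s $ k\<bar> \<le> \<delta>"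
  shows "\<bar>g t $ k - g s $ k\<bar> \<le> \<delta> / m"
proof -
  let ?h = "\<lambda>x. cell_inv m a (g x)"
  have "arc_length ?h s t \<le> ennreal m * arc_length g s t" by (rule arc_in_pull(2)[OF g(1)])
  also have "\<dots> < \<infinity>" using g(2) by (simp add: ennreal_mult_less_top)
  finally have "\<bar>?h t $ k - ?h s $ k\<bar> \<le> \<delta>" by (rule IH[OF arc_in_pull(1)[OF g(1)]]) simp
  then show ?thesis using m by (simp add: cell_inv_height field_simps)
qed

text \<open>All cells but the last are crossed from gate to gate, hence without change of height;
  only the last one contributes. The hypothesis on \<open>linked\<close> ensures that the two gates
  of the first cell differ.\<close>

lemma path_from_gate_height:
  assumes IH: "\<And>c h s t x. arc_in (L c) h s t \<Longrightarrow> arc_length h s t < \<infinity> \<Longrightarrow> h s = exit_pt c x \<Longrightarrow>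
      \<bar>h t $ k - h s $ k\<bar> \<le> \<delta>"
    and "simple_path adj (Pat c) xs" "arc_in (L c) g s t" "arc_length g s t < \<infinity>"
    and "g s = gate c (hd xs) x" "g s \<in> K c (hd xs)" "g t \<in> K c (last xs)"
    and "\<And>b. b \<in> set xs \<Longrightarrow> \<not> linked x (hd xs) b"
  shows "\<bar>g t $ k - g s $ k\<bar> \<le> \<delta> / m"
  using assms(2-)
proof (induction xs arbitrary: x s rule: induct_list012)
  case 1
  then show ?case by (simp add: simple_path_def)
next
  case (2 a)
  have "arc_in (K c a) g s t" by (rule arc_in_single) (use 2 in \<open>auto simp: simple_path_def\<close>)
  then show ?case
  proof (rule single_cell_height[OF _ 2(3)])
    fix h assume h: "arc_in (L (c = fst a)) h s t" "arc_length h s t < \<infinity>" "h s = cell_inv m a (g s)"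
    show "\<bar>h t $ k - h s $ k\<bar> \<le> \<delta>" by (rule IH[OF h(1,2)]) (use h(3) 2(4) in simp)
  qed
next
  case (3 a b as)
  obtain r where r: "r \<in> {s..t}" "g r = gate c a (label a b)" "g r = gate c b (label a b)"
    "g r \<in> K c a" "g r \<in> K c b" "arc_in (K c a) g s r" "arc_in (L c) g r t"
    by (rule arc_in_first[OF 3(4,3)]) (use 3 in auto)
  have l: "linked (label a b) a b" using 3(3) by (simp add: linked_label simple_path_Cons)
  have fin: "arc_length g s r < \<infinity>" "arc_length g r t < \<infinity>"
    using arc_length_mono[of s s r t g] arc_length_mono[of s r t t g] r(1) 3(5) by (auto intro: le_less_trans)
  have "x \<noteq> label a b" using 3(9)[of b] l by auto
  then have "g s $ k = g r $ k"
    using finite_crossing_flat[OF r(6) fin(1)] 3(6) r(2) by simp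
  moreover have "\<bar>g t $ k - g r $ k\<bar> \<le> \<delta> / m"
  proof (rule 3(2)[of r "label a b"])
    show "simple_path adj (Pat c) (b # as)" using 3(3) by (simp add: simple_path_Cons)
    show "\<not> linked (label a b) (hd (b # as)) d" if "d \<in> set (b # as)" for d
    proof
      assume "linked (label a b) (hd (b # as)) d"
      then have "d = a" using linked_unique[of "label a b" b d a] linked_sym[OF l] by simp
      then show False using that 3(3) by (auto simp: simple_path_def)
    qed
  qed (use r fin 3 in auto)
  ultimately show ?case by simp
qed

lemma from_exit_flat:
  assumes "arc_in (L c) g s t" "arc_length g s t < \<infinity>" "g s = exit_pt c x"
  shows "g t $ k = g s $ k"
proof -
  have "\<bar>g t $ k - g s $ k\<bar> \<le> (1 / m) ^ n" for n
    using assms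
  proof (induction n arbitrary: c g s t x)
    case 0
    have "g s \<in> L c" "g t \<in> L c" using arc_in_ends[OF 0(1)] by simp_all
    then show ?case using L_simplex(1)[of _ c k] L_le_1[of _ c k]
      by (smt (verit) power_0)
  next
    case (Suc n)
    have L: "g s \<in> L c" "g t \<in> L c" using arc_in_ends[OF Suc.prems(1)] by simp_all
    obtain b where b: "b \<in> Pat c" "g t \<in> K c b" using L(2) L_subset_K by blast
    obtain xs where xs: "simple_path adj (Pat c) xs" "hd xs = (True, ex c x)" "last xs = b"
      using paths(1)[OF exits(1) b(1)] by blast
    have "\<bar>g t $ k - g s $ k\<bar> \<le> (1 / m) ^ n / m"
    proof (rule path_from_gate_height[OF Suc.IH xs(1) Suc.prems(1,2)])
      show "g s = gate c (hd xs) x" using xs(2) Suc.prems(3) by (simp add: exit_gate)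
      show "g s \<in> K c (hd xs)" using xs(2) Suc.prems(3) L(1) exit_pt_in_K by simp
      show "g t \<in> K c (last xs)" using b xs by simp
      show "\<not> linked x (hd xs) b" if "b \<in> set xs" for b
        using exit_not_linked[of b c x] that xs by (auto simp: simple_path_def)
    qed
    then show ?case by simp
  qed
  then show ?thesis by (rule eq_of_le_powers[OF m])
qed

text \<open>Height differences are at most 1, and each subdivision gains a factor
  \<open>1 / m\<close>. If the arc leaves its first cell, that part ends in a gate; reversed, it
  starts from an exit and is flat by \<open>from_exit_flat\<close>, so only the last cell
  contributes.\<close>

lemma finite_arc_flat:
  assumes "arc_in (L c) g s t" "arc_length g s t < \<infinity>"
  shows "g t $ k = g s $ k"
proof -
  have "\<bar>g t $ k - g s $ k\<bar> \<le> (1 / m) ^ n" for n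
    using assms
  proof (induction n arbitrary: c g s t)
    case 0
    have "g s \<in> L c" "g t \<in> L c" using arc_in_ends[OF 0(1)] by simp_all
    then show ?case using L_simplex(1)[of _ c k] L_le_1[of _ c k]
      by (smt (verit) power_0)
  next
    case (Suc n)
    have L: "g s \<in> L c" "g t \<in> L c" using arc_in_ends[OF Suc.prems(1)] by simp_all
    obtain a where a: "a \<in> Pat c" "g s \<in> K c a" using L(1) L_subset_K by blast
    obtain b where b: "b \<in> Pat c" "g t \<in> K c b" using L(2) L_subset_K by blast
    obtain xs where xs: "simple_path adj (Pat c) xs" "hd xs = a" "last xs = b"
      using paths(1)[OF a(1) b(1)] by blast
    have "\<bar>g t $ k - g s $ k\<bar> \<le> (1 / m) ^ n / m"
    proof (cases "tl xs")
      case Nil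
      then have "a = b" using xs by (cases xs) (auto simp: simple_path_def)
      then have "arc_in (K c a) g s t" using arc_in_single[OF Suc.prems(1) a(1)] a b by simp
      then show ?thesis by (rule single_cell_height[OF _ Suc.prems(2)]) (rule Suc.IH)
    next
      case (Cons d as)
      then have eq: "xs = a # d # as" using xs by (cases xs) auto
      obtain r where r: "r \<in> {s..t}" "g r = gate c a (label a d)" "g r = gate c d (label a d)"
        "g r \<in> K c a" "g r \<in> K c d" "arc_in (K c a) g s r" "arc_in (L c) g r t"
        by (rule arc_in_first[OF Suc.prems(1) xs(1)[unfolded eq] a(2)]) (use b xs eq in auto)
      have l: "linked (label a d) a d" using xs(1) by (simp add: linked_label simple_path_Cons eq)
      have fin: "arc_length g s r < \<infinity>" "arc_length g r t < \<infinity>"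
        using arc_length_mono[of s s r t g] arc_length_mono[of s r t t g] r(1) Suc.prems(2)
        by (auto intro: le_less_trans)
      have "\<bar>g t $ k - g r $ k\<bar> \<le> (1 / m) ^ n / m"
      proof (rule path_from_gate_height[where xs = "d # as" and x = "label a d", OF _ _ r(7) fin(2)])
        show "\<bar>h t $ k - h s $ k\<bar> \<le> (1 / m) ^ n" if "arc_in (L c) h s t" "arc_length h s t < \<infinity>" for c h s t
          by (rule Suc.IH[OF that])
        show "simple_path adj (Pat c) (d # as)" using xs(1) eq by (simp add: simple_path_Cons)
        show "\<not> linked (label a d) (hd (d # as)) e" if "e \<in> set (d # as)" for e
        proof
          assume "linked (label a d) (hd (d # as)) e"
          then have "e = a" using linked_unique[of "label a d" d e a] linked_sym[OF l] by simp
          then show False using that xs(1) eq by (auto simp: simple_path_def)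
        qed
      qed (use r b xs eq in auto)
      moreover have "g s $ k = g r $ k"
      proof -
        let ?h = "\<lambda>x. cell_inv m a (g x)"
        have "arc_length ?h s r \<le> ennreal m * arc_length g s r" by (rule arc_in_pull(2)[OF r(6)])
        also have "\<dots> < \<infinity>" using fin(1) by (simp add: ennreal_mult_less_top)
        finally have "arc_length (\<lambda>x. ?h (- x)) (- r) (- s) < \<infinity>"
          using arc_length_reverse[of ?h r s] by (rule le_less_trans[rotated])
        then have "?h s $ k = ?h r $ k"
          using from_exit_flat[OF arc_in_reverse[OF arc_in_pull(1)[OF r(6)]], of "label a d"] r(2) by simp
        then show ?thesis using cell_inv_height[of a "g s" k "g r"] m by simp
      qed
      ultimately show ?thesis by simp
    qed
    then show ?case by simp
  qed
  then show ?thesis by (rule eq_of_le_powers[OF m])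
qed

end

section \<open>Pattern graphs and barycentric coordinates\<close>

lemma set_vwalk_arcs_subset:
  "set (vwalk_arcs p) \<subseteq> R \<longleftrightarrow> successively (\<lambda>a b. (a, b) \<in> R) p"
  by (induction p rule: vwalk_arcs.induct) auto

lemma vpath_iff_simple_path:
  "vpath p (with_proj G) \<longleftrightarrow> simple_path (\<lambda>a b. (a, b) \<in> parcs G) (pverts G) p"
  by (auto simp: vpath_def vwalk_def simple_path_def set_vwalk_arcs_subset)

lemma simple_path_extend:
  assumes "simple_path E V xs" "E (last xs) v" "v \<in> V"
  obtains ys where "simple_path E V ys" "hd ys = hd xs" "last ys = v"
proof (cases "v \<in> set xs")
  case True
  then obtain as bs where xs: "xs = as @ v # bs" by (metis split_list)
  have "successively E ((as @ [v]) @ bs)" using assms(1) by (simp add: simple_path_def xs)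
  then have "successively E (as @ [v])" by (simp only: successively_append_iff)
  then have "simple_path E V (as @ [v])" using assms(1) by (auto simp: simple_path_def xs)
  moreover have "hd (as @ [v]) = hd xs" by (cases as) (auto simp: xs)
  ultimately show ?thesis using that[of "as @ [v]"] by simp
next
  case False
  have "simple_path E V (xs @ [v])"
    using assms False by (auto simp: simple_path_def successively_append_iff)
  then show ?thesis using that[of "xs @ [v]"] assms(1) by (simp add: simple_path_def)
qed

lemma rtrancl_on_simple_path:
  assumes "(u, v) \<in> rtrancl_on V R"
  shows "\<exists>xs. simple_path (\<lambda>a b. (a, b) \<in> R) V xs \<and> hd xs = u \<and> last xs = v"
  using assms
proof (induction rule: rtrancl_on_induct)
  case base
  then show ?case by (intro exI[of _ "[u]"]) (simp add: simple_path_def)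
next
  case (step y z)
  then obtain xs where xs: "simple_path (\<lambda>a b. (a, b) \<in> R) V xs" "hd xs = u" "last xs = y" by blast
  obtain ys where "simple_path (\<lambda>a b. (a, b) \<in> R) V ys" "hd ys = hd xs" "last ys = z"
    by (rule simple_path_extend[OF xs(1), of z]) (use step xs in auto)
  then show ?case using xs by metis
qed

text \<open>Cycles are lists of arcs, whereas simple paths are lists of vertices: pairing each
  vertex with its successor, and the last one with \<open>y\<close>, translates between
  them.\<close>

lemma pcas_closing_walk:
  assumes "xs \<noteq> []"
  shows "pcas (hd xs) (zip xs (tl xs @ [y])) y \<and>
    pawalk_verts (hd xs) (zip xs (tl xs @ [y])) = xs @ [y]"
  using assms
proof (induction xs)
  case (Cons x xs)
  then show ?case by (cases xs) auto
qed simp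

lemma zip_closing_walk_subset:
  assumes "xs \<noteq> []" "successively (\<lambda>a b. (a, b) \<in> R) (xs @ [y])"
  shows "set (zip xs (tl xs @ [y])) \<subseteq> R"
  using assms
proof (induction xs)
  case (Cons x xs)
  then show ?case by (cases xs) auto
qed simp

text \<open>Connectedness refers to the symmetric closure of the graph, which adds nothing to a
  symmetric set of arcs.\<close>

lemma undirected_tree_path_exists:
  assumes "undirected_tree G" "\<And>a b. (a, b) \<in> parcs G \<Longrightarrow> (b, a) \<in> parcs G"
    and "u \<in> pverts G" "v \<in> pverts G"
  shows "\<exists>xs. simple_path (\<lambda>a b. (a, b) \<in> parcs G) (pverts G) xs \<and> hd xs = u \<and> last xs = v"
proof (rule rtrancl_on_simple_path)
  have "parcs (mk_symmetric (with_proj G)) = parcs G"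
    using assms(2) by (auto simp: parcs_mk_symmetric)
  then show "(u, v) \<in> rtrancl_on (pverts G) (parcs G)"
    using assms by (simp add: undirected_tree_def connected_def strongly_connected_def reachable_def)
qed

lemma undirected_tree_path_unique:
  assumes "undirected_tree G" "\<And>a b. (a, b) \<in> parcs G \<Longrightarrow> (b, a) \<in> parcs G"
    and "simple_path (\<lambda>a b. (a, b) \<in> parcs G) (pverts G) p"
    and "simple_path (\<lambda>a b. (a, b) \<in> parcs G) (pverts G) q"
    and "hd p = hd q" "last p = last q"
  shows "p = q"
proof (rule simple_path_eqI[OF _ _ assms(3-6)])
  show "symp (\<lambda>a b. (a, b) \<in> parcs G)" using assms(2) by (auto intro: sympI)
next
  fix xs assume xs: "simple_path (\<lambda>a b. (a, b) \<in> parcs G) (pverts G) xs" "3 \<le> length xs"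
  show "(last xs, hd xs) \<notin> parcs G"
  proof
    assume *: "(last xs, hd xs) \<in> parcs G"
    define p where "p = zip xs (tl xs @ [hd xs])"
    have ne: "xs \<noteq> []" using xs by auto
    have "successively (\<lambda>a b. (a, b) \<in> parcs G) (xs @ [hd xs])"
      using xs(1) * by (simp add: simple_path_def successively_append_iff)
    then have "set p \<subseteq> parcs G" unfolding p_def by (rule zip_closing_walk_subset[OF ne])
    moreover have "hd xs \<in> pverts G" using xs(1) ne by (auto simp: simple_path_def)
    moreover have "distinct (tl (xs @ [hd xs]))"
      using xs(1) by (cases xs) (auto simp: simple_path_def)
    moreover have len: "length p = length xs" using ne by (simp add: p_def)
    ultimately have "pre_digraph.cycle (with_proj G) p"
      using pcas_closing_walk[OF ne, of "hd xs"] xs(2)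
      unfolding pre_digraph.cycle_def pre_digraph.awalk_def cas_with_proj_eq awalk_verts_with_proj_eq
      by (intro exI[of _ "hd xs"]) (auto simp flip: p_def)
    then show False using assms(1) xs(2) len by (auto simp: undirected_tree_def)
  qed
qed

lemma simple_path_map_iff:
  assumes "inj_on f V" "\<And>a b. a \<in> V \<Longrightarrow> b \<in> V \<Longrightarrow> E' (f a) (f b) \<longleftrightarrow> E a b" "set xs \<subseteq> V"
  shows "simple_path E' (f ` V) (map f xs) \<longleftrightarrow> simple_path E V xs"
proof -
  have "successively E' (map f xs) \<longleftrightarrow> successively E xs"
    using assms(2,3) by (induction xs rule: induct_list012) auto
  moreover have "distinct (map f xs) \<longleftrightarrow> distinct xs"
    using assms by (auto simp: distinct_map intro: inj_on_subset)
  ultimately show ?thesis using assms(3) by (auto simp: simple_path_def)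
qed

section \<open>Barycentric coordinates and affine maps\<close>

definition coordinates :: "real^2 \<Rightarrow> real^3" where
  "coordinates x = vector [1 - x $ 1 - x $ 2 / sqrt 3, x $ 1 - x $ 2 / sqrt 3, 2 * x $ 2 / sqrt 3]"

definition point :: "real^3 \<Rightarrow> real^2" where
  "point \<alpha> = (\<Sum>i\<in>UNIV. \<alpha> $ i *\<^sub>R P $ i)"

lemma P_nth: "P $ 1 = vector [0, 0]" "P $ 2 = vector [1, 0]" "P $ 3 = vector [1/2, sqrt 3 / 2]"
  by (simp_all add: P_def)

lemma point_nth: "point \<alpha> $ 1 = \<alpha> $ 2 + \<alpha> $ 3 / 2" "point \<alpha> $ 2 = \<alpha> $ 3 * sqrt 3 / 2"
  by (simp_all add: point_def sum_3 P_nth)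

lemma coordinates_nth:
  "coordinates x $ 1 = 1 - x $ 1 - x $ 2 / sqrt 3" "coordinates x $ 2 = x $ 1 - x $ 2 / sqrt 3"
  "coordinates x $ 3 = 2 * x $ 2 / sqrt 3"
  by (simp_all add: coordinates_def)

lemma point_coordinates [simp]: "point (coordinates x) = x"
  by (simp add: vec_eq_iff forall_2 point_nth coordinates_nth)

lemma sum_coordinates: "(\<Sum>i\<in>UNIV. coordinates x $ i) = 1"
  by (simp add: sum_3 coordinates_nth)

lemma coordinates_point: "(\<Sum>i\<in>UNIV. \<alpha> $ i) = 1 \<Longrightarrow> coordinates (point \<alpha>) = \<alpha>"
  by (simp add: vec_eq_iff forall_3 point_nth coordinates_nth sum_3)

lemma linear_point: "linear point"
  by (rule linearI) (simp_all add: point_def sum.distrib scaleR_left_distrib scaleR_right.sum)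

lemma point_inj:
  "point \<alpha> = point \<beta> \<Longrightarrow> (\<Sum>i\<in>UNIV. \<alpha> $ i) = 1 \<Longrightarrow> (\<Sum>i\<in>UNIV. \<beta> $ i) = 1 \<Longrightarrow> \<alpha> = \<beta>"
  by (metis coordinates_point)

lemma continuous_point: "continuous_on X point"
  by (rule linear_continuous_on) (simp add: linear_conv_bounded_linear[symmetric] linear_point)

text \<open>Each of the three coordinates is 4-Lipschitz, and the norm is at most the sum of their
  moduli. A crude constant is enough to keep lengths finite.\<close>

lemma dist_coordinates: "dist (coordinates x) (coordinates y) \<le> 12 * dist x y"
proof -
  have s3: "1 \<le> sqrt 3" by simp
  have d: "\<bar>x $ i - y $ i\<bar> \<le> dist x y" for i
    using component_le_norm_cart[of "x - y" i] by (simp add: dist_norm)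
  have q: "\<bar>x $ 2 / sqrt 3 - y $ 2 / sqrt 3\<bar> \<le> dist x y"
  proof -
    have "\<bar>x $ 2 / sqrt 3 - y $ 2 / sqrt 3\<bar> = \<bar>x $ 2 - y $ 2\<bar> / sqrt 3"
      by (simp add: diff_divide_distrib[symmetric])
    also have "\<dots> \<le> \<bar>x $ 2 - y $ 2\<bar>" using s3 by (simp add: divide_le_eq mult_le_cancel_left1)
    finally show ?thesis using d[of 2] by simp
  qed
  have c: "\<bar>coordinates x $ i - coordinates y $ i\<bar> \<le> 4 * dist x y" for i
    using exhaust_3[of i] d[of 1] q by (auto simp: coordinates_nth)
  have "dist (coordinates x) (coordinates y) \<le> (\<Sum>i\<in>UNIV. \<bar>(coordinates x - coordinates y) $ i\<bar>)"
    unfolding dist_norm by (rule norm_le_l1_cart)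
  also have "\<dots> \<le> 12 * dist x y" using c[of 1] c[of 2] c[of 3] by (simp add: sum_3)
  finally show ?thesis .
qed

lemma continuous_coordinates: "continuous_on X coordinates"
  by (rule lipschitz_on_continuous_on[of 12]) (auto intro!: lipschitz_onI dist_coordinates)

lemma bary_point:
  assumes "\<alpha> \<in> H"
  shows "bary (point \<alpha>) = \<alpha>"
  unfolding bary_def
proof (rule the_equality)
  show "\<alpha> \<in> H \<and> point \<alpha> = (\<Sum>i\<in>UNIV. \<alpha> $ i *\<^sub>R P $ i)" using assms by (simp add: point_def)
  show "\<beta> = \<alpha>" if "\<beta> \<in> H \<and> point \<alpha> = (\<Sum>i\<in>UNIV. \<beta> $ i *\<^sub>R P $ i)" for \<beta>
    by (rule point_inj) (use that assms in \<open>auto simp: H_def point_def\<close>)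
qed

definition unit_vec :: "3 \<Rightarrow> real^3" where
  "unit_vec i = axis i 1"

lemma unit_vec_nth: "unit_vec i $ l = (if l = i then 1 else 0)"
  by (auto simp: unit_vec_def axis_def)

lemma unit_vec_H: "unit_vec i \<in> H"
  by (auto simp: H_def unit_vec_nth)

lemma point_unit_vec: "point (unit_vec i) = P $ i"
  using exhaust_3[of i] by (auto simp: point_def sum_3 unit_vec_nth)

definition triangle_of :: "(real^3 \<Rightarrow> real^3) \<Rightarrow> triangle" where
  "triangle_of f = (\<chi> i. point (f (unit_vec i)))"

text \<open>Affinity on the plane of coordinate sum 1: such a map is determined there by the images
  of the vertices, that is, by its triangle.\<close>

definition affine_comb :: "(real^3 \<Rightarrow> real^3) \<Rightarrow> bool" where
  "affine_comb f \<longleftrightarrow> (\<forall>\<alpha>. (\<Sum>i\<in>UNIV. \<alpha> $ i) = 1 \<longrightarrow> f \<alpha> = (\<Sum>i\<in>UNIV. \<alpha> $ i *\<^sub>R f (unit_vec i)))"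

lemma point_affine_comb:
  assumes "affine_comb f" "(\<Sum>i\<in>UNIV. \<alpha> $ i) = 1"
  shows "point (f \<alpha>) = (\<Sum>i\<in>UNIV. \<alpha> $ i *\<^sub>R triangle_of f $ i)"
proof -
  have "f \<alpha> = (\<Sum>i\<in>UNIV. \<alpha> $ i *\<^sub>R f (unit_vec i))" using assms by (simp add: affine_comb_def)
  then have "point (f \<alpha>) = point (\<Sum>i\<in>UNIV. \<alpha> $ i *\<^sub>R f (unit_vec i))" by (rule arg_cong)
  also have "\<dots> = (\<Sum>i\<in>UNIV. \<alpha> $ i *\<^sub>R point (f (unit_vec i)))"
    by (simp add: linear_sum[OF linear_point] linear_scale[OF linear_point])
  finally show ?thesis by (simp add: triangle_of_def)
qed

lemma solid_triangle_of:
  assumes "affine_comb f"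
  shows "solid (triangle_of f) = (\<lambda>\<alpha>. point (f \<alpha>)) ` H"
proof
  have conv: "convex ((\<lambda>\<alpha>. point (f \<alpha>)) ` H)"
  proof -
    have "convex H"
    proof (rule convexI)
      fix x y :: "real^3" and u v :: real
      assume xy: "x \<in> H" "y \<in> H" and uv: "0 \<le> u" "0 \<le> v" "u + v = 1"
      have "0 \<le> u * x $ i + v * y $ i \<and> u * x $ i + v * y $ i \<le> 1" for i
        using xy uv convex_bound_le[of "x $ i" 1 "y $ i" u v] by (auto simp: H_def)
      moreover have "(\<Sum>i\<in>UNIV. u * x $ i + v * y $ i) = 1"
        using xy uv by (simp add: H_def sum.distrib sum_distrib_left[symmetric])
      ultimately show "u *\<^sub>R x + v *\<^sub>R y \<in> H" by (simp add: H_def)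
    qed
    moreover have "linear (\<lambda>\<alpha>. \<Sum>i\<in>UNIV. \<alpha> $ i *\<^sub>R triangle_of f $ i)"
      by (rule linearI) (simp_all add: sum.distrib scaleR_left_distrib scaleR_right.sum)
    ultimately have "convex ((\<lambda>\<alpha>. \<Sum>i\<in>UNIV. \<alpha> $ i *\<^sub>R triangle_of f $ i) ` H)"
      by (rule convex_linear_image[rotated])
    moreover have "(\<lambda>\<alpha>. \<Sum>i\<in>UNIV. \<alpha> $ i *\<^sub>R triangle_of f $ i) ` H = (\<lambda>\<alpha>. point (f \<alpha>)) ` H"
      using point_affine_comb[OF assms] by (intro image_cong) (auto simp: H_def)
    ultimately show ?thesis by simp
  qed
  show "solid (triangle_of f) \<subseteq> (\<lambda>\<alpha>. point (f \<alpha>)) ` H"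
    unfolding solid_def
  proof (rule hull_minimal)
    show "range (\<lambda>i. triangle_of f $ i) \<subseteq> (\<lambda>\<alpha>. point (f \<alpha>)) ` H"
      by (auto simp: triangle_of_def unit_vec_H)
  qed (rule conv)
  show "(\<lambda>\<alpha>. point (f \<alpha>)) ` H \<subseteq> solid (triangle_of f)"
  proof safe
    fix \<alpha> assume \<alpha>: "\<alpha> \<in> H"
    then have "point (f \<alpha>) = (\<Sum>i\<in>UNIV. \<alpha> $ i *\<^sub>R triangle_of f $ i)"
      by (intro point_affine_comb[OF assms]) (simp add: H_def)
    also have "\<dots> \<in> solid (triangle_of f)"
      unfolding solid_def
      by (rule convex_sum) (use \<alpha> in \<open>auto simp: H_def intro: hull_inc\<close>)
    finally show "point (f \<alpha>) \<in> solid (triangle_of f)" .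
  qed
qed

lemma closed_solid: "closed (solid A)"
  unfolding solid_def by (intro compact_imp_closed compact_convex_hull finite_imp_compact) simp

text \<open>Turns nesting of triangles into composition of maps; \<open>bary\<close> recovers the
  argument because \<open>h\<close> keeps the vertices in \<open>H\<close>.\<close>

lemma tri_image_triangle_of:
  assumes "affine_comb f" "\<And>i. h (unit_vec i) \<in> H"
  shows "tri_image (triangle_of f) (triangle_of h) = triangle_of (f \<circ> h)"
proof -
  have "tri_map (triangle_of f) (point (h (unit_vec i))) = point (f (h (unit_vec i)))" for i
    using point_affine_comb[OF assms(1), of "h (unit_vec i)"] assms(2)[of i]
    by (simp add: tri_map_def bary_point H_def)
  then show ?thesis by (simp add: tri_image_def triangle_of_def)
qed

section \<open>Cells, words and the levels of a patterns system\<close>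

lemma H_iff: "\<alpha> \<in> H \<longleftrightarrow> (\<forall>i. 0 \<le> \<alpha> $ i) \<and> (\<Sum>i\<in>UNIV. \<alpha> $ i) = 1"
  using member_le_sum[of _ UNIV "\<lambda>i. \<alpha> $ i"] by (auto simp: H_def)

text \<open>Down indices sum to \<open>m - 2\<close>; the shift by 1 in three entries makes this
  \<open>m + 1\<close>.\<close>

definition cells :: "nat \<Rightarrow> cell set" where
  "cells m = {(b, u). (\<forall>i. (if b then 0 else 1) \<le> u $ i) \<and>
     (\<Sum>i\<in>UNIV. u $ i) = int m + (if b then -1 else 1)}"

definition cell_triangle :: "nat \<Rightarrow> cell \<Rightarrow> triangle" where
  "cell_triangle m a = triangle_of (cell_map m a)"

lemma cell_map_sum:
  assumes "m \<ge> 2" "a \<in> cells m" "(\<Sum>i\<in>UNIV. x $ i) = 1"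
  shows "(\<Sum>i\<in>UNIV. cell_map m a x $ i) = 1"
proof -
  have "real_of_int (\<Sum>i\<in>UNIV. snd a $ i) = m - orient (fst a)"
    using assms(2) by (cases a) (auto simp: cells_def orient_def split: if_splits)
  then show ?thesis
    using assms(1,3)
    by (simp add: cell_map_nth sum_divide_distrib[symmetric] sum.distrib sum_distrib_left[symmetric])
qed

lemma cell_map_H:
  assumes "m \<ge> 2" "a \<in> cells m" "x \<in> H"
  shows "cell_map m a x \<in> H"
proof -
  have "0 \<le> real_of_int (snd a $ i) + orient (fst a) * x $ i" for i
  proof (cases "fst a")
    case True
    then have "0 \<le> snd a $ i" using assms(2) by (auto simp: cells_def)
    then show ?thesis using True assms(3) by (simp add: H_iff)
  next
    case False
    then have "1 \<le> snd a $ i" using assms(2) by (auto simp: cells_def)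
    then show ?thesis using False assms(3) by (simp add: H_def) (smt (verit) of_int_1_le_iff)
  qed
  then show ?thesis using cell_map_sum[OF assms(1,2), of x] assms(3)
    by (auto simp: H_iff cell_map_nth)
qed

lemma affine_comb_cell_map: "affine_comb (cell_map m a)"
  unfolding affine_comb_def
proof (intro allI impI)
  fix \<alpha> :: "real^3" assume \<alpha>: "(\<Sum>i\<in>UNIV. \<alpha> $ i) = 1"
  have "cell_map m a \<alpha> $ l = (\<Sum>i\<in>UNIV. \<alpha> $ i *\<^sub>R cell_map m a (unit_vec i)) $ l" for l
  proof -
    have "(\<Sum>i\<in>UNIV. \<alpha> $ i *\<^sub>R cell_map m a (unit_vec i)) $ l =
        (\<Sum>i\<in>UNIV. \<alpha> $ i * snd a $ l / m + (if l = i then orient (fst a) * \<alpha> $ i / m else 0))"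
      unfolding sum_component by (intro sum.cong) (auto simp: cell_map_nth unit_vec_nth add_divide_distrib distrib_left mult.commute)
    also have "\<dots> = (\<Sum>i\<in>UNIV. \<alpha> $ i) * snd a $ l / m + orient (fst a) * \<alpha> $ l / m"
      by (simp add: sum.distrib sum_distrib_right sum_divide_distrib)
    finally show ?thesis using \<alpha> by (simp add: cell_map_nth add_divide_distrib)
  qed
  then show "cell_map m a \<alpha> = (\<Sum>i\<in>UNIV. \<alpha> $ i *\<^sub>R cell_map m a (unit_vec i))" by (simp add: vec_eq_iff)
qed

lemma affine_comb_comp:
  assumes f: "affine_comb f" and h: "affine_comb h"
    and sum: "\<And>\<alpha>. (\<Sum>i\<in>UNIV. \<alpha> $ i) = 1 \<Longrightarrow> (\<Sum>i\<in>UNIV. h \<alpha> $ i) = 1"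
  shows "affine_comb (f \<circ> h)"
  unfolding affine_comb_def
proof (intro allI impI)
  fix \<alpha> :: "real^3" assume \<alpha>: "(\<Sum>i\<in>UNIV. \<alpha> $ i) = 1"
  have f_eq: "f \<beta> = (\<Sum>i\<in>UNIV. \<beta> $ i *\<^sub>R f (unit_vec i))" if "(\<Sum>i\<in>UNIV. \<beta> $ i) = 1" for \<beta>
    using f that by (simp add: affine_comb_def)
  have "h \<alpha> = (\<Sum>l\<in>UNIV. \<alpha> $ l *\<^sub>R h (unit_vec l))" using h \<alpha> by (simp add: affine_comb_def)
  then have h_nth: "h \<alpha> $ i = (\<Sum>l\<in>UNIV. \<alpha> $ l * h (unit_vec l) $ i)" for i by simp
  have "(f \<circ> h) \<alpha> = (\<Sum>i\<in>UNIV. h \<alpha> $ i *\<^sub>R f (unit_vec i))" using f_eq[OF sum[OF \<alpha>]] by simp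
  also have "\<dots> = (\<Sum>i\<in>UNIV. \<Sum>l\<in>UNIV. (\<alpha> $ l * h (unit_vec l) $ i) *\<^sub>R f (unit_vec i))"
    by (simp add: h_nth scaleR_left.sum)
  also have "\<dots> = (\<Sum>l\<in>UNIV. \<alpha> $ l *\<^sub>R (\<Sum>i\<in>UNIV. h (unit_vec l) $ i *\<^sub>R f (unit_vec i)))"
    by (subst sum.swap) (simp add: scaleR_right.sum)
  also have "\<dots> = (\<Sum>l\<in>UNIV. \<alpha> $ l *\<^sub>R (f \<circ> h) (unit_vec l))"
  proof (intro sum.cong refl)
    fix l :: 3
    have "(\<Sum>i\<in>UNIV. h (unit_vec l) $ i) = 1" using unit_vec_H[of l] by (intro sum) (simp add: H_iff)
    from f_eq[OF this]
    show "\<alpha> $ l *\<^sub>R (\<Sum>i\<in>UNIV. h (unit_vec l) $ i *\<^sub>R f (unit_vec i)) = \<alpha> $ l *\<^sub>R (f \<circ> h) (unit_vec l)"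
      by simp
  qed
  finally show "(f \<circ> h) \<alpha> = (\<Sum>l\<in>UNIV. \<alpha> $ l *\<^sub>R (f \<circ> h) (unit_vec l))" .
qed

lemma cell_triangle_inj:
  assumes "m \<ge> 2" "a \<in> cells m" "b \<in> cells m" "cell_triangle m a = cell_triangle m b"
  shows "a = b"
proof -
  have eq: "cell_map m a (unit_vec i) = cell_map m b (unit_vec i)" for i
  proof (rule point_inj)
    show "point (cell_map m a (unit_vec i)) = point (cell_map m b (unit_vec i))"
      using assms(4) by (simp add: cell_triangle_def triangle_of_def vec_eq_iff)
  qed (use cell_map_sum assms unit_vec_H[of i] in \<open>auto simp: H_iff\<close>)
  have comp: "real_of_int (snd a $ l) + orient (fst a) * unit_vec i $ l =
      real_of_int (snd b $ l) + orient (fst b) * unit_vec i $ l" for i l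
    using arg_cong[OF eq[of i], of "\<lambda>v. v $ l"] assms(1) by (simp add: cell_map_nth)
  have "snd a $ l = snd b $ l" for l
  proof -
    \<comment> \<open>A vertex other than \<open>l\<close> contributes 0 to entry \<open>l\<close>,
      so the integer can be read off whatever the orientation is.\<close>
    obtain i where "i \<noteq> l" using other_index_3 by blast
    then show ?thesis using comp[of l i] by (simp add: unit_vec_nth)
  qed
  then have "snd a = snd b" by (simp add: vec_eq_iff)
  moreover have "fst a = fst b"
    using comp[of 1 1] calculation by (auto simp: unit_vec_nth orient_def split: if_splits)
  ultimately show ?thesis by (simp add: prod_eq_iff)
qed

lemma point_real_vec: "point (real_vec k) = (\<Sum>l\<in>UNIV. of_int (k $ l) *\<^sub>R P $ l)"
  by (simp add: point_def)

lemma T_eq: "T m k = cell_triangle m (True, k)"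
proof -
  have "point (cell_map m (True, k) (unit_vec i)) = T m k $ i" for i
    by (simp add: cell_map_def T_def linear_scale[OF linear_point] linear_add[OF linear_point]
        point_real_vec point_unit_vec)
  then show ?thesis by (simp add: vec_eq_iff cell_triangle_def triangle_of_def)
qed

lemma T'_eq: "T' m k = cell_triangle m (False, \<chi> i. k $ i + 1)"
proof -
  have "real_vec (\<chi> i. k $ i + 1) = real_vec k + unit_vec 1 + unit_vec 2 + unit_vec 3"
    by (simp add: vec_eq_iff forall_3 unit_vec_nth)
  then have "point (cell_map m (False, \<chi> i. k $ i + 1) (unit_vec i)) = T' m k $ i" for i
    by (simp add: cell_map_def T'_def linear_scale[OF linear_point] linear_add[OF linear_point]
        linear_diff[OF linear_point] point_real_vec point_unit_vec)
  then show ?thesis by (simp add: vec_eq_iff cell_triangle_def triangle_of_def)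
qed

lemma up_cells_iff: "(True, k) \<in> cells m \<longleftrightarrow> k \<in> idx (int m - 1)"
  by (simp add: cells_def idx_def)

lemma down_cells_iff: "(False, \<chi> i. k $ i + 1) \<in> cells m \<longleftrightarrow> k \<in> idx (int m - 2)"
  by (auto simp: cells_def idx_def sum.distrib)

lemma cells_cases:
  assumes "a \<in> cells m"
  obtains k where "a = (True, k)" "k \<in> idx (int m - 1)" "cell_triangle m a = T m k"
  | k where "a = (False, \<chi> i. k $ i + 1)" "k \<in> idx (int m - 2)" "cell_triangle m a = T' m k"
proof (cases "fst a")
  case True
  then have "a = (True, snd a)" by (simp add: prod_eq_iff)
  then show ?thesis using that(1)[of "snd a"] assms up_cells_iff T_eq by metis
next
  case False
  define k where "k = (\<chi> i. snd a $ i - 1)"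
  have "a = (False, \<chi> i. k $ i + 1)" using False by (simp add: prod_eq_iff vec_eq_iff k_def)
  then show ?thesis using that(2)[of k] assms down_cells_iff T'_eq by metis
qed

lemma calT_eq: "calT m = cell_triangle m ` {a \<in> cells m. fst a}"
proof -
  have "{a \<in> cells m. fst a} = (\<lambda>k. (True, k)) ` idx (int m - 1)"
    by (auto simp: up_cells_iff image_iff)
  then show ?thesis by (simp add: calT_def image_image T_eq)
qed

lemma calT'_eq: "calT' m = cell_triangle m ` {a \<in> cells m. \<not> fst a}"
proof -
  have "{a \<in> cells m. \<not> fst a} = (\<lambda>k. (False, \<chi> i. k $ i + 1)) ` idx (int m - 2)"
  proof (intro equalityI subsetI)
    fix a assume "a \<in> {a \<in> cells m. \<not> fst a}"
    then show "a \<in> (\<lambda>k. (False, \<chi> i. k $ i + 1)) ` idx (int m - 2)"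
      by (auto elim!: cells_cases)
  qed (auto simp: down_cells_iff)
  then show ?thesis by (simp add: calT'_def image_image T'_eq)
qed

lemma neighbours_iff:
  assumes "m \<ge> 2" "a \<in> cells m" "b \<in> cells m"
  shows "neighbours m j (cell_triangle m a) (cell_triangle m b) \<longleftrightarrow> link j a b"
proof
  assume "neighbours m j (cell_triangle m a) (cell_triangle m b)"
  then obtain k k' where k: "k \<in> idx (int m - 1)" "k' \<in> idx (int m - 2)"
      "cell_triangle m a = T m k" "cell_triangle m b = T' m k'"
      "k $ j = k' $ j + 1" "\<forall>i. i \<noteq> j \<longrightarrow> k $ i = k' $ i"
    by (auto simp: neighbours_def)
  have "a = (True, k)" "b = (False, \<chi> i. k' $ i + 1)"
    using k assms by (auto intro!: cell_triangle_inj[of m] simp: T_eq T'_eq up_cells_iff down_cells_iff)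
  then show "link j a b" using k by (simp add: link_def)
next
  assume *: "link j a b"
  obtain k where a: "a = (True, k)" "k \<in> idx (int m - 1)" "cell_triangle m a = T m k"
    using assms(2) by (rule cells_cases) (use * in \<open>auto simp: link_def\<close>)
  obtain k' where b: "b = (False, \<chi> i. k' $ i + 1)" "k' \<in> idx (int m - 2)" "cell_triangle m b = T' m k'"
    using assms(3) by (rule cells_cases) (use * in \<open>auto simp: link_def\<close>)
  show "neighbours m j (cell_triangle m a) (cell_triangle m b)"
    unfolding neighbours_def
    by (intro bexI[of _ k] bexI[of _ k']) (use * a b in \<open>auto simp: link_def\<close>)
qed

lemma strip_eq: "strip m i n = cell_triangle m ` {a \<in> cells m. strip_index i a = n}"
proof (intro equalityI subsetI)
  fix A assume "A \<in> strip m i n"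
  then consider k where "A = T m k" "k \<in> idx (int m - 1)" "k $ i = n"
    | k where "A = T' m k" "k \<in> idx (int m - 2)" "k $ i = n"
    unfolding strip_def by blast
  then show "A \<in> cell_triangle m ` {a \<in> cells m. strip_index i a = n}"
  proof cases
    case (1 k)
    then show ?thesis
      by (intro image_eqI[of _ _ "(True, k)"]) (simp_all add: T_eq up_cells_iff strip_index_def)
  next
    case (2 k)
    then show ?thesis
      by (intro image_eqI[of _ _ "(False, \<chi> i. k $ i + 1)"])
        (simp_all add: T'_eq down_cells_iff strip_index_def)
  qed
next
  fix A assume "A \<in> cell_triangle m ` {a \<in> cells m. strip_index i a = n}"
  then obtain a where a: "a \<in> cells m" "strip_index i a = n" "A = cell_triangle m a" by auto
  from a(1) show "A \<in> strip m i n"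
    by (rule cells_cases) (use a(2,3) in \<open>auto simp: strip_def strip_index_def\<close>)
qed

lemma strip_iff:
  assumes "m \<ge> 2" "a \<in> cells m"
  shows "cell_triangle m a \<in> strip m i n \<longleftrightarrow> strip_index i a = n"
proof
  assume "cell_triangle m a \<in> strip m i n"
  then obtain b where b: "b \<in> cells m" "strip_index i b = n" "cell_triangle m a = cell_triangle m b"
    unfolding strip_eq by auto
  then show "strip_index i a = n" using cell_triangle_inj[OF assms b(1,3)] by simp
qed (use assms(2) in \<open>auto simp: strip_eq\<close>)

lemma finite_idx: "finite (idx n)"
proof -
  have "idx n \<subseteq> (\<lambda>(a, b, c). vector [a, b, c]) ` ({0..n} \<times> {0..n} \<times> {0..n})"
  proof
    fix k assume k: "k \<in> idx n"
    then have "k = vector [k $ 1, k $ 2, k $ 3]" by (simp add: vec_eq_iff forall_3)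
    moreover have "k $ i \<in> {0..n}" for i
      using k member_le_sum[of i UNIV "\<lambda>i. k $ i"] by (auto simp: idx_def)
    ultimately show "k \<in> (\<lambda>(a, b, c). vector [a, b, c]) ` ({0..n} \<times> {0..n} \<times> {0..n})"
      by (intro image_eqI[of _ _ "(k $ 1, k $ 2, k $ 3)"]) auto
  qed
  then show ?thesis by (rule finite_subset) auto
qed

lemma finite_cells: "finite (cells m)"
proof (rule finite_subset)
  show "cells m \<subseteq> (\<lambda>k. (True, k)) ` idx (int m - 1) \<union> (\<lambda>k. (False, \<chi> i. k $ i + 1)) ` idx (int m - 2)"
    by (auto elim!: cells_cases)
qed (simp add: finite_idx)

definition part :: "patterns \<Rightarrow> bool \<Rightarrow> bool \<Rightarrow> triangle set" where
  "part S c d = (if c then (if d then white_up S else white_down S)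
     else (if d then yellow_up S else yellow_down S))"

definition pattern :: "nat \<Rightarrow> patterns \<Rightarrow> bool \<Rightarrow> cell set" where
  "pattern m S c = {a \<in> cells m. cell_triangle m a \<in> part S c (fst a)}"

lemma part_eq:
  assumes "patterns_system m S"
  shows "part S c d = cell_triangle m ` {a \<in> pattern m S c. fst a = d}"
proof -
  have "part S c d \<subseteq> cell_triangle m ` {a \<in> cells m. fst a = d}"
    using assms by (cases d) (auto simp: patterns_system_def part_def calT_eq calT'_eq)
  then show ?thesis by (auto simp: pattern_def)
qed

lemma part_refine:
  "part (refine S L) c d = images (part L c True) (part S c d) \<union> images (part L c False) (part S (\<not> c) (\<not> d))"
  by (auto simp: part_def refine_def)

text \<open>Addresses of nested triangles, outermost cell first. After a down cell the rest is taken
  from the other colour.\<close>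

fun word :: "nat \<Rightarrow> patterns \<Rightarrow> bool \<Rightarrow> cell list \<Rightarrow> bool" where
  "word m S c [] = True"
| "word m S c (a # w) = (a \<in> pattern m S c \<and> word m S (c = fst a) w)"

text \<open>The colour changes with every down cell, so \<open>word_colour c w = c\<close> says that
  their number in \<open>w\<close> is even, that is, that the composed triangle points up.\<close>

fun word_colour :: "bool \<Rightarrow> cell list \<Rightarrow> bool" where
  "word_colour c [] = c"
| "word_colour c (a # w) = word_colour (c = fst a) w"

fun word_map :: "nat \<Rightarrow> cell list \<Rightarrow> real^3 \<Rightarrow> real^3" where
  "word_map m [] = id"
| "word_map m (a # w) = cell_map m a \<circ> word_map m w"

lemma word_append: "word m S c (v @ w) \<longleftrightarrow> word m S c v \<and> word m S (word_colour c v) w"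
  by (induction v arbitrary: c) auto

lemma word_colour_append: "word_colour c (v @ w) = word_colour (word_colour c v) w"
  by (induction v arbitrary: c) auto

lemma word_map_append: "word_map m (v @ w) = word_map m v \<circ> word_map m w"
  by (induction v) (auto simp: o_assoc)

lemma word_map_sum:
  "m \<ge> 2 \<Longrightarrow> word m S c w \<Longrightarrow> (\<Sum>i\<in>UNIV. x $ i) = 1 \<Longrightarrow> (\<Sum>i\<in>UNIV. word_map m w x $ i) = 1"
  by (induction w arbitrary: c) (auto simp: cell_map_sum pattern_def)

lemma word_map_H: "m \<ge> 2 \<Longrightarrow> word m S c w \<Longrightarrow> x \<in> H \<Longrightarrow> word_map m w x \<in> H"
  by (induction w arbitrary: c) (auto simp: cell_map_H pattern_def)

lemma affine_comb_word_map: "m \<ge> 2 \<Longrightarrow> word m S c w \<Longrightarrow> affine_comb (word_map m w)"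
proof (induction w arbitrary: c)
  case Nil
  have "\<alpha> = (\<Sum>i\<in>UNIV. \<alpha> $ i *\<^sub>R unit_vec i)" for \<alpha> :: "real^3"
    by (simp add: vec_eq_iff forall_3 sum_3 unit_vec_nth)
  then show ?case by (simp add: affine_comb_def)
next
  case (Cons a w)
  then have w: "word m S (c = fst a) w" by simp
  have "affine_comb (cell_map m a \<circ> word_map m w)"
    by (rule affine_comb_comp[OF affine_comb_cell_map Cons.IH[OF Cons.prems(1) w] word_map_sum[OF Cons.prems(1) w]])
  then show ?case unfolding word_map.simps .
qed

lemma images_triangles:
  assumes m: "m \<ge> 2" and S: "patterns_system m S"
  shows "images {triangle_of (word_map m w) | w. length w = n \<and> word m S c w \<and> (word_colour c w = c) = d'}
      (part S (c = d') d) =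
    {triangle_of (word_map m (w @ [a])) | w a. length w = n \<and> word m S c (w @ [a]) \<and>
      (word_colour c w = c) = d' \<and> fst a = d}" (is "?L = ?R")
proof -
  have col: "word_colour c w = (c = d')" if "(word_colour c w = c) = d'" for w using that by auto
  have eq: "tri_image (triangle_of (word_map m w)) (cell_triangle m a) = triangle_of (word_map m (w @ [a]))"
    if "word m S c (w @ [a])" for w a
  proof -
    have w: "word m S c w" "a \<in> cells m" using that by (auto simp: word_append pattern_def)
    then show ?thesis unfolding cell_triangle_def
      by (subst tri_image_triangle_of)
        (auto intro: affine_comb_word_map[OF m] cell_map_H[OF m] simp: unit_vec_H word_map_append)
  qed
  show ?thesis
  proof (intro equalityI subsetI)
    fix x assume "x \<in> ?L"
    then obtain w a where wa: "length w = n" "word m S c w" "(word_colour c w = c) = d'"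
        "a \<in> pattern m S (c = d')" "fst a = d"
        "x = tri_image (triangle_of (word_map m w)) (cell_triangle m a)"
      unfolding images_def part_eq[OF S] by blast
    then have "word m S c (w @ [a])" using col[OF wa(3)] by (simp add: word_append)
    with wa eq show "x \<in> ?R" by blast
  next
    fix x assume "x \<in> ?R"
    then obtain w a where wa: "length w = n" "word m S c (w @ [a])" "(word_colour c w = c) = d'" "fst a = d"
        "x = triangle_of (word_map m (w @ [a]))" by blast
    then have "word m S c w" "a \<in> pattern m S (c = d')" using col[OF wa(3)] by (auto simp: word_append)
    moreover have "x = tri_image (triangle_of (word_map m w)) (cell_triangle m a)" using eq wa by simp
    ultimately show "x \<in> ?L" unfolding images_def part_eq[OF S] using wa by blast
  qed
qed

text \<open>\<open>refine\<close> inserts new cells innermost and so appends a letter, whereas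
  self-similarity splits off the outermost cell, the first letter. Words give access to both
  ends.\<close>

lemma part_level:
  assumes m: "m \<ge> 2" and S: "patterns_system m S"
  shows "part (level S (Suc n)) c d =
    {triangle_of (word_map m w) | w. length w = Suc n \<and> word m S c w \<and> (word_colour c w = c) = d}"
proof (induction n arbitrary: d)
  case 0
  have "{w. length w = Suc 0 \<and> word m S c w \<and> (word_colour c w = c) = d} = (\<lambda>a. [a]) ` {a \<in> pattern m S c. fst a = d}"
    by (auto simp: length_Suc_conv)
  moreover have "{triangle_of (word_map m w) | w. length w = Suc 0 \<and> word m S c w \<and> (word_colour c w = c) = d} =
      (\<lambda>w. triangle_of (word_map m w)) ` {w. length w = Suc 0 \<and> word m S c w \<and> (word_colour c w = c) = d}"
    by auto
  ultimately show ?case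
    by (simp add: level_def part_eq[OF S] image_image cell_triangle_def)
next
  case (Suc n)
  let ?X = "\<lambda>d d'. {triangle_of (word_map m (w @ [a])) | w a. length w = Suc n \<and> word m S c (w @ [a]) \<and>
      (word_colour c w = c) = d' \<and> fst a = d}"
  have "part (level S (Suc (Suc n))) c d =
      images (part (level S (Suc n)) c True) (part S (c = True) d) \<union>
      images (part (level S (Suc n)) c False) (part S (c = False) (\<not> d))"
    by (simp add: level_def part_refine)
  also have "\<dots> = ?X d True \<union> ?X (\<not> d) False"
    unfolding Suc.IH images_triangles[OF m S] ..
  also have "\<dots> = {triangle_of (word_map m w) | w. length w = Suc (Suc n) \<and> word m S c w \<and> (word_colour c w = c) = d}"
    (is "_ = ?Y")
  proof (intro equalityI subsetI)
    fix x assume "x \<in> ?X d True \<union> ?X (\<not> d) False"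
    then show "x \<in> ?Y"
    proof (elim UnE CollectE exE conjE)
      fix w a
      assume "x = triangle_of (word_map m (w @ [a]))" "length w = Suc n" "word m S c (w @ [a])"
        "(word_colour c w = c) = True" "fst a = d"
      then show "x \<in> ?Y" by (intro CollectI exI[of _ "w @ [a]"]) (auto simp: word_colour_append)
    next
      fix w a
      assume "x = triangle_of (word_map m (w @ [a]))" "length w = Suc n" "word m S c (w @ [a])"
        "(word_colour c w = c) = False" "fst a = (\<not> d)"
      then show "x \<in> ?Y" by (intro CollectI exI[of _ "w @ [a]"]) (auto simp: word_colour_append)
    qed
  next
    fix x assume "x \<in> ?Y"
    then obtain v where v: "x = triangle_of (word_map m v)" "length v = Suc (Suc n)" "word m S c v"
        "(word_colour c v = c) = d" by auto
    obtain w a where wa: "v = w @ [a]" using v(2) by (cases v rule: rev_cases) auto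
    have "fst a = (if word_colour c w = c then d else \<not> d)"
      using v(4) wa by (auto simp: word_colour_append)
    then have "(word_colour c w = c \<and> fst a = d) \<or> (word_colour c w \<noteq> c \<and> fst a = (\<not> d))" by presburger
    then show "x \<in> ?X d True \<union> ?X (\<not> d) False"
    proof (elim disjE conjE)
      assume "word_colour c w = c" "fst a = d"
      then have "x \<in> ?X d True"
        using v(1-3) unfolding wa by (intro CollectI exI[of _ w] exI[of _ a]) simp
      then show ?thesis ..
    next
      assume "word_colour c w \<noteq> c" "fst a = (\<not> d)"
      then have "x \<in> ?X (\<not> d) False"
        using v(1-3) unfolding wa by (intro CollectI exI[of _ w] exI[of _ a]) simp
      then show ?thesis ..
    qed
  qed
  finally show ?case .
qed

definition fractal :: "patterns \<Rightarrow> bool \<Rightarrow> (real^2) set" where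
  "fractal S c = (if c then white_fractal S else yellow_fractal S)"

definition bary_fractal :: "patterns \<Rightarrow> bool \<Rightarrow> (real^3) set" where
  "bary_fractal S c = {x. (\<Sum>i\<in>UNIV. x $ i) = 1 \<and> point x \<in> fractal S c}"

lemma mem_fractal_iff:
  assumes m: "m \<ge> 2" and S: "patterns_system m S"
  shows "p \<in> fractal S c \<longleftrightarrow>
    (\<forall>n. \<exists>w. length w = Suc n \<and> word m S c w \<and> p \<in> (\<lambda>x. point (word_map m w x)) ` H)"
proof -
  have "fractal S c = (\<Inter>n\<in>{1..}. \<Union>A\<in>part (level S n) c True \<union> part (level S n) c False. solid A)"
    by (auto simp: fractal_def white_fractal_def yellow_fractal_def part_def)
  also have "{1..} = range Suc" by (auto simp: image_iff Suc_le_eq gr0_conv_Suc)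
  finally have eq: "p \<in> fractal S c \<longleftrightarrow>
      (\<forall>n. \<exists>A\<in>part (level S (Suc n)) c True \<union> part (level S (Suc n)) c False. p \<in> solid A)"
    by (simp add: bex_Un)
  have un: "part (level S (Suc n)) c True \<union> part (level S (Suc n)) c False =
      {triangle_of (word_map m w) | w. length w = Suc n \<and> word m S c w}" for n
    unfolding part_level[OF m S] by auto
  have "p \<in> fractal S c \<longleftrightarrow>
      (\<forall>n. \<exists>w. length w = Suc n \<and> word m S c w \<and> p \<in> solid (triangle_of (word_map m w)))"
    unfolding eq un by blast
  also have "\<dots> \<longleftrightarrow> (\<forall>n. \<exists>w. length w = Suc n \<and> word m S c w \<and> p \<in> (\<lambda>x. point (word_map m w x)) ` H)"
    using solid_triangle_of[OF affine_comb_word_map[OF m], of S c] by (simp cong: conj_cong)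
  finally show ?thesis .
qed

lemma mem_bary_fractal_iff:
  assumes m: "m \<ge> 2" and S: "patterns_system m S"
  shows "x \<in> bary_fractal S c \<longleftrightarrow>
    (\<forall>n. \<exists>w. length w = Suc n \<and> word m S c w \<and> x \<in> word_map m w ` H)"
proof -
  have *: "(\<Sum>i\<in>UNIV. x $ i) = 1 \<and> point x \<in> (\<lambda>x. point (word_map m w x)) ` H \<longleftrightarrow> x \<in> word_map m w ` H"
    if w: "word m S c w" for w
  proof
    assume a: "(\<Sum>i\<in>UNIV. x $ i) = 1 \<and> point x \<in> (\<lambda>x. point (word_map m w x)) ` H"
    then obtain y where y: "y \<in> H" "point x = point (word_map m w y)" by auto
    then have "x = word_map m w y"
      using a word_map_sum[OF m w] by (intro point_inj) (auto simp: H_iff)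
    then show "x \<in> word_map m w ` H" using y by auto
  qed (use word_map_sum[OF m w] in \<open>auto simp: H_iff\<close>)
  show ?thesis
    unfolding bary_fractal_def mem_Collect_eq mem_fractal_iff[OF m S] using * by blast
qed

lemma bary_fractal_H:
  assumes m: "m \<ge> 2" and S: "patterns_system m S" and "x \<in> bary_fractal S c"
  shows "x \<in> H"
proof -
  obtain w y where "word m S c w" "x = word_map m w y" "y \<in> H"
    using assms(3) unfolding mem_bary_fractal_iff[OF m S] by blast
  then show ?thesis using word_map_H[OF m] by blast
qed

lemma closed_fractal:
  assumes m: "m \<ge> 2" and S: "patterns_system m S"
  shows "closed (fractal S c)"
proof -
  have fin: "finite (part (level S (Suc n)) c d)" for n d
  proof -
    have "{w. length w = Suc n \<and> word m S c w} \<subseteq> {w. set w \<subseteq> cells m \<and> length w = Suc n}"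
    proof -
      have "set w \<subseteq> cells m" if "word m S c w" for w c
        using that by (induction w arbitrary: c) (auto simp: pattern_def)
      then show ?thesis by auto
    qed
    then have f: "finite {w. length w = Suc n \<and> word m S c w}"
      by (rule finite_subset) (rule finite_lists_length_eq[OF finite_cells])
    have s: "part (level S (Suc n)) c d \<subseteq> (\<lambda>w. triangle_of (word_map m w)) ` {w. length w = Suc n \<and> word m S c w}"
      unfolding part_level[OF m S] by auto
    show ?thesis by (rule finite_subset[OF s finite_imageI[OF f]])
  qed
  have "fractal S c = (\<Inter>n\<in>{1..}. \<Union>A\<in>part (level S n) c True \<union> part (level S n) c False. solid A)"
    by (auto simp: fractal_def white_fractal_def yellow_fractal_def part_def)
  also have "{1..} = range Suc" by (auto simp: image_iff Suc_le_eq gr0_conv_Suc)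
  finally show ?thesis using fin by (auto intro!: closed_INT closed_UN closed_solid)
qed

lemma closed_bary_fractal:
  assumes m: "m \<ge> 2" and S: "patterns_system m S"
  shows "closed (bary_fractal S c)"
proof -
  have "bary_fractal S c = {x. (\<Sum>i\<in>UNIV. x $ i) = 1} \<inter> point -` fractal S c"
    by (auto simp: bary_fractal_def)
  moreover have "closed {x :: real^3. (\<Sum>i\<in>UNIV. x $ i) = 1}"
    by (intro closed_Collect_eq continuous_intros)
  moreover have "closed (point -` fractal S c)"
    by (rule closed_vimage[OF closed_fractal[OF m S] continuous_point])
  ultimately show ?thesis by (simp add: closed_Int)
qed

text \<open>The words that contain \<open>x\<close> may begin differently at each length. But there
  are finitely many first letters, and a word works only if its prefixes do, so one first letter
  serves all lengths.\<close>

lemma bary_fractal_step: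
  assumes m: "m \<ge> 2" and S: "patterns_system m S" and x: "x \<in> bary_fractal S c"
  shows "\<exists>a\<in>pattern m S c. \<exists>y\<in>bary_fractal S (c = fst a). x = cell_map m a y"
proof (rule ccontr)
  assume contra: "\<not> ?thesis"
  have inv: "cell_inv m a (cell_map m a z) = z" "cell_map m a (cell_inv m a z) = z" for a z
    using m by (simp_all add: cell_inv_def cell_map_def)
  have "\<exists>n. \<forall>w. length w = Suc n \<longrightarrow> word m S (c = fst a) w \<longrightarrow> cell_inv m a x \<notin> word_map m w ` H"
    if "a \<in> pattern m S c" for a
    using contra that inv(2)[of a x] mem_bary_fractal_iff[OF m S, of "cell_inv m a x" "c = fst a"] by metis
  then obtain N where N: "\<And>a w. a \<in> pattern m S c \<Longrightarrow> length w = Suc (N a) \<Longrightarrow> word m S (c = fst a) w \<Longrightarrow>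
      cell_inv m a x \<notin> word_map m w ` H" by metis
  have fin: "finite (pattern m S c)" using finite_cells by (auto simp: pattern_def)
  \<comment> \<open>Long enough that the word behind any first letter \<open>a\<close> has a prefix
    of the length \<open>Suc (N a)\<close> at which \<open>a\<close> fails.\<close>
  define M where "M = Suc (Max (N ` pattern m S c))"
  obtain v where v: "length v = Suc M" "word m S c v" "x \<in> word_map m v ` H"
    using x unfolding mem_bary_fractal_iff[OF m S] by blast
  then obtain a w where aw: "v = a # w" by (cases v) auto
  have a: "a \<in> pattern m S c" "word m S (c = fst a) w" using v aw by auto
  have "N a \<le> Max (N ` pattern m S c)" using fin a by (intro Max_ge) auto
  then have len: "Suc (N a) \<le> length w" using v aw by (simp add: M_def)
  define w1 w2 where "w1 = take (Suc (N a)) w" and "w2 = drop (Suc (N a)) w"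
  have w: "w = w1 @ w2" "length w1 = Suc (N a)" using len by (auto simp: w1_def w2_def)
  have words: "word m S (c = fst a) w1" "word m S (word_colour (c = fst a) w1) w2"
    using a(2) unfolding w(1) word_append by auto
  obtain z where z: "z \<in> H" "x = cell_map m a (word_map m w1 (word_map m w2 z))"
    using v(3) aw w(1) by (auto simp: word_map_append)
  have "cell_inv m a x \<in> word_map m w1 ` H" using z word_map_H[OF m words(2)] by (auto simp: inv)
  then show False using N[OF a(1) w(2) words(1)] by simp
qed

section \<open>Labyrinth patterns systems\<close>

definition exit_cell :: "nat \<Rightarrow> int^3 \<Rightarrow> bool \<Rightarrow> 3 \<Rightarrow> int^3" where
  "exit_cell m k c i =
     (if c then
        (if i = 1 then vector [0, k $ 1, int m - 1 - k $ 1]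
         else if i = 2 then vector [k $ 2, 0, int m - 1 - k $ 2]
         else vector [k $ 3, int m - 1 - k $ 3, 0])
      else
        (if i = 1 then vector [0, int m - 1 - k $ 1, k $ 1]
         else if i = 2 then vector [int m - 1 - k $ 2, 0, k $ 2]
         else vector [int m - 1 - k $ 3, k $ 3, 0]))"

lemma white_exit_eq: "white_exit m k i = cell_triangle m (True, exit_cell m k True i)"
  by (simp add: white_exit_def exit_cell_def T_eq)

lemma yellow_exit_eq: "yellow_exit m k i = cell_triangle m (True, exit_cell m k False i)"
  by (simp add: yellow_exit_def exit_cell_def T_eq)

lemma exit_cell_self: "exit_cell m k c j $ j = 0"
  using exhaust_3[of j] by (auto simp: exit_cell_def)

lemma exit_cell_sum: "i \<noteq> j \<Longrightarrow> exit_cell m k c j $ i + exit_cell m k (\<not> c) j $ i = int m - 1"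
  using exhaust_3[of j] exhaust_3[of i] by (auto simp: exit_cell_def)

lemma exit_cell_cells: "k $ j \<in> {0..int m - 1} \<Longrightarrow> (True, exit_cell m k c j) \<in> cells m"
  using exhaust_3[of j] by (auto simp: exit_cell_def cells_def forall_3 sum_3)

lemma exit_triple_iff:
  "exit_triple m S k \<longleftrightarrow>
     (\<forall>i. k $ i \<in> {0..int m - 1} \<and> (\<forall>c. (True, exit_cell m k c i) \<in> pattern m S c))"
proof -
  have "(\<forall>c. (True, exit_cell m k c i) \<in> pattern m S c) \<longleftrightarrow>
      white_exit m k i \<in> white_up S \<and> yellow_exit m k i \<in> yellow_up S"
    if "k $ i \<in> {0..int m - 1}" for i
    using exit_cell_cells[OF that] unfolding all_bool_eq pattern_def
    by (simp add: white_exit_eq yellow_exit_eq part_def)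
  then show ?thesis unfolding exit_triple_def by blast
qed

text \<open>Uniqueness is assumed for the triple as a whole. Replacing its \<open>j\<close>-th entry
  by the one read off from \<open>u\<close> and \<open>v\<close> gives another valid triple, hence
  the same one.\<close>

lemma exit_cell_unique:
  assumes ex1: "\<exists>!k. exit_triple m S k" and k: "exit_triple m S k"
    and uv: "(True, u) \<in> pattern m S c" "(True, v) \<in> pattern m S (\<not> c)" "u $ j = 0" "v $ j = 0"
    and sum: "\<And>i. i \<noteq> j \<Longrightarrow> u $ i + v $ i = int m - 1"
  shows "u = exit_cell m k c j"
proof -
  define w y where "w = (if c then u else v)" and "y = (if c then v else u)"
  have wy: "(True, w) \<in> pattern m S True" "(True, y) \<in> pattern m S False" "w $ j = 0" "y $ j = 0"
    using uv by (auto simp: w_def y_def)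
  have sum': "w $ i + y $ i = int m - 1" if "i \<noteq> j" for i
    using sum[OF that] by (auto simp: w_def y_def)
  have nn: "0 \<le> w $ i" "0 \<le> y $ i" for i using wy by (auto simp: pattern_def cells_def)
  have tot: "w $ 1 + w $ 2 + w $ 3 = int m - 1" using wy by (auto simp: pattern_def cells_def sum_3)
  \<comment> \<open>The coordinate in which the white exit cell of side \<open>j\<close> stores
    \<open>k $ j\<close>.\<close>
  define p :: 3 where "p = (if j = 1 then 2 else 1)"
  have "p \<noteq> j" by (simp add: p_def)
  define k' :: "int^3" where "k' = (\<chi> i. if i = j then w $ p else k $ i)"
  have other: "exit_cell m k' d i = exit_cell m k d i" if "i \<noteq> j" for d i
    using that exhaust_3[of i] by (auto simp: exit_cell_def k'_def)
  have w: "exit_cell m k' True j = w" and y: "exit_cell m k' False j = y"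
    using exhaust_3[of j] wy(3,4) tot sum'[of 1] sum'[of 2] sum'[of 3]
    by (auto simp: exit_cell_def k'_def p_def vec_eq_iff forall_3)
  have "exit_triple m S k'"
    unfolding exit_triple_iff
  proof (intro allI)
    fix i
    show "k' $ i \<in> {0..int m - 1} \<and> (\<forall>c. (True, exit_cell m k' c i) \<in> pattern m S c)"
    proof (cases "i = j")
      case True
      then show ?thesis
        using wy w y nn[of p] sum'[OF \<open>p \<noteq> j\<close>] by (auto simp: all_bool_eq k'_def)
    next
      case False
      then show ?thesis using k other unfolding exit_triple_iff by (auto simp: k'_def)
    qed
  qed
  then have "k' = k" using ex1 k by blast
  then show ?thesis using w y by (cases c) (auto simp: w_def y_def)
qed

lemma corner_cell:
  assumes m: "m \<ge> 2" and u: "(True, u) \<in> pattern m S c" "u $ i = int m - 1"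
  shows "cell_triangle m (True, u) \<in> corner_triangles (part S c True)" "l \<noteq> i \<Longrightarrow> u $ l = 0"
proof -
  have cells: "(True, u) \<in> cells m" using u by (simp add: pattern_def)
  have other: "u $ l = 0" if "l \<noteq> i" for l
  proof -
    obtain k where "k \<noteq> l" "k \<noteq> i" using other_index_3 by blast
    then show ?thesis
      using cells u(2) that sum_UNIV_3_eq[of l i k "\<lambda>l. u $ l"]
      by (auto simp: cells_def) (smt (verit, best))
  qed
  then show "l \<noteq> i \<Longrightarrow> u $ l = 0" .
  have "cell_map m (True, u) (unit_vec i) = unit_vec i"
    using m u(2) other by (auto simp: vec_eq_iff cell_map_nth unit_vec_nth)
  then have "P $ i = cell_triangle m (True, u) $ i"
    by (simp add: cell_triangle_def triangle_of_def point_unit_vec)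
  then have "P $ i \<in> solid (cell_triangle m (True, u))"
    unfolding solid_def by (simp add: hull_inc)
  then show "cell_triangle m (True, u) \<in> corner_triangles (part S c True)"
    using u(1) by (auto simp: corner_triangles_def pattern_def)
qed

definition graph :: "nat \<Rightarrow> patterns \<Rightarrow> bool \<Rightarrow> triangle pair_pre_digraph" where
  "graph m S c = pattern_graph m (part S c True \<union> part S c False)"

lemma graph_cases: "graph m S True = white_graph m S" "graph m S False = yellow_graph m S"
  by (simp_all add: graph_def white_graph_def yellow_graph_def part_def)

context
  fixes m :: nat and S :: patterns
  assumes m: "m \<ge> 2" and lab: "labyrinth_patterns_system m S"
begin

lemma system: "patterns_system m S"
  using lab by (simp add: labyrinth_patterns_system_def)

lemma pverts_graph: "pverts (graph m S c) = cell_triangle m ` pattern m S c"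
  unfolding graph_def pattern_graph_def part_eq[OF system] by auto

lemma inj_pattern: "inj_on (cell_triangle m) (pattern m S c)"
  using cell_triangle_inj[OF m] by (auto simp: inj_on_def pattern_def)

lemma parcs_graph:
  assumes "a \<in> pattern m S c" "b \<in> pattern m S c"
  shows "(cell_triangle m a, cell_triangle m b) \<in> parcs (graph m S c) \<longleftrightarrow> adj a b"
proof -
  have "cell_triangle m a \<in> pverts (graph m S c)" "cell_triangle m b \<in> pverts (graph m S c)"
    using assms by (auto simp: pverts_graph)
  moreover have "a \<in> cells m" "b \<in> cells m" using assms by (auto simp: pattern_def)
  ultimately show ?thesis
    using neighbours_iff[OF m] by (simp add: graph_def pattern_graph_def adj_def linked_def)
qed

lemma parcs_sym: "(A, B) \<in> parcs (graph m S c) \<Longrightarrow> (B, A) \<in> parcs (graph m S c)"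
  by (auto simp: graph_def pattern_graph_def)

lemma graph_tree: "undirected_tree (graph m S c)"
  using lab by (cases c) (auto simp: graph_cases labyrinth_patterns_system_def tree_property_def)

lemma graph_path_iff:
  assumes "set xs \<subseteq> pattern m S c"
  shows "simple_path (\<lambda>a b. (a, b) \<in> parcs (graph m S c)) (pverts (graph m S c)) (map (cell_triangle m) xs)
    \<longleftrightarrow> simple_path adj (pattern m S c) xs"
  unfolding pverts_graph
proof (rule simple_path_map_iff)
  show "(cell_triangle m a, cell_triangle m b) \<in> parcs (graph m S c) \<longleftrightarrow> adj a b"
    if "a \<in> pattern m S c" "b \<in> pattern m S c" for a b by (rule parcs_graph[OF that])
qed (use inj_pattern assms in auto)

lemma pattern_path_exists:
  assumes "a \<in> pattern m S c" "b \<in> pattern m S c"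
  shows "\<exists>xs. simple_path adj (pattern m S c) xs \<and> hd xs = a \<and> last xs = b"
proof -
  let ?f = "cell_triangle m" and ?V = "pattern m S c"
  obtain p where p: "simple_path (\<lambda>a b. (a, b) \<in> parcs (graph m S c)) (pverts (graph m S c)) p"
      "hd p = ?f a" "last p = ?f b"
    using undirected_tree_path_exists[OF graph_tree[of c] parcs_sym[where c = c], where u = "?f a" and v = "?f b"] assms
    by (auto simp: pverts_graph)
  define xs where "xs = map (inv_into ?V ?f) p"
  have sub: "set p \<subseteq> ?f ` ?V" "p \<noteq> []" using p(1) by (auto simp: simple_path_def pverts_graph)
  have "inv_into ?V ?f A \<in> ?V" if "A \<in> set p" for A
    using that sub(1) by (intro inv_into_into) blast
  then have "set xs \<subseteq> ?V" by (simp add: xs_def image_subset_iff)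
  moreover have "map ?f xs = p"
    using sub by (auto simp: xs_def f_inv_into_f subset_iff intro!: map_idI)
  ultimately have "simple_path adj ?V xs" using p(1) graph_path_iff by metis
  moreover have "hd xs = a" "last xs = b"
    using p sub(2) inv_into_f_f[OF inj_pattern] assms by (auto simp: xs_def hd_map last_map)
  ultimately show ?thesis by blast
qed

lemma pattern_path_unique:
  assumes "simple_path adj (pattern m S c) xs" "simple_path adj (pattern m S c) ys"
    and "hd xs = hd ys" "last xs = last ys"
  shows "xs = ys"
proof -
  have sub: "set xs \<subseteq> pattern m S c" "set ys \<subseteq> pattern m S c" "xs \<noteq> []" "ys \<noteq> []"
    using assms by (auto simp: simple_path_def)
  have "map (cell_triangle m) xs = map (cell_triangle m) ys"
    by (rule undirected_tree_path_unique[OF graph_tree[of c] parcs_sym[where c = c]])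
      (use assms sub in \<open>auto simp: graph_path_iff hd_map last_map\<close>)
  moreover have "inj_on (cell_triangle m) (set xs \<union> set ys)"
    by (rule inj_on_subset[OF inj_pattern[of c]]) (use sub in simp)
  ultimately show ?thesis by (simp add: inj_on_map_eq_map)
qed

lemma tree_path_eq:
  assumes "simple_path adj (pattern m S c) xs"
  shows "tree_path (graph m S c) (cell_triangle m (hd xs)) (cell_triangle m (last xs)) = map (cell_triangle m) xs"
  unfolding tree_path_def vpath_iff_simple_path
proof (rule the_equality)
  have sub: "set xs \<subseteq> pattern m S c" "xs \<noteq> []" using assms by (auto simp: simple_path_def)
  let ?Q = "\<lambda>p. simple_path (\<lambda>a b. (a, b) \<in> parcs (graph m S c)) (pverts (graph m S c)) p \<and>
    hd p = cell_triangle m (hd xs) \<and> last p = cell_triangle m (last xs)"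
  show Q: "?Q (map (cell_triangle m) xs)"
    using assms sub by (simp add: graph_path_iff hd_map last_map)
  show "p = map (cell_triangle m) xs" if "?Q p" for p
    by (rule undirected_tree_path_unique[OF graph_tree[of c] parcs_sym[where c = c]]) (use that Q in auto)
qed

definition exit_index :: "int^3" where
  "exit_index = (THE k. exit_triple m S k)"

lemma exit_index: "exit_triple m S exit_index"
  using lab theI'[of "exit_triple m S"] by (simp add: exit_index_def labyrinth_patterns_system_def exits_property_def)

lemma labyrinth_bary_fractal: "labyrinth m (pattern m S) (exit_cell m exit_index) (bary_fractal S)"
proof
  show "m \<ge> 2" by (rule m)
  have cells: "a \<in> cells m" if "a \<in> pattern m S c" for a c using that by (simp add: pattern_def)
  show "0 \<le> u $ i" "(\<Sum>i\<in>UNIV. u $ i) = int m - 1" if "(True, u) \<in> pattern m S c" for u c i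
    using cells[OF that] by (auto simp: cells_def)
  show "1 \<le> u $ i" "(\<Sum>i\<in>UNIV. u $ i) = int m + 1" if "(False, u) \<in> pattern m S c" for u c i
    using cells[OF that] by (auto simp: cells_def)
  show "finite (pattern m S c)" for c
    using finite_cells by (rule finite_subset[rotated]) (auto simp: pattern_def)
  show "(True, exit_cell m exit_index c j) \<in> pattern m S c" for c j
    using exit_index by (simp add: exit_triple_iff)
  show "exit_cell m exit_index c j $ j = 0" for c j by (rule exit_cell_self)
  show "exit_cell m exit_index c j $ i + exit_cell m exit_index (\<not> c) j $ i = int m - 1" if "i \<noteq> j" for c i j
    by (rule exit_cell_sum[OF that])
  show "u = exit_cell m exit_index c j"
    if "(True, u) \<in> pattern m S c" "(True, v) \<in> pattern m S (\<not> c)" "u $ j = 0" "v $ j = 0"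
      "\<And>i. i \<noteq> j \<Longrightarrow> u $ i + v $ i = int m - 1" for u v c j
    by (rule exit_cell_unique[OF _ exit_index that])
      (use lab in \<open>auto simp: labyrinth_patterns_system_def exits_property_def\<close>)
  have corners: "corners_property S" using lab by (simp add: labyrinth_patterns_system_def)
  show "i = j" if "(True, u) \<in> pattern m S c" "u $ i = int m - 1" "(True, v) \<in> pattern m S c" "v $ j = int m - 1"
    for u v c i j
  proof (rule ccontr)
    assume "i \<noteq> j"
    have "cell_triangle m (True, u) = cell_triangle m (True, v)"
      using corner_cell(1)[OF m that(1,2)] corner_cell(1)[OF m that(3,4)] corners
      by (cases c) (auto simp: corners_property_def part_def)
    then have "u = v" using cell_triangle_inj[OF m cells[OF that(1)] cells[OF that(3)]] by simp
    then show False using corner_cell(2)[OF m that(1,2), of j] \<open>i \<noteq> j\<close> that(4) m by simp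
  qed
  show "(True, u) \<notin> pattern m S (\<not> c)" if "(True, u) \<in> pattern m S c" "u $ i = int m - 1" for u c i
  proof
    assume "(True, u) \<in> pattern m S (\<not> c)"
    then show False
      using corner_cell(1)[OF m that] corner_cell(1)[OF m _ that(2), of S "\<not> c"] corners
      by (cases c) (auto simp: corners_property_def part_def)
  qed
  show "\<exists>xs. simple_path adj (pattern m S c) xs \<and> hd xs = a \<and> last xs = b"
    if "a \<in> pattern m S c" "b \<in> pattern m S c" for a b c by (rule pattern_path_exists[OF that])
  show "xs = ys" if "simple_path adj (pattern m S c) xs" "simple_path adj (pattern m S c) ys"
    "hd xs = hd ys" "last xs = last ys" for xs ys c by (rule pattern_path_unique[OF that])
  show "0 \<le> x $ i" "(\<Sum>i\<in>UNIV. x $ i) = 1" if "x \<in> bary_fractal S c" for x c i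
    using bary_fractal_H[OF m system that] by (auto simp: H_iff)
  show "closed (bary_fractal S c)" for c by (rule closed_bary_fractal[OF m system])
  show "\<exists>a\<in>pattern m S c. \<exists>y\<in>bary_fractal S (c = fst a). x = cell_map m a y"
    if "x \<in> bary_fractal S c" for x c by (rule bary_fractal_step[OF m system that])
qed

definition exit_path_triangles :: "bool \<Rightarrow> 3 \<Rightarrow> 3 \<Rightarrow> triangle list" where
  "exit_path_triangles c i j = (if c then white_path m S i j else yellow_path m S i j)"

lemma exit_path_triangles_eq:
  assumes "simple_path adj (pattern m S c) xs"
    and "hd xs = (True, exit_cell m exit_index c i)" "last xs = (True, exit_cell m exit_index c j)"
  shows "exit_path_triangles c i j = map (cell_triangle m) xs"
  using tree_path_eq[OF assms(1)] assms(2,3)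
  by (cases c) (simp_all add: exit_path_triangles_def white_path_def yellow_path_def Let_def
      exit_index_def white_exit_eq yellow_exit_eq graph_cases)

lemma pair_blocked_iff:
  "pair_blocked m S \<pi> \<longleftrightarrow> (\<exists>i j k c. \<pi> = {i, j} \<and> i \<noteq> j \<and> {k} = UNIV - {i, j} \<and>
     path_blocked m k (exit_path_triangles c i j))"
  unfolding pair_blocked_def ex_bool_eq exit_path_triangles_def if_True if_False by blast

lemma strip_index_bounds: "a \<in> cells m \<Longrightarrow> strip_index i a \<in> {0..int m - 1}"
proof -
  have *: "0 \<le> k $ i \<and> k $ i \<le> n" if "k \<in> idx n" for k n
    using that member_le_sum[of i UNIV "\<lambda>i. k $ i"] by (auto simp: idx_def)
  assume "a \<in> cells m"
  then show ?thesis by (rule cells_cases) (use * in \<open>force simp: strip_index_def\<close>)+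
qed

lemma path_blocked_iff:
  assumes "set xs \<subseteq> cells m" "xs \<noteq> []"
  shows "path_blocked m z (map (cell_triangle m) xs) \<longleftrightarrow> \<not> (\<exists>n. \<forall>a\<in>set xs. strip_index z a = n)"
proof -
  have *: "(\<exists>K\<in>{0..int m - 1}. cell_triangle m a \<in> strip m z K \<and> cell_triangle m b \<in> strip m z K)
      \<longleftrightarrow> strip_index z a = strip_index z b" if "a \<in> set xs" "b \<in> set xs" for a b
    using strip_iff[OF m] strip_index_bounds that assms(1) by (metis subsetD)
  have "path_blocked m z (map (cell_triangle m) xs) \<longleftrightarrow> (\<exists>a\<in>set xs. \<exists>b\<in>set xs.
      \<not> (\<exists>K\<in>{0..int m - 1}. cell_triangle m a \<in> strip m z K \<and> cell_triangle m b \<in> strip m z K))"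
    unfolding path_blocked_def set_map by blast
  also have "\<dots> \<longleftrightarrow> (\<exists>a\<in>set xs. \<exists>b\<in>set xs. strip_index z a \<noteq> strip_index z b)"
    by (intro bex_cong refl) (simp only: *)
  also have "\<dots> \<longleftrightarrow> \<not> (\<exists>n. \<forall>a\<in>set xs. strip_index z a = n)"
    by (metis assms(2) hd_in_set)
  finally show ?thesis .
qed

lemma pair_in_index_pairs: "i \<noteq> j \<Longrightarrow> {i, j} \<in> index_pairs"
  using exhaust_3[of i] exhaust_3[of j] by (auto simp: index_pairs_def)

lemma blocked_labyrinth_bary_fractal:
  assumes uniq: "\<exists>!\<pi>'. \<pi>' \<in> index_pairs \<and> \<not> pair_blocked m S \<pi>'"
    and ij: "\<not> pair_blocked m S {i, j}" "i \<noteq> j" "i \<noteq> k" "j \<noteq> k"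
  shows "blocked_labyrinth m (pattern m S) (exit_cell m exit_index) (bary_fractal S) i j k"
proof -
  interpret labyrinth m "pattern m S" "exit_cell m exit_index" "bary_fractal S"
    by (rule labyrinth_bary_fractal)
  have sub: "set xs \<subseteq> cells m" "xs \<noteq> []" if "simple_path adj (pattern m S c) xs" for xs c
    using that by (auto simp: simple_path_def pattern_def)
  have compl: "{z} = UNIV - {x, y}" if "x \<noteq> y" "x \<noteq> z" "y \<noteq> z" for x y z :: 3
    using UNIV_3_eq[OF that] that by auto
  show ?thesis
  proof
    show "i \<noteq> j" "i \<noteq> k" "j \<noteq> k" by fact+
    show "exit_cell m exit_index c i $ k = exit_cell m exit_index c j $ k" for c
    proof -
      obtain xs where xs: "simple_path adj (pattern m S c) xs"
          "hd xs = (True, exit_cell m exit_index c i)" "last xs = (True, exit_cell m exit_index c j)"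
        using paths(1)[OF exits(1) exits(1)] by blast
      have "\<not> path_blocked m k (exit_path_triangles c i j)"
        using ij compl[OF ij(2-4)] unfolding pair_blocked_iff by blast
      then obtain n where "\<forall>a\<in>set xs. strip_index k a = n"
        unfolding exit_path_triangles_eq[OF xs] path_blocked_iff[OF sub[OF xs(1)]] by blast
      \<comment> \<open>Both ends are up cells, whose strip index is the entry itself: a path within
        one strip of type \<open>k\<close> joins exits of equal height.\<close>
      then have "strip_index k (hd xs) = strip_index k (last xs)" using sub[OF xs(1)] by simp
      then show ?thesis using xs by (simp add: strip_index_def)
    qed
    show "\<exists>c xs. simple_path adj (pattern m S c) xs \<and> hd xs = (True, exit_cell m exit_index c x) \<and>
        last xs = (True, exit_cell m exit_index c k) \<and> \<not> (\<exists>n. \<forall>a\<in>set xs. strip_index z a = n)"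
      if x: "x \<in> {i, j}" and z: "z \<noteq> x" "z \<noteq> k" for x z
    proof -
      have "x \<noteq> k" using x ij by auto
      then have "{x, k} \<noteq> {i, j}" using ij by auto
      then have "pair_blocked m S {x, k}"
        using uniq ij(1) pair_in_index_pairs[OF ij(2)] pair_in_index_pairs[OF \<open>x \<noteq> k\<close>] by blast
      then obtain i' j' k' c where b: "{x, k} = {i', j'}" "{k'} = UNIV - {i', j'}"
          "path_blocked m k' (exit_path_triangles c i' j')"
        unfolding pair_blocked_iff by blast
      have "{k'} = {z}" using b(1,2) compl[of x k z] \<open>x \<noteq> k\<close> z by simp
      then have "k' = z" by simp
      obtain xs where xs: "simple_path adj (pattern m S c) xs"
          "hd xs = (True, exit_cell m exit_index c i')" "last xs = (True, exit_cell m exit_index c j')"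
        using paths(1)[OF exits(1) exits(1)] by blast
      have nb: "\<not> (\<exists>n. \<forall>a\<in>set xs. strip_index z a = n)"
        using b(3) unfolding exit_path_triangles_eq[OF xs] path_blocked_iff[OF sub[OF xs(1)]] \<open>k' = z\<close> .
      \<comment> \<open>The pair is unordered, so the blocked path may run from \<open>k\<close> to
        \<open>x\<close> and then has to be reversed.\<close>
      consider "i' = x" "j' = k" | "i' = k" "j' = x" using b(1) by (auto simp: doubleton_eq_iff)
      then show ?thesis
      proof cases
        case 1
        then show ?thesis using xs nb by blast
      next
        case 2
        have "simple_path adj (pattern m S c) (rev xs)" by (rule simple_path_rev[OF adj_sym xs(1)])
        moreover have "hd (rev xs) = last xs" "last (rev xs) = hd xs"
          using sub(2)[OF xs(1)] by (simp_all add: hd_rev last_rev)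
        ultimately show ?thesis using xs nb 2
          by (intro exI[of _ c] exI[of _ "rev xs"]) auto
      qed
    qed
  qed
qed

end

section \<open>Flat arcs are segments\<close>

lemma injective_path_real_image:
  fixes \<phi> :: "real \<Rightarrow> real"
  assumes "continuous_on {0..1} \<phi>" "inj_on \<phi> {0..1}"
  shows "\<phi> ` {0..1} = closed_segment (\<phi> 0) (\<phi> 1)"
proof
  show "\<phi> ` {0..1} \<subseteq> closed_segment (\<phi> 0) (\<phi> 1)"
  proof safe
    fix t :: real assume t: "t \<in> {0..1}"
    consider "t = 0" | "t = 1" | "0 < t" "t < 1" using t by force
    then show "\<phi> t \<in> closed_segment (\<phi> 0) (\<phi> 1)"
    proof cases
      case 3
      then show ?thesis using continuous_inj_imp_mono[OF 3 assms] by (auto simp: closed_segment_eq_real_ivl)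
    qed auto
  qed
  have "Topological_Spaces.connected (\<phi> ` {0..1})" by (intro connected_continuous_image assms) simp
  then have "convex (\<phi> ` {0..1})" by (simp add: is_interval_convex_1[symmetric] is_interval_connected_1)
  then show "closed_segment (\<phi> 0) (\<phi> 1) \<subseteq> \<phi> ` {0..1}" by (intro closed_segment_subset) auto
qed

text \<open>With the \<open>k\<close>-th coordinate fixed, the other two change by opposite amounts,
  so the arc moves along a line in the direction of side \<open>k\<close> with one real parameter,
  which is injective and therefore sweeps out exactly the segment.\<close>

lemma flat_path_segment:
  fixes g :: "real \<Rightarrow> real^2"
  assumes g: "Path_Connected.arc g"
    and flat: "\<And>t. t \<in> {0..1} \<Longrightarrow> coordinates (g t) $ k = coordinates (g 0) $ k"
  shows "path_image g = closed_segment (g 0) (g 1) \<and> parallel_to_side k (g 1 - g 0)"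
proof -
  have cont: "continuous_on {0..1} g" "inj_on g {0..1}"
    using g by (auto simp: Path_Connected.arc_def path_def)
  obtain a b where ab: "a \<noteq> k" "b \<noteq> k" "b \<noteq> a" using other_indices_3[of k] by blast
  define \<phi> where "\<phi> t = coordinates (g t) $ b - coordinates (g 0) $ b" for t
  define v where "v = P $ b - P $ a"
  have eq: "g t = g 0 + \<phi> t *\<^sub>R v" if t: "t \<in> {0..1}" for t
  proof -
    define d where "d = coordinates (g t) - coordinates (g 0)"
    have "(\<Sum>i\<in>UNIV. d $ i) = 0" by (simp add: d_def sum_subtractf sum_coordinates)
    moreover have "d $ k = 0" using flat[OF t] by (simp add: d_def)
    ultimately have "d $ a = - d $ b" using sum_UNIV_3_eq[of a b k "\<lambda>l. d $ l"] ab by simp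
    have "g t - g 0 = point d" by (simp add: d_def linear_diff[OF linear_point])
    also have "\<dots> = d $ a *\<^sub>R P $ a + d $ b *\<^sub>R P $ b + d $ k *\<^sub>R P $ k"
      unfolding point_def using ab by (intro sum_UNIV_3_eq) auto
    also have "\<dots> = d $ b *\<^sub>R v"
      using \<open>d $ a = - d $ b\<close> \<open>d $ k = 0\<close> by (simp add: v_def scaleR_right_diff_distrib)
    also have "d $ b = \<phi> t" by (simp add: \<phi>_def d_def)
    finally show ?thesis by (simp add: algebra_simps)
  qed
  have "continuous_on {0..1} (\<lambda>t. coordinates (g t))"
    by (rule continuous_on_compose2[OF continuous_coordinates cont(1)]) auto
  then have \<phi>_cont: "continuous_on {0..1} \<phi>" unfolding \<phi>_def by (intro continuous_intros)
  have \<phi>_inj: "inj_on \<phi> {0..1}"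
    using cont(2) eq by (metis (mono_tags, lifting) inj_on_def)
  have end_eq: "\<phi> 0 = 0" "g 1 = g 0 + \<phi> 1 *\<^sub>R v" by (simp add: \<phi>_def, rule eq, simp)
  have "path_image g = (\<lambda>r. g 0 + r *\<^sub>R v) ` \<phi> ` {0..1}"
    unfolding path_image_def image_image by (rule image_cong[OF refl eq])
  also have "\<dots> = (\<lambda>r. g 0 + r *\<^sub>R v) ` closed_segment (\<phi> 0) (\<phi> 1)"
    by (simp only: injective_path_real_image[OF \<phi>_cont \<phi>_inj])
  also have "\<dots> = (+) (g 0) ` (\<lambda>r. r *\<^sub>R v) ` closed_segment (\<phi> 0) (\<phi> 1)"
    by (simp add: image_image)
  also have "\<dots> = closed_segment (g 0 + \<phi> 0 *\<^sub>R v) (g 0 + \<phi> 1 *\<^sub>R v)"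
    by (simp add: closed_segment_linear_image[symmetric] closed_segment_translation)
  also have "\<dots> = closed_segment (g 0) (g 1)" by (simp add: end_eq)
  finally have "path_image g = closed_segment (g 0) (g 1)" .
  moreover have "parallel_to_side k (g 1 - g 0)"
  proof -
    have "P $ a \<in> side k" "P $ b \<in> side k" unfolding side_def using ab by (auto intro: hull_inc)
    moreover have "P $ a \<noteq> P $ b"
    proof
      assume "P $ a = P $ b"
      then have "unit_vec a = unit_vec b"
        using unit_vec_H by (intro point_inj) (auto simp: point_unit_vec H_iff)
      then show False using ab unit_vec_nth[of a a] unit_vec_nth[of b a] by auto
    qed
    moreover have "g 1 - g 0 = \<phi> 1 *\<^sub>R (P $ b - P $ a)" using end_eq(2) by (simp add: v_def)
    ultimately show ?thesis unfolding parallel_to_side_def by blast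
  qed
  ultimately show ?thesis by blast
qed

theorem proposition10p8:
  fixes m :: nat and S :: patterns and \<pi> :: "3 set" and k :: 3
  assumes "m \<ge> 2"
    and "labyrinth_patterns_system m S"
    and "\<exists>!\<pi>'. \<pi>' \<in> index_pairs \<and> \<not> pair_blocked m S \<pi>'"
    and "\<pi> \<in> index_pairs" and "\<not> pair_blocked m S \<pi>"
    and "{k} = UNIV - \<pi>"
  shows "\<forall>L\<in>{white_fractal S, yellow_fractal S}. \<forall>x\<in>L. \<forall>y\<in>L. \<forall>g :: real \<Rightarrow> real^2.
    x \<noteq> y \<and> Path_Connected.arc g \<and> path_image g \<subseteq> L \<and> pathstart g = x \<and> pathfinish g = y \<longrightarrow>
      (hausdorff_measure1 (path_image g) < \<infinity> \<longleftrightarrow>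
       path_image g = closed_segment x y \<and> closed_segment x y \<subseteq> L \<and> parallel_to_side k (y - x))"
proof (intro ballI allI impI, elim conjE)
  fix L x y and g :: "real \<Rightarrow> real^2"
  assume L: "L \<in> {white_fractal S, yellow_fractal S}"
    and g: "Path_Connected.arc g" "path_image g \<subseteq> L" "pathstart g = x" "pathfinish g = y"
  obtain c where c: "L = fractal S c" using L by (metis fractal_def insertE singletonD)
  obtain i j where ij: "\<pi> = {i, j}" "i \<noteq> j" using assms(4) by (auto simp: index_pairs_def)
  have k: "k \<notin> {i, j}" using assms(6) ij(1) by blast
  interpret blocked_labyrinth m "pattern m S" "exit_cell m (exit_index m S)" "bary_fractal S" i j k
    by (rule blocked_labyrinth_bary_fractal) (use assms ij k in auto)
  have cont: "continuous_on {0..1} g" "inj_on g {0..1}" "g ` {0..1} \<subseteq> L" "g 0 = x" "g 1 = y"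
    using g by (auto simp: Path_Connected.arc_def path_def path_image_def pathstart_def pathfinish_def)
  show "hausdorff_measure1 (path_image g) < \<infinity> \<longleftrightarrow>
      path_image g = closed_segment x y \<and> closed_segment x y \<subseteq> L \<and> parallel_to_side k (y - x)"
  proof
    assume fin: "hausdorff_measure1 (path_image g) < \<infinity>"
    have "arc_length g 0 1 < \<infinity>"
      using arc_length_le_hausdorff[OF cont(1,2)] fin unfolding path_image_def by (rule le_less_trans)
    then have "ennreal 12 * arc_length g 0 1 < \<infinity>" by (simp add: ennreal_mult_less_top)
    then have len: "arc_length (\<lambda>t. coordinates (g t)) 0 1 < \<infinity>"
      by (rule le_less_trans[OF arc_length_scale_le, rotated -1]) (auto intro: dist_coordinates)
    have arc: "arc_in (bary_fractal S c) (\<lambda>t. coordinates (g t)) 0 1"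
    proof -
      have "continuous_on {0..1} (\<lambda>t. coordinates (g t))"
        by (rule continuous_on_compose2[OF continuous_coordinates cont(1)]) auto
      moreover have "inj_on (\<lambda>t. coordinates (g t)) {0..1}"
        using cont(2) unfolding inj_on_def by (metis point_coordinates)
      moreover have "(\<lambda>t. coordinates (g t)) ` {0..1} \<subseteq> bary_fractal S c"
        using cont(3) c by (auto simp: bary_fractal_def sum_coordinates)
      ultimately show ?thesis by (simp add: arc_in_def)
    qed
    \<comment> \<open>\<open>finite_arc_flat\<close> compares only the two ends of an arc, so it is
      applied to every initial piece.\<close>
    have "coordinates (g t) $ k = coordinates (g 0) $ k" if t: "t \<in> {0..1}" for t
    proof (rule finite_arc_flat)
      show "arc_in (bary_fractal S c) (\<lambda>t. coordinates (g t)) 0 t"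
        by (rule arc_in_sub[OF arc]) (use t arc in \<open>auto simp: arc_in_def\<close>)
      show "arc_length (\<lambda>t. coordinates (g t)) 0 t < \<infinity>"
        using arc_length_mono[of 0 0 t 1] len t by (auto intro: le_less_trans)
    qed
    then show "path_image g = closed_segment x y \<and> closed_segment x y \<subseteq> L \<and> parallel_to_side k (y - x)"
      using flat_path_segment[OF g(1)] g(2) cont(4,5) by auto
  next
    assume "path_image g = closed_segment x y \<and> closed_segment x y \<subseteq> L \<and> parallel_to_side k (y - x)"
    then show "hausdorff_measure1 (path_image g) < \<infinity>"
      using hausdorff_measure1_segment[of x y] by simp
  qed
qed

end
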